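(* Let $H:\mathbb{CP}^1\times\mathbb{CP}^1\dashrightarrow\mathbb{CP}^1\times\mathbb{CP}^1$ be the projective heat map on pentagons, i.e. the rational map given in affine coordinates by $H(x,y)=(x',y')$ with $$x'=\frac{(xy^2+2xy-3)(x^2y^2-6xy-x+6)}{(xy^2+4xy+x-y-5)(x^2y^2-6xy-y+6)},\qquad y'=\frac{(x^2y+2xy-3)(x^2y^2-6xy-y+6)}{(x^2y+4xy-x+y-5)(x^2y^2-6xy-x+6)}.$$ Then $H$ has no invariant fibration.
   Context: A rational self-map $f:X\dashrightarrow X$ of a complex projective surface has an invariant fibration if there are a one-dimensional projective curve $Y$, a dominant (nonconstant) rational map $\pi:X\dashrightarrow Y$ and a rational map $g:Y\dashrightarrow Y$ such that $\pi\circ f=g\circ\pi$. *)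

theory Defs
  imports Complex_Main "HOL-Library.Poly_Mapping" "HOL-Library.Extended_Nat"
begin

section \<open>Products of projective spaces in homogeneous coordinates\<close>

text \<open>
  A list \<open>ns = [n\<^sub>0, \<dots>, n\<^sub>k]\<close> stands for the product of the complex projective spaces of
  dimensions \<open>n\<^sub>0, \<dots>, n\<^sub>k\<close>: \<open>[n]\<close> is projective \<open>n\<close>-space and \<open>[1, 1]\<close> is the product of two
  projective lines. The variable \<open>(i, j)\<close>, with \<open>i < length ns\<close> and \<open>j \<le> ns ! i\<close>, is the \<open>j\<close>-th
  homogeneous coordinate of the \<open>i\<close>-th factor.

  A point is handled through its homogeneous coordinate vectors: these form \<open>coords ns\<close>, and two
  of them represent the same point iff they are related by \<open>same_point ns\<close>. A subset of the
  product is represented by the set of all coordinate vectors of its points.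
\<close>

type_synonym cpoly = "(nat \<times> nat \<Rightarrow>\<^sub>0 nat) \<Rightarrow>\<^sub>0 complex"

definition Var :: "nat \<Rightarrow> nat \<Rightarrow> cpoly" where
  "Var i j = Poly_Mapping.single (Poly_Mapping.single (i, j) 1) 1"

definition eval_mon :: "(nat \<times> nat \<Rightarrow>\<^sub>0 nat) \<Rightarrow> (nat \<Rightarrow> nat \<Rightarrow> complex) \<Rightarrow> complex" where
  "eval_mon m v = (\<Prod>(i, j)\<in>Poly_Mapping.keys m. v i j ^ Poly_Mapping.lookup m (i, j))"

definition eval_poly :: "cpoly \<Rightarrow> (nat \<Rightarrow> nat \<Rightarrow> complex) \<Rightarrow> complex" where
  "eval_poly p v = (\<Sum>m\<in>Poly_Mapping.keys p. Poly_Mapping.lookup p m * eval_mon m v)"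

text \<open>\<open>p\<close> is a polynomial in the coordinates of \<open>ns\<close>, homogeneous of degree \<open>d i\<close> in the
  coordinates of the \<open>i\<close>-th factor, for each \<open>i\<close>.\<close>

definition multihom :: "nat list \<Rightarrow> (nat \<Rightarrow> nat) \<Rightarrow> cpoly \<Rightarrow> bool" where
  "multihom ns d p \<longleftrightarrow> (\<forall>m\<in>Poly_Mapping.keys p.
     Poly_Mapping.keys m \<subseteq> {(i, j). i < length ns \<and> j \<le> ns ! i} \<and>
     (\<forall>i<length ns. (\<Sum>j\<le>ns ! i. Poly_Mapping.lookup m (i, j)) = d i))"

definition coords :: "nat list \<Rightarrow> (nat \<Rightarrow> nat \<Rightarrow> complex) set" where
  "coords ns = {v. (\<forall>i<length ns. \<exists>j\<le>ns ! i. v i j \<noteq> 0) \<and>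
                   (\<forall>i j. \<not> (i < length ns \<and> j \<le> ns ! i) \<longrightarrow> v i j = 0)}"

definition same_point ::
  "nat list \<Rightarrow> (nat \<Rightarrow> nat \<Rightarrow> complex) \<Rightarrow> (nat \<Rightarrow> nat \<Rightarrow> complex) \<Rightarrow> bool" where
  "same_point ns v w \<longleftrightarrow> (\<forall>i<length ns. \<exists>c. c \<noteq> 0 \<and> (\<forall>j\<le>ns ! i. w i j = c * v i j))"

section \<open>Projective varieties\<close>

definition zariski_closed :: "nat list \<Rightarrow> (nat \<Rightarrow> nat \<Rightarrow> complex) set \<Rightarrow> bool" where
  "zariski_closed ns Z \<longleftrightarrow>
     (\<exists>S. (\<forall>p\<in>S. \<exists>d. multihom ns d p) \<and> Z = {v \<in> coords ns. \<forall>p\<in>S. eval_poly p v = 0})"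

definition irreducible_closed :: "nat list \<Rightarrow> (nat \<Rightarrow> nat \<Rightarrow> complex) set \<Rightarrow> bool" where
  "irreducible_closed ns Z \<longleftrightarrow> zariski_closed ns Z \<and> Z \<noteq> {} \<and>
     (\<forall>A B. zariski_closed ns A \<and> zariski_closed ns B \<and> Z \<subseteq> A \<union> B \<longrightarrow> Z \<subseteq> A \<or> Z \<subseteq> B)"

text \<open>The dimension of \<open>X\<close> as a projective set, that is, its Krull dimension in the Zariski
  topology (not the dimension of the affine cone formed by the coordinate vectors).\<close>

definition proj_dim :: "nat list \<Rightarrow> (nat \<Rightarrow> nat \<Rightarrow> complex) set \<Rightarrow> enat" where
  "proj_dim ns X = Sup {enat k | k. \<exists>Z.
     (\<forall>i\<le>k. irreducible_closed ns (Z i) \<and> Z i \<subseteq> X) \<and> (\<forall>i<k. Z i \<subset> Z (Suc i))}"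

definition projective_curve :: "nat \<Rightarrow> (nat \<Rightarrow> nat \<Rightarrow> complex) set \<Rightarrow> bool" where
  "projective_curve n Y \<longleftrightarrow> irreducible_closed [n] Y \<and> proj_dim [n] Y = 1"

section \<open>Rational maps\<close>

text \<open>
  A rational map into the product \<open>ms\<close> is given by a family \<open>F\<close>, where \<open>F i j\<close> is the \<open>j\<close>-th
  homogeneous coordinate of the \<open>i\<close>-th component. Different families may represent the same
  rational map, and a family may vanish at points to which the rational map extends. Since the
  source is irreducible, a rational map is determined by its values on any nonempty Zariski open
  subset, in particular on \<open>dom_map X ms F\<close>.
\<close>

definition map_at ::
  "(nat \<Rightarrow> nat \<Rightarrow> cpoly) \<Rightarrow> (nat \<Rightarrow> nat \<Rightarrow> complex) \<Rightarrow> nat \<Rightarrow> nat \<Rightarrow> complex" where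
  "map_at F v = (\<lambda>i j. eval_poly (F i j) v)"

definition dom_map ::
  "(nat \<Rightarrow> nat \<Rightarrow> complex) set \<Rightarrow> nat list \<Rightarrow> (nat \<Rightarrow> nat \<Rightarrow> cpoly) \<Rightarrow>
   (nat \<Rightarrow> nat \<Rightarrow> complex) set" where
  "dom_map X ms F = {v \<in> X. map_at F v \<in> coords ms}"

definition rational_map ::
  "nat list \<Rightarrow> (nat \<Rightarrow> nat \<Rightarrow> complex) set \<Rightarrow> nat list \<Rightarrow> (nat \<Rightarrow> nat \<Rightarrow> complex) set \<Rightarrow>
   (nat \<Rightarrow> nat \<Rightarrow> cpoly) \<Rightarrow> bool" where
  "rational_map ns X ms Y F \<longleftrightarrow>
     (\<forall>i<length ms. \<exists>d. \<forall>j\<le>ms ! i. multihom ns d (F i j)) \<and>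
     (\<forall>i j. \<not> (i < length ms \<and> j \<le> ms ! i) \<longrightarrow> F i j = 0) \<and>
     dom_map X ms F \<noteq> {} \<and> map_at F ` dom_map X ms F \<subseteq> Y"

definition dominant_rational_map ::
  "nat list \<Rightarrow> (nat \<Rightarrow> nat \<Rightarrow> complex) set \<Rightarrow> nat list \<Rightarrow> (nat \<Rightarrow> nat \<Rightarrow> complex) set \<Rightarrow>
   (nat \<Rightarrow> nat \<Rightarrow> cpoly) \<Rightarrow> bool" where
  "dominant_rational_map ns X ms Y F \<longleftrightarrow> rational_map ns X ms Y F \<and>
     (\<forall>C. zariski_closed ms C \<and> map_at F ` dom_map X ms F \<subseteq> C \<longrightarrow> Y \<subseteq> C)"

text \<open>Equality \<open>G\<^sub>1 \<circ> F\<^sub>1 = G\<^sub>2 \<circ> F\<^sub>2\<close> of rational maps on an irreducible \<open>X\<close>: both composites are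
  defined on a common nonempty Zariski open subset of \<open>X\<close> and agree there.\<close>

definition comp_eq ::
  "(nat \<Rightarrow> nat \<Rightarrow> complex) set \<Rightarrow> nat list \<Rightarrow> nat list \<Rightarrow> nat list \<Rightarrow>
   (nat \<Rightarrow> nat \<Rightarrow> cpoly) \<Rightarrow> (nat \<Rightarrow> nat \<Rightarrow> cpoly) \<Rightarrow>
   (nat \<Rightarrow> nat \<Rightarrow> cpoly) \<Rightarrow> (nat \<Rightarrow> nat \<Rightarrow> cpoly) \<Rightarrow> bool" where
  "comp_eq X ms1 ms2 ks G1 F1 G2 F2 \<longleftrightarrow>
     (let U = {v \<in> dom_map X ms1 F1 \<inter> dom_map X ms2 F2.
                 map_at G1 (map_at F1 v) \<in> coords ks \<and> map_at G2 (map_at F2 v) \<in> coords ks}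
      in U \<noteq> {} \<and>
         (\<forall>v\<in>U. same_point ks (map_at G1 (map_at F1 v)) (map_at G2 (map_at F2 v))))"

definition has_invariant_fibration ::
  "nat list \<Rightarrow> (nat \<Rightarrow> nat \<Rightarrow> complex) set \<Rightarrow> (nat \<Rightarrow> nat \<Rightarrow> cpoly) \<Rightarrow> bool" where
  "has_invariant_fibration ns X f \<longleftrightarrow>
     (\<exists>n Y \<pi> g. projective_curve n Y \<and>
        dominant_rational_map ns X [n] Y \<pi> \<and>
        rational_map [n] Y [n] Y g \<and>
        comp_eq X ns [n] [n] \<pi> f g \<pi>)"

section \<open>The projective heat map on pentagons\<close>

abbreviation P1xP1 :: "(nat \<Rightarrow> nat \<Rightarrow> complex) set" where
  "P1xP1 \<equiv> coords [1, 1]"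

text \<open>The affine coordinates are \<open>x = X1 / X0\<close> and \<open>y = Y1 / Y0\<close>; the four polynomials are the
  denominators and numerators of the affine formula, made bihomogeneous. That formula is recovered
  in \<open>heat_map_affine\<close> below.\<close>

definition heat_map :: "nat \<Rightarrow> nat \<Rightarrow> cpoly" where
  "heat_map =
    (let X0 = Var 0 0; X1 = Var 0 1; Y0 = Var 1 0; Y1 = Var 1 1;
         A = X1*Y1^2 + 2*X1*Y1*Y0 - 3*X0*Y0^2;
         B = X1^2*Y1^2 - 6*X1*X0*Y1*Y0 - X1*X0*Y0^2 + 6*X0^2*Y0^2;
         C = X1*Y1^2 + 4*X1*Y1*Y0 + X1*Y0^2 - X0*Y1*Y0 - 5*X0*Y0^2;
         D = X1^2*Y1^2 - 6*X1*X0*Y1*Y0 - X0^2*Y1*Y0 + 6*X0^2*Y0^2;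
         E = X1^2*Y1 + 2*X1*X0*Y1 - 3*X0^2*Y0;
         F = X1^2*Y1 + 4*X1*X0*Y1 - X1*X0*Y0 + X0^2*Y1 - 5*X0^2*Y0
     in (\<lambda>i j. if i = 0 \<and> j = 0 then C * D
               else if i = 0 \<and> j = 1 then A * B
               else if i = 1 \<and> j = 0 then F * B
               else if i = 1 \<and> j = 1 then E * D
               else 0))"

definition affine_point :: "complex \<Rightarrow> complex \<Rightarrow> nat \<Rightarrow> nat \<Rightarrow> complex" where
  "affine_point x y = (\<lambda>i j. if i \<le> 1 \<and> j = 0 then 1
                             else if i = 0 \<and> j = 1 then x
                             else if i = 1 \<and> j = 1 then y
                             else 0)"

subsection \<open>Consistency of the definition\<close>

lemma eval_mon_superset:
  assumes "finite K" "Poly_Mapping.keys m \<subseteq> K"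
  shows "eval_mon m v = (\<Prod>(i, j)\<in>K. v i j ^ Poly_Mapping.lookup m (i, j))"
  unfolding eval_mon_def using assms
  by (intro prod.mono_neutral_left) (auto simp: in_keys_iff)

lemma eval_mon_add: "eval_mon (a + b) v = eval_mon a v * eval_mon b v"
proof -
  let ?K = "Poly_Mapping.keys a \<union> Poly_Mapping.keys b"
  have "eval_mon (a + b) v = (\<Prod>(i, j)\<in>?K. v i j ^ Poly_Mapping.lookup (a + b) (i, j))"
    by (rule eval_mon_superset) (simp_all add: keys_add)
  also have "\<dots> = (\<Prod>(i, j)\<in>?K. v i j ^ Poly_Mapping.lookup a (i, j)) *
                 (\<Prod>(i, j)\<in>?K. v i j ^ Poly_Mapping.lookup b (i, j))"
    by (simp add: prod.distrib[symmetric] lookup_add power_add case_prod_unfold)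
  also have "\<dots> = eval_mon a v * eval_mon b v"
    by (subst (1 2) eval_mon_superset[of ?K]) auto
  finally show ?thesis .
qed

lemma eval_poly_superset:
  assumes "finite K" "Poly_Mapping.keys p \<subseteq> K"
  shows "eval_poly p v = (\<Sum>m\<in>K. Poly_Mapping.lookup p m * eval_mon m v)"
  unfolding eval_poly_def using assms
  by (intro sum.mono_neutral_left) (auto simp: in_keys_iff)

lemma eval_poly_0 [simp]: "eval_poly 0 v = 0"
  by (simp add: eval_poly_def)

lemma eval_poly_add [simp]: "eval_poly (p + q) v = eval_poly p v + eval_poly q v"
proof -
  let ?K = "Poly_Mapping.keys p \<union> Poly_Mapping.keys q"
  have "eval_poly (p + q) v = (\<Sum>m\<in>?K. Poly_Mapping.lookup (p + q) m * eval_mon m v)"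
    by (rule eval_poly_superset) (simp_all add: keys_add)
  also have "\<dots> = eval_poly p v + eval_poly q v"
    by (subst (1 2) eval_poly_superset[of ?K])
      (auto simp: lookup_add sum.distrib[symmetric] algebra_simps)
  finally show ?thesis .
qed

lemma eval_poly_uminus [simp]: "eval_poly (- p) v = - eval_poly p v"
  using eval_poly_add[of p "- p" v] by (simp add: eq_neg_iff_add_eq_0 add.commute)

lemma eval_poly_diff [simp]: "eval_poly (p - q) v = eval_poly p v - eval_poly q v"
  using eval_poly_add[of p "- q" v] by simp

lemma eval_poly_single [simp]: "eval_poly (Poly_Mapping.single m c) v = c * eval_mon m v"
  by (subst eval_poly_superset[of "{m}"]) auto

lemma eval_poly_sum: "eval_poly (sum f S) v = (\<Sum>s\<in>S. eval_poly (f s) v)"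
  by (induction S rule: infinite_finite_induct) auto

lemma cpoly_eq_sum_single:
  "(p :: cpoly) = (\<Sum>m\<in>Poly_Mapping.keys p. Poly_Mapping.single m (Poly_Mapping.lookup p m))"
  by (rule poly_mapping_eqI)
    (auto simp: lookup_sum lookup_single when_def in_keys_iff if_distrib cong: if_cong)

lemma eval_poly_mult [simp]: "eval_poly (p * q) v = eval_poly p v * eval_poly q v"
proof -
  have "p * q = (\<Sum>m\<in>Poly_Mapping.keys p. \<Sum>m'\<in>Poly_Mapping.keys q.
      Poly_Mapping.single (m + m') (Poly_Mapping.lookup p m * Poly_Mapping.lookup q m'))"
    by (subst cpoly_eq_sum_single[of p], subst cpoly_eq_sum_single[of q])
      (simp add: sum_product mult_single)
  then show ?thesis
    by (simp add: eval_poly_sum eval_mon_add eval_poly_def[of p] eval_poly_def[of q] sum_product mult_ac)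
qed

lemma eval_poly_1 [simp]: "eval_poly 1 v = 1"
  by (simp add: eval_poly_def eval_mon_def)

lemma eval_poly_power [simp]: "eval_poly (p ^ n) v = eval_poly p v ^ n"
  by (induction n) auto

lemma eval_poly_numeral [simp]: "eval_poly (numeral n) v = numeral n"
proof -
  have "eval_poly (of_nat k) v = of_nat k" for k
    by (induction k) auto
  from this[of "numeral n"] show ?thesis by simp
qed

lemma eval_poly_Var [simp]: "eval_poly (Var i j) v = v i j"
  by (simp add: Var_def eval_mon_def)

lemma multihom_add: "multihom ns d p \<Longrightarrow> multihom ns d q \<Longrightarrow> multihom ns d (p + q)"
  using keys_add[of p q] unfolding multihom_def by blast

lemma multihom_diff: "multihom ns d p \<Longrightarrow> multihom ns d q \<Longrightarrow> multihom ns d (p - q)"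
  using keys_diff[of p q] unfolding multihom_def by blast

lemma multihom_mult:
  assumes "multihom ns d p" "multihom ns e q" "\<And>i. i < length ns \<Longrightarrow> d i + e i = f i"
  shows "multihom ns f (p * q)"
  unfolding multihom_def
proof (intro ballI conjI allI impI)
  fix m assume "m \<in> Poly_Mapping.keys (p * q)"
  then obtain a b where ab: "m = a + b" "a \<in> Poly_Mapping.keys p" "b \<in> Poly_Mapping.keys q"
    using keys_mult[of p q] by auto
  show "Poly_Mapping.keys m \<subseteq> {(i, j). i < length ns \<and> j \<le> ns ! i}"
    using ab assms keys_add[of a b] unfolding multihom_def by blast
  fix i assume "i < length ns"
  then show "(\<Sum>j\<le>ns ! i. Poly_Mapping.lookup m (i, j)) = f i"
    using ab assms unfolding multihom_def by (auto simp: lookup_add sum.distrib)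
qed

lemma multihom_numeral:
  assumes "\<And>i. i < length ns \<Longrightarrow> d i = 0"
  shows "multihom ns d (numeral n)"
proof -
  have "Poly_Mapping.keys (numeral n :: cpoly) = {0}"
    by (subst single_numeral[symmetric]) (simp del: single_numeral)
  with assms show ?thesis unfolding multihom_def by auto
qed

lemma multihom_Var:
  assumes "i < length ns" "j \<le> ns ! i" "\<And>k. k < length ns \<Longrightarrow> d k = (if k = i then 1 else 0)"
  shows "multihom ns d (Var i j)"
  using assms unfolding multihom_def Var_def
  by (auto simp: lookup_single when_def)

definition bideg :: "nat \<Rightarrow> nat \<Rightarrow> nat \<Rightarrow> nat" where
  "bideg a b = (\<lambda>i. if i = 0 then a else b)"

lemma bihom_mult:
  assumes "multihom [1, 1] (bideg a b) p" "multihom [1, 1] (bideg a' b') q" "c = a + a'" "d = b + b'"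
  shows "multihom [1, 1] (bideg c d) (p * q)"
  by (rule multihom_mult[OF assms(1,2)]) (use assms(3,4) in \<open>auto simp: bideg_def\<close>)

lemma bihom_square:
  assumes "multihom [1, 1] (bideg a b) p" "c = 2 * a" "d = 2 * b"
  shows "multihom [1, 1] (bideg c d) (p ^ 2)"
  unfolding power2_eq_square by (rule bihom_mult[OF assms(1) assms(1)]) (use assms(2,3) in auto)

lemma bihom_numeral: "multihom [1, 1] (bideg 0 0) (numeral n)"
  by (rule multihom_numeral) (auto simp: bideg_def)

lemma bihom_Var:
  "multihom [1, 1] (bideg 1 0) (Var 0 0)" "multihom [1, 1] (bideg 1 0) (Var 0 1)"
  "multihom [1, 1] (bideg 0 1) (Var 1 0)" "multihom [1, 1] (bideg 0 1) (Var 1 1)"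
  by (rule multihom_Var; auto simp: bideg_def less_Suc_eq)+

lemma bihom_heat_map:
  "multihom [1, 1] (bideg 3 4) (heat_map 0 0)" "multihom [1, 1] (bideg 3 4) (heat_map 0 1)"
  "multihom [1, 1] (bideg 4 3) (heat_map 1 0)" "multihom [1, 1] (bideg 4 3) (heat_map 1 1)"
proof -
  note bihom = multihom_add multihom_diff bihom_mult bihom_square bihom_numeral bihom_Var
  have factors:
    "multihom [1, 1] (bideg 1 2)
      (Var 0 1 * Var 1 1^2 + 2 * Var 0 1 * Var 1 1 * Var 1 0 - 3 * Var 0 0 * Var 1 0^2)"
    "multihom [1, 1] (bideg 2 2)
      (Var 0 1^2 * Var 1 1^2 - 6 * Var 0 1 * Var 0 0 * Var 1 1 * Var 1 0
         - Var 0 1 * Var 0 0 * Var 1 0^2 + 6 * Var 0 0^2 * Var 1 0^2)"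
    "multihom [1, 1] (bideg 1 2)
      (Var 0 1 * Var 1 1^2 + 4 * Var 0 1 * Var 1 1 * Var 1 0 + Var 0 1 * Var 1 0^2
         - Var 0 0 * Var 1 1 * Var 1 0 - 5 * Var 0 0 * Var 1 0^2)"
    "multihom [1, 1] (bideg 2 2)
      (Var 0 1^2 * Var 1 1^2 - 6 * Var 0 1 * Var 0 0 * Var 1 1 * Var 1 0
         - Var 0 0^2 * Var 1 1 * Var 1 0 + 6 * Var 0 0^2 * Var 1 0^2)"
    "multihom [1, 1] (bideg 2 1)
      (Var 0 1^2 * Var 1 1 + 2 * Var 0 1 * Var 0 0 * Var 1 1 - 3 * Var 0 0^2 * Var 1 0)"
    "multihom [1, 1] (bideg 2 1)
      (Var 0 1^2 * Var 1 1 + 4 * Var 0 1 * Var 0 0 * Var 1 1 - Var 0 1 * Var 0 0 * Var 1 0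
         + Var 0 0^2 * Var 1 1 - 5 * Var 0 0^2 * Var 1 0)"
    by (rule bihom | rule refl | simp; fail)+
  note unfold = heat_map_def Let_def simp_thms if_True if_False zero_neq_one one_neq_zero
  show "multihom [1, 1] (bideg 3 4) (heat_map 0 0)"
    by (simp only: unfold, rule bihom_mult[OF factors(3,4)]) simp_all
  show "multihom [1, 1] (bideg 3 4) (heat_map 0 1)"
    by (simp only: unfold, rule bihom_mult[OF factors(1,2)]) simp_all
  show "multihom [1, 1] (bideg 4 3) (heat_map 1 0)"
    by (simp only: unfold, rule bihom_mult[OF factors(6,2)]) simp_all
  show "multihom [1, 1] (bideg 4 3) (heat_map 1 1)"
    by (simp only: unfold, rule bihom_mult[OF factors(5,4)]) simp_all
qed

lemma affine_point_coords: "affine_point x y \<in> P1xP1"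
  by (auto simp: coords_def affine_point_def less_Suc_eq le_Suc_eq)

lemma heat_map_affine:
  fixes x y :: complex
  defines "a \<equiv> (x*y^2 + 4*x*y + x - y - 5) * (x^2*y^2 - 6*x*y - y + 6)"
    and "b \<equiv> (x^2*y + 4*x*y - x + y - 5) * (x^2*y^2 - 6*x*y - x + 6)"
  assumes "a \<noteq> 0" "b \<noteq> 0"
  shows "affine_point x y \<in> dom_map P1xP1 [1, 1] heat_map"
    and "same_point [1, 1]
      (affine_point ((x*y^2 + 2*x*y - 3) * (x^2*y^2 - 6*x*y - x + 6) / a)
                    ((x^2*y + 2*x*y - 3) * (x^2*y^2 - 6*x*y - y + 6) / b))
      (map_at heat_map (affine_point x y))"
proof -
  have v: "map_at heat_map (affine_point x y) 0 0 = a"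
    "map_at heat_map (affine_point x y) 0 1 = (x*y^2 + 2*x*y - 3) * (x^2*y^2 - 6*x*y - x + 6)"
    "map_at heat_map (affine_point x y) 1 0 = b"
    "map_at heat_map (affine_point x y) 1 1 = (x^2*y + 2*x*y - 3) * (x^2*y^2 - 6*x*y - y + 6)"
    unfolding map_at_def heat_map_def Let_def a_def b_def by (simp_all add: affine_point_def)
  have z: "map_at heat_map (affine_point x y) i j = 0" if "\<not> (i < 2 \<and> j \<le> 1)" for i j
    using that by (auto simp: map_at_def heat_map_def Let_def)
  show "affine_point x y \<in> dom_map P1xP1 [1, 1] heat_map"
  proof -
    have "\<exists>j\<le>[1, 1] ! i. map_at heat_map (affine_point x y) i j \<noteq> 0" if "i < length [1, 1::nat]" for i
    proof -
      from that consider "i = 0" | "i = 1" by fastforce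
      then show ?thesis using v assms(3,4) by cases (auto intro!: exI[of _ 0])
    qed
    moreover have "map_at heat_map (affine_point x y) i j = 0"
      if "\<not> (i < length [1, 1::nat] \<and> j \<le> [1, 1] ! i)" for i j
    proof (rule z)
      show "\<not> (i < 2 \<and> j \<le> 1)"
      proof
        assume ij: "i < 2 \<and> j \<le> 1"
        then have "i = 0 \<or> i = 1" by auto
        with that ij show False by auto
      qed
    qed
    ultimately show ?thesis
      using affine_point_coords by (simp add: dom_map_def coords_def)
  qed
  show "same_point [1, 1]
      (affine_point ((x*y^2 + 2*x*y - 3) * (x^2*y^2 - 6*x*y - x + 6) / a)
                    ((x^2*y + 2*x*y - 3) * (x^2*y^2 - 6*x*y - y + 6) / b))
      (map_at heat_map (affine_point x y))"
    unfolding same_point_def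
  proof (intro allI impI)
    fix i assume "i < length [1, 1::nat]"
    then consider "i = 0" | "i = 1" by fastforce
    then show "\<exists>c. c \<noteq> 0 \<and> (\<forall>j\<le>[1, 1] ! i. map_at heat_map (affine_point x y) i j = c *
       affine_point ((x*y^2 + 2*x*y - 3) * (x^2*y^2 - 6*x*y - x + 6) / a)
                    ((x^2*y + 2*x*y - 3) * (x^2*y^2 - 6*x*y - y + 6) / b) i j)"
    proof cases
      case 1
      then show ?thesis using v assms(3)
        by (intro exI[of _ a]) (auto simp: le_Suc_eq affine_point_def)
    next
      case 2
      then show ?thesis using v assms(4)
        by (intro exI[of _ b]) (auto simp: le_Suc_eq affine_point_def)
    qed
  qed
qed

lemma rational_map_heat_map: "rational_map [1, 1] P1xP1 [1, 1] P1xP1 heat_map"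
proof -
  have "\<exists>d. \<forall>j\<le>[1, 1] ! i. multihom [1, 1] d (heat_map i j)" if "i < length [1, 1::nat]" for i
  proof -
    from that consider "i = 0" | "i = 1" by fastforce
    then show ?thesis
      using bihom_heat_map by cases (auto simp: le_Suc_eq)
  qed
  moreover have "heat_map i j = 0" if "\<not> (i < length [1, 1::nat] \<and> j \<le> [1, 1] ! i)" for i j
    using that by (auto simp: heat_map_def Let_def)
  moreover have "dom_map P1xP1 [1, 1] heat_map \<noteq> {}"
    using heat_map_affine(1)[of 0 0] by auto
  ultimately show ?thesis
    unfolding rational_map_def by (auto simp: dom_map_def)
qed

end

theory Submission
  imports Defs
    "HOL-Computational_Algebra.Polynomial_Factorial"
    "HOL-Computational_Algebra.Fundamental_Theorem_Algebra"
    "HOL-Computational_Algebra.Field_as_Ring"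
begin

text \<open>
  The heat map \<open>H\<close> does not even preserve a foliation that is given by a polynomial form, and this
  is what is proved. A fibration \<open>\<pi>\<close> yields such a foliation, by its fibres: if \<open>u\<close> is a
  nonconstant quotient of two coordinates of \<open>\<pi>\<close>, then \<open>u\<close> and \<open>u \<circ> H\<close> are both functions on the
  curve \<open>Y\<close>, so they are algebraically dependent and \<open>du\<close> is proportional to its pull-back
  (\<open>no_invariant_fibration\<close>).

  So let \<open>\<omega> = P ds + Q dt\<close>, with \<open>P\<close> and \<open>Q\<close> coprime, define an invariant foliation. It has only
  finitely many singular points on the diagonal, which \<open>H\<close> maps to itself by a quadratic rational
  function of one variable. Where \<open>H\<close> is a local isomorphism, \<open>H z\<close> is singular iff \<open>z\<close> is
  (\<open>singular_forward\<close>, \<open>singular_backward\<close>). Consequently a point of the diagonal is not singular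
  if it has an infinite forward or backward orbit along which \<open>H\<close> is a local isomorphism. This
  applies to two points.

  One of them is \<open>x = y = -2\<close>, an indeterminacy point of \<open>H\<close> that \<open>H\<close> blows up to the curve
  \<open>x y = 1\<close>. Since there is exactly one leaf through this point, almost all directions at it are
  transversal to the foliation, and their images show that \<open>x y = 1\<close> is a leaf
  (\<open>leaf_xy_eq_1\<close>).

  Now \<open>H\<close> contracts \<open>x y = 1\<close> to \<open>(1, 1)\<close>, which is again an indeterminacy point. Therefore
  everything is computed in a chart of the blow-up of \<open>(1, 1)\<close>, where \<open>x = 1 + s\<close> and
  \<open>y = 1 + t s\<close>. There the curve \<open>x y = 1\<close> is mapped onto the exceptional curve \<open>s = 0\<close>, which is
  therefore a leaf (\<open>leaf_exceptional_curve\<close>); and \<open>s = 0\<close> is mapped onto a curve \<open>\<Gamma>\<close>, which is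
  a leaf, too. But \<open>\<Gamma>\<close> touches \<open>s = 0\<close> at the point where \<open>s = 0\<close> meets the diagonal, so that
  this point is singular. It is the other point to which the orbit argument applies, and this
  contradiction proves the theorem (\<open>no_invariant_foliation\<close>).
\<close>

section \<open>Polynomials in two variables\<close>

text \<open>
  A polynomial in the coordinates \<open>s\<close> and \<open>t\<close> is a polynomial in \<open>t\<close> whose coefficients are
  polynomials in \<open>s\<close>. This nesting makes the polynomials in two variables a factorial ring with
  a gcd, which is what the arguments about foliations rest on.
\<close>

type_synonym bipoly = "complex poly poly"

definition ev :: "bipoly \<Rightarrow> complex \<times> complex \<Rightarrow> complex" where
  "ev p z = poly (poly p [:snd z:]) (fst z)"

definition \<s> :: bipoly where "\<s> = [:[:0, 1:]:]"
definition \<t> :: bipoly where "\<t> = [:0, 1:]"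

definition const :: "complex \<Rightarrow> bipoly" where "const c = [:[:c:]:]"

lemma ev_simps [simp]:
  "ev 0 z = 0" "ev 1 z = 1" "ev (numeral n) z = numeral n"
  "ev (p + q) z = ev p z + ev q z" "ev (p - q) z = ev p z - ev q z" "ev (- p) z = - ev p z"
  "ev (p * q) z = ev p z * ev q z" "ev (p ^ k) z = ev p z ^ k"
  "ev \<s> z = fst z" "ev \<t> z = snd z" "ev (const c) z = c"
  by (simp_all add: ev_def \<s>_def \<t>_def const_def)

lemma ev_sum [simp]: "ev (sum f A) z = (\<Sum>a\<in>A. ev (f a) z)"
  by (induction A rule: infinite_finite_induct) auto

lemma ev_prod [simp]: "ev (prod f A) z = (\<Prod>a\<in>A. ev (f a) z)"
  by (induction A rule: infinite_finite_induct) auto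

lemma ev_pCons [simp]: "ev (pCons a p) z = poly a (fst z) + snd z * ev p z"
  by (simp add: ev_def)

definition ds :: "bipoly \<Rightarrow> bipoly" where "ds p = map_poly pderiv p"

abbreviation dt :: "bipoly \<Rightarrow> bipoly" where "dt \<equiv> pderiv"

lemma ds_pCons [simp]: "ds (pCons a p) = pCons (pderiv a) (ds p)"
  by (simp add: ds_def map_poly_pCons)

lemma ds_add [simp]: "ds (p + q) = ds p + ds q"
  by (rule poly_eqI) (simp add: ds_def coeff_map_poly pderiv_add)

lemma ds_diff [simp]: "ds (p - q) = ds p - ds q"
  by (rule poly_eqI) (simp add: ds_def coeff_map_poly pderiv_diff)

lemma ds_0 [simp]: "ds 0 = 0"
  by (simp add: ds_def)

lemma ds_smult: "ds (smult a q) = smult (pderiv a) q + smult a (ds q)"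
  by (rule poly_eqI) (simp add: ds_def coeff_map_poly pderiv_mult algebra_simps)

lemma ds_mult [simp]: "ds (p * q) = ds p * q + p * ds q"
  by (induction p) (simp_all add: ds_smult algebra_simps)

lemma ds_1 [simp]: "ds 1 = 0"
  by (simp add: ds_def one_pCons map_poly_pCons)

lemma ds_numeral [simp]: "ds (numeral n) = 0"
  by (simp add: numeral_poly pderiv_numeral)

lemma ds_vars [simp]: "ds \<s> = 1" "ds \<t> = 0" "dt \<s> = 0" "dt \<t> = 1"
  by (simp_all add: \<s>_def \<t>_def pderiv_pCons one_pCons)

lemma pderiv_power2 [simp]: "dt (p ^ 2) = 2 * p * dt p" "ds (p ^ 2) = 2 * p * ds p"
  by (simp_all add: power2_eq_square pderiv_mult)

text \<open>
  All differentiation below is along curves, mostly coordinate lines, so that only derivatives of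
  functions of one complex variable occur.
\<close>

lemma ev_chain_rule:
  assumes "(f has_field_derivative f') (at z)" "(g has_field_derivative g') (at z)"
  shows "((\<lambda>w. ev p (f w, g w)) has_field_derivative
           ev (ds p) (f z, g z) * f' + ev (dt p) (f z, g z) * g') (at z)"
proof (induction p)
  case (pCons a p)
  have "((\<lambda>w. poly a (f w)) has_field_derivative poly (pderiv a) (f z) * f') (at z)"
    using DERIV_chain2[OF poly_DERIV assms(1)] .
  from DERIV_add[OF this DERIV_mult[OF assms(2) pCons(2)]]
  show ?case
    by (simp add: pderiv_pCons algebra_simps)
qed (simp_all add: pderiv_0)

lemma infinite_constant_polys: "infinite (range (\<lambda>t :: complex. [:t:]))"
  by (subst finite_image_iff) (auto simp: inj_def infinite_UNIV_char_0)

lemma bipoly_eq_0I: 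
  assumes "\<And>z. ev p z = 0" shows "p = 0"
proof (rule ccontr)
  assume "p \<noteq> 0"
  have "poly p [:t:] = 0" for t
  proof -
    have "\<forall>x. poly (poly p [:t:]) x = 0" using assms[of "(_, t)"] by (simp add: ev_def)
    then show ?thesis using poly_all_0_iff_0 by blast
  qed
  then have "range (\<lambda>t :: complex. [:t:]) \<subseteq> {x. poly p x = 0}" by auto
  with poly_roots_finite[OF \<open>p \<noteq> 0\<close>] infinite_constant_polys finite_subset show False by blast
qed

text \<open>
  The filter of nonempty Zariski open subsets of the plane. A polynomial identity may be checked
  along it, and so denominators and other exceptional curves can be ignored.
\<close>

definition generic :: "(complex \<times> complex) filter" where
  "generic = (INF f\<in>{f. f \<noteq> 0}. principal {z. ev f z \<noteq> 0})"

lemma eventually_generic: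
  "eventually \<Phi> generic \<longleftrightarrow> (\<exists>f. f \<noteq> 0 \<and> (\<forall>z. ev f z \<noteq> 0 \<longrightarrow> \<Phi> z))"
proof -
  have "\<exists>h\<in>{f. f \<noteq> 0}. principal {z. ev h z \<noteq> 0} \<le>
      inf (principal {z. ev f z \<noteq> 0}) (principal {z. ev g z \<noteq> 0})"
    if "f \<in> {f. f \<noteq> 0}" "g \<in> {f. f \<noteq> 0}" for f g
    using that by (intro bexI[of _ "f * g"]) auto
  then have "eventually \<Phi> generic \<longleftrightarrow>
      (\<exists>f\<in>{f. f \<noteq> 0}. eventually \<Phi> (principal {z. ev f z \<noteq> 0}))"
    unfolding generic_def by (intro eventually_INF_base) (auto intro: exI[of _ 1])
  then show ?thesis by (auto simp: eventually_principal)
qed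

lemma eventually_ev_neq_0: "f \<noteq> 0 \<Longrightarrow> \<forall>\<^sub>F z in generic. ev f z \<noteq> 0"
  by (auto simp: eventually_generic)

lemma bipoly_eq_0_if_generically_0:
  assumes "\<forall>\<^sub>F z in generic. ev p z = 0" shows "p = 0"
proof -
  obtain f where f: "f \<noteq> 0" "\<And>z. ev f z \<noteq> 0 \<Longrightarrow> ev p z = 0"
    using assms by (auto simp: eventually_generic)
  have "f * p = 0" by (rule bipoly_eq_0I) (use f(2) in auto)
  with f(1) show ?thesis by simp
qed

lemma bipoly_eqI_generic:
  assumes "\<forall>\<^sub>F z in generic. ev p z = ev q z" shows "p = q"
  using bipoly_eq_0_if_generically_0[of "p - q"] assms by (auto elim: eventually_mono)

text \<open>
  Two parallel vectors, the first of them with coprime entries, differ by a factor without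
  denominators. For an invariant foliation, it is the factor by which its form changes under
  pull-back.
\<close>

lemma coprime_common_multiplier:
  fixes P Q :: "'a :: {factorial_ring_gcd}"
  assumes "coprime P Q" "P * M2 = Q * M1"
  obtains K where "M1 = K * P" "M2 = K * Q"
proof (cases "P = 0")
  case True
  then have u: "is_unit Q" using assms(1) by simp
  then have "Q \<noteq> 0" by auto
  then have "M1 = 0" using assms(2) True by simp
  moreover obtain K where "M2 = Q * K" using u by (meson dvdE unit_imp_dvd)
  ultimately show ?thesis using that[of K] True by (simp add: mult.commute)
next
  case False
  have "P dvd Q * M1" using assms(2) by (metis dvd_triv_left)
  then have "P dvd M1" using assms(1) coprime_dvd_mult_right_iff by blast
  then obtain K where K: "M1 = P * K" by auto
  then have "P * M2 = P * (Q * K)" using assms(2) by (simp add: mult_ac)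
  then have "M2 = Q * K" using False by simp
  with K show ?thesis using that[of K] by (simp add: mult.commute)
qed

text \<open>
  The ideal of two coprime polynomials contains a nonzero polynomial in \<open>s\<close> alone: an element
  of the ideal of least degree in \<open>t\<close> divides both generators up to factors free of \<open>t\<close> by
  pseudo-division, so by Gauss' lemma its primitive part is a common divisor.
\<close>

lemma bezout_bipoly:
  fixes P Q :: bipoly
  assumes "coprime P Q"
  obtains U V r where "r \<noteq> 0" "U * P + V * Q = [:r:]"
proof -
  define I where "I = {U * P + V * Q | U V. True}"
  have I_diff: "smult c a - b * q \<in> I" if a: "a \<in> I" and b: "b \<in> I" for a b c q
  proof -
    obtain U V U' V' where "a = U * P + V * Q" "b = U' * P + V' * Q"
      using a b by (auto simp: I_def)
    then have "smult c a - b * q = (smult c U - U' * q) * P + (smult c V - V' * q) * Q"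
      by (simp add: algebra_simps smult_add_right)
    then show ?thesis unfolding I_def by blast
  qed
  have PQ: "P \<in> I" "Q \<in> I"
    unfolding I_def by (simp_all, rule exI[of _ 1], rule exI[of _ 0], simp,
      rule exI[of _ 0], rule exI[of _ 1], simp)
  have "P \<noteq> 0 \<or> Q \<noteq> 0" using assms by auto
  then have "\<exists>g. g \<in> I \<and> g \<noteq> 0" using PQ by auto
  then obtain g where g: "g \<in> I" "g \<noteq> 0" and min: "\<And>f. f \<in> I \<Longrightarrow> f \<noteq> 0 \<Longrightarrow> degree g \<le> degree f"
    using ex_has_least_nat[of "\<lambda>g. g \<in> I \<and> g \<noteq> 0" _ degree] by metis
  have dvd: "primitive_part g dvd f" if "f \<in> I" for f
  proof -
    obtain q r where qr: "pseudo_divmod f g = (q, r)" by fastforce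
    define c where "c = lead_coeff g ^ (Suc (degree f) - degree g)"
    have c: "smult c f = g * q + r" "r = 0 \<or> degree r < degree g"
      using pseudo_divmod[OF g(2) qr] by (auto simp: c_def)
    have "r = smult c f - g * q" using c(1) by simp
    then have "r \<in> I" using I_diff that g(1) by simp
    then have "r = 0" using min c(2) by (metis not_le)
    then have "smult c f = primitive_part g * (smult (content g) q)"
      using c(1) content_times_primitive_part[of g] by (metis add.right_neutral mult_smult_left mult_smult_right)
    then have "fract_poly (primitive_part g) dvd fract_poly (smult c f)"
      by (intro fract_poly_dvd) (metis dvd_triv_left)
    moreover have "c \<noteq> 0" using g(2) by (simp add: c_def)
    ultimately have "fract_poly (primitive_part g) dvd fract_poly f"
      by (simp add: dvd_smult_iff)
    then show ?thesis using g(2) by (intro fract_poly_dvdD) auto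
  qed
  have "is_unit (primitive_part g)"
    using dvd PQ assms by (meson coprime_common_divisor)
  then have "degree g = 0" by (metis degree_primitive_part is_unit_polyE degree_pCons_0)
  then obtain r where r: "g = [:r:]" by (metis degree_eq_zeroE)
  then show ?thesis using g that by (auto simp: I_def)
qed

lemma coprime_common_zeros_finite:
  fixes P Q :: bipoly
  assumes "coprime P Q"
  shows "finite {s. \<exists>t. ev P (s, t) = 0 \<and> ev Q (s, t) = 0}"
proof -
  obtain U V r where r: "r \<noteq> 0" "U * P + V * Q = [:r:]" using bezout_bipoly[OF assms] .
  have "poly r s = 0" if "ev P (s, t) = 0" "ev Q (s, t) = 0" for s t
  proof -
    have "ev (U * P + V * Q) (s, t) = 0" using that by simp
    then show ?thesis unfolding r(2) by simp
  qed
  then have "{s. \<exists>t. ev P (s, t) = 0 \<and> ev Q (s, t) = 0} \<subseteq> {s. poly r s = 0}" by auto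
  then show ?thesis using poly_roots_finite[OF r(1)] finite_subset by blast
qed

lemma poly_wronskian_0:
  fixes a b :: "complex poly"
  assumes "b \<noteq> 0" "b * pderiv a = a * pderiv b"
  obtains c where "a = smult c b"
proof -
  have "gcd a b \<noteq> 0" using assms(1) by simp
  then obtain a' b' where ab: "a = a' * gcd a b" "b = b' * gcd a b" "coprime a' b'"
    using gcd_coprime_exists by blast
  define g where "g = gcd a b"
  have ab: "a = a' * g" "b = b' * g" "coprime a' b'" using ab by (auto simp: g_def)
  have g: "g \<noteq> 0" and b': "b' \<noteq> 0" using ab(2) assms(1) by auto
  have "g\<^sup>2 * (b' * pderiv a') = g\<^sup>2 * (a' * pderiv b')"
    using assms(2) unfolding ab(1,2) pderiv_mult by (simp add: algebra_simps power2_eq_square)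
  then have eq: "b' * pderiv a' = a' * pderiv b'" using g by simp
  then have "b' dvd pderiv b'"
    using ab(3) by (metis coprime_commute coprime_dvd_mult_right_iff dvd_triv_left)
  then have "pderiv b' = 0"
    by (metis b' degree_pderiv dvd_imp_degree_le diff_less not_le pderiv_eq_0_iff zero_less_one gr0I)
  moreover from this have "pderiv a' = 0" using eq b' by simp
  ultimately obtain u v where uv: "a' = [:u:]" "b' = [:v:]"
    by (metis pderiv_eq_0_iff degree_eq_zeroE)
  have "v \<noteq> 0" using b' uv by auto
  then have "a = smult (u / v) b" unfolding ab(1,2) uv by simp
  then show ?thesis using that by blast
qed

lemma ds_slice: "poly (ds p) [:t:] = pderiv (poly p [:t:])"
  by (induction p) (simp_all add: pderiv_add pderiv_mult pderiv_smult)

definition slice_s :: "complex \<Rightarrow> bipoly \<Rightarrow> complex poly" where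
  "slice_s s p = map_poly (\<lambda>c. poly c s) p"

lemma slice_s_simps [simp]: "slice_s s 0 = 0" "slice_s s (pCons a p) = pCons (poly a s) (slice_s s p)"
  by (simp_all add: slice_s_def map_poly_pCons)

lemma poly_slice_s: "poly (slice_s s p) t = ev p (s, t)"
  by (induction p) simp_all

lemma pderiv_slice_s: "pderiv (slice_s s p) = slice_s s (dt p)"
proof (induction p)
  case (pCons a p)
  have "slice_s s (p + q) = slice_s s p + slice_s s q" for p q
    by (rule poly_eqI) (simp add: slice_s_def coeff_map_poly)
  with pCons show ?case by (simp add: pderiv_pCons)
qed simp

text \<open>
  A quotient whose partial derivatives vanish is constant on each horizontal and each vertical
  line, hence constant.
\<close>

lemma proportional_if_jacobian_0:
  assumes b: "b \<noteq> 0" and s: "b * ds a = a * ds b" and t: "b * dt a = a * dt b"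
  obtains c where "a = const c * b"
proof -
  obtain s0 t0 where z0: "ev b (s0, t0) \<noteq> 0" using b bipoly_eq_0I by fastforce
  define c where "c = ev a (s0, t0) / ev b (s0, t0)"
  have ratio_t: "ev a (s1, t1) * ev b (s1, t2) = ev a (s1, t2) * ev b (s1, t1)"
    if "ev b (s1, t1) \<noteq> 0" for s1 t1 t2
  proof -
    have "slice_s s1 b \<noteq> 0" using that poly_slice_s[of s1 b t1] by auto
    moreover have "slice_s s1 b * pderiv (slice_s s1 a) = slice_s s1 a * pderiv (slice_s s1 b)"
    proof -
      have "poly (slice_s s1 b * pderiv (slice_s s1 a)) x = poly (slice_s s1 a * pderiv (slice_s s1 b)) x" for x
        using arg_cong[OF t, of "\<lambda>p. ev p (s1, x)"] by (simp add: poly_slice_s pderiv_slice_s)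
      then show ?thesis by (metis poly_eq_poly_eq_iff ext)
    qed
    ultimately obtain d where "slice_s s1 a = smult d (slice_s s1 b)"
      by (rule poly_wronskian_0)
    then have "ev a (s1, t') = d * ev b (s1, t')" for t'
      by (metis poly_slice_s poly_smult)
    then show ?thesis by simp
  qed
  have ratio_s: "ev a (s1, t1) * ev b (s2, t1) = ev a (s2, t1) * ev b (s1, t1)"
    if "ev b (s1, t1) \<noteq> 0" for s1 s2 t1
  proof -
    have "poly b [:t1:] \<noteq> 0" using that by (auto simp: ev_def)
    moreover have "poly b [:t1:] * pderiv (poly a [:t1:]) = poly a [:t1:] * pderiv (poly b [:t1:])"
      using arg_cong[OF s, of "\<lambda>p. poly p [:t1:]"] by (simp add: ds_slice)
    ultimately obtain d where "poly a [:t1:] = smult d (poly b [:t1:])"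
      by (rule poly_wronskian_0)
    then show ?thesis by (simp add: ev_def)
  qed
  have "\<forall>\<^sub>F z in generic. ev a z = ev (const c * b) z"
  proof -
    have "\<forall>\<^sub>F z in generic. poly (slice_s s0 b) (snd z) \<noteq> 0"
    proof -
      define f :: bipoly where "f = map_poly (\<lambda>c. [:c:]) (slice_s s0 b)"
      have "ev (map_poly (\<lambda>c. [:c:]) q) z = poly q (snd z)" for q z
        by (induction q) (simp_all add: map_poly_pCons)
      then have f: "ev f z = poly (slice_s s0 b) (snd z)" for z
        by (simp add: f_def)
      have "f \<noteq> 0" using z0 f[of "(s0, t0)"] by (auto simp: poly_slice_s)
      from eventually_ev_neq_0[OF this] show ?thesis by (simp add: f)
    qed
    then show ?thesis using eventually_ev_neq_0[OF b]
    proof eventually_elim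
      case (elim z)
      obtain s1 t1 where z: "z = (s1, t1)" by (cases z)
      have b01: "ev b (s0, t1) \<noteq> 0" using elim by (simp add: z poly_slice_s)
      have "(ev b (s0, t1) * ev b (s0, t0)) * ev a z =
          ev b (s0, t0) * (ev a (s1, t1) * ev b (s0, t1))" by (simp add: z)
      also have "\<dots> = (ev a (s0, t1) * ev b (s0, t0)) * ev b (s1, t1)"
        unfolding ratio_s[OF b01, of s1, symmetric] by simp
      also have "\<dots> = (ev b (s0, t1) * ev b (s0, t0)) * (c * ev b z)"
        unfolding ratio_t[OF z0, of t1, symmetric] using z0 by (simp add: z c_def)
      finally show ?case using b01 z0 by simp
    qed
  qed
  then have "a = const c * b" by (rule bipoly_eqI_generic)
  then show ?thesis by (rule that)
qed

section \<open>Foliations invariant under a rational map of the plane\<close>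

text \<open>
  Throughout this section, a foliation is the kernel of a form \<open>P ds + Q dt\<close> with coprime
  polynomials \<open>P\<close> and \<open>Q\<close>, and its singular points are the common zeros of \<open>P\<close> and \<open>Q\<close>.
\<close>

lemma prime_factor_through_point:
  fixes K :: bipoly
  assumes "K \<noteq> 0" "ev K z = 0"
  obtains k where "prime k" "k dvd K" "ev k z = 0"
proof -
  have "K \<noteq> 0 \<longrightarrow> ev K z = 0 \<longrightarrow> (\<exists>k. prime k \<and> k dvd K \<and> ev k z = 0)"
  proof (induction K rule: prime_divisors_induct)
    case (unit x)
    then obtain y where "1 = x * y" by auto
    then have "ev x z * ev y z = 1" by (metis ev_simps(2,7))
    then show ?case by auto
  next
    case (factor p x)
    show ?case
    proof (intro impI)
      assume "p * x \<noteq> 0" "ev (p * x) z = 0"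
      then have "x \<noteq> 0" "ev p z = 0 \<or> ev x z = 0" by auto
      then show "\<exists>k. prime k \<and> k dvd p * x \<and> ev k z = 0"
        using factor by (metis dvd_mult dvd_triv_left)
    qed
  qed simp
  with assms that show ?thesis by blast
qed

lemma bipoly_restrict_s:
  "\<exists>p1. \<forall>z. ev p z = poly (slice_s c p) (snd z) + (fst z - c) * ev p1 z"
  proof (induction p)
    case (pCons a p)
    then obtain p1 where p1: "\<And>z. ev p z = poly (slice_s c p) (snd z) + (fst z - c) * ev p1 z"
      by blast
    have "poly a x = poly a c + (x - c) * poly (synthetic_div a c) x" for x
    proof -
      have "poly (a + smult c (synthetic_div a c)) x = poly (pCons (poly a c) (synthetic_div a c)) x"
        by (simp only: synthetic_div_correct)
      then show ?thesis by (simp add: algebra_simps)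
    qed
    then have "\<forall>z. ev (pCons a p) z = poly (slice_s c (pCons a p)) (snd z) +
        (fst z - c) * ev (pCons (synthetic_div a c) p1) z"
      by (auto simp: p1 algebra_simps)
    then show ?case by blast
  qed (auto intro: exI[of _ 0])

lemma coprime_slice_neq_0:
  assumes "coprime P Q"
  shows "slice_s c P \<noteq> 0 \<or> slice_s c Q \<noteq> 0"
proof (rule ccontr)
  assume 0: "\<not> ?thesis"
  have "\<s> - const c dvd p" if p: "slice_s c p = 0" for p
  proof -
    obtain p1 where "\<And>z. ev p z = poly (slice_s c p) (snd z) + (fst z - c) * ev p1 z"
      using bipoly_restrict_s by blast
    then have "p = (\<s> - const c) * p1"
      using p by (intro bipoly_eqI_generic) simp
    then show ?thesis by simp
  qed
  with 0 assms have "is_unit (\<s> - const c)" by (meson coprime_common_divisor)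
  then obtain y where "1 = (\<s> - const c) * y" by auto
  then have "ev 1 (c, 0) = ev ((\<s> - const c) * y) (c, 0)" by simp
  then show False by simp
qed

lemma linear_system_2:
  fixes a b c d x y :: complex
  assumes "a * x + b * y = 0" "c * x + d * y = 0" "a * d - b * c \<noteq> 0"
  shows "x = 0" "y = 0"
proof -
  have "(a * d - b * c) * x = d * (a * x + b * y) - b * (c * x + d * y)"
    "(a * d - b * c) * y = a * (c * x + d * y) - c * (a * x + b * y)"
    by (simp_all add: algebra_simps)
  with assms show "x = 0" "y = 0" by auto
qed

lemma ev_neq_0_nearby_s: "ev p (s, t) \<noteq> 0 \<Longrightarrow> \<forall>\<^sub>F x in nhds s. ev p (x, t) \<noteq> 0"
  by (rule tendsto_imp_eventually_ne[of "\<lambda>x. ev p (x, t)" "ev p (s, t)"])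
    (use DERIV_isCont[OF ev_chain_rule[OF DERIV_ident DERIV_const, of p t s]]
        tendsto_at_iff_tendsto_nhds[of "\<lambda>x. ev p (x, t)" s]
      in \<open>simp_all add: isCont_def\<close>)

lemma ev_neq_0_nearby_t: "ev p (s, t) \<noteq> 0 \<Longrightarrow> \<forall>\<^sub>F x in nhds t. ev p (s, x) \<noteq> 0"
  by (rule tendsto_imp_eventually_ne[of "\<lambda>x. ev p (s, x)" "ev p (s, t)"])
    (use DERIV_isCont[OF ev_chain_rule[OF DERIV_const DERIV_ident, of p s t]]
        tendsto_at_iff_tendsto_nhds[of "\<lambda>x. ev p (s, x)" t]
      in \<open>simp_all add: isCont_def\<close>)

text \<open>
  The partial derivative of \<open>p / q\<close>, where \<open>D\<close> is the corresponding derivation of polynomials.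
\<close>

definition quot_deriv :: "(bipoly \<Rightarrow> bipoly) \<Rightarrow> bipoly \<Rightarrow> bipoly \<Rightarrow> complex \<times> complex \<Rightarrow> complex" where
  "quot_deriv D p q z = (ev (D p) z * ev q z - ev p z * ev (D q) z) / (ev q z)\<^sup>2"

lemma quot_deriv_s:
  "ev q (s, t) \<noteq> 0 \<Longrightarrow>
   ((\<lambda>x. ev p (x, t) / ev q (x, t)) has_field_derivative quot_deriv ds p q (s, t)) (at s)"
  using DERIV_divide[OF ev_chain_rule[OF DERIV_ident DERIV_const, of p t s]
      ev_chain_rule[OF DERIV_ident DERIV_const, of q t s]]
  by (simp add: quot_deriv_def power2_eq_square)

lemma quot_deriv_t:
  "ev q (s, t) \<noteq> 0 \<Longrightarrow>
   ((\<lambda>x. ev p (s, x) / ev q (s, x)) has_field_derivative quot_deriv dt p q (s, t)) (at t)"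
  using DERIV_divide[OF ev_chain_rule[OF DERIV_const DERIV_ident, of p s t]
      ev_chain_rule[OF DERIV_const DERIV_ident, of q s t]]
  by (simp add: quot_deriv_def power2_eq_square)

text \<open>
  A rational map \<open>G = (S, T)\<close> of the plane is given by numerators and denominators; the points
  where a denominator vanishes are left aside, even if \<open>G\<close> extends to them.
\<close>

locale plane_map =
  fixes Sn Sd Tn Td :: bipoly
begin

definition regular :: "complex \<times> complex \<Rightarrow> bool" where
  "regular z \<longleftrightarrow> ev Sd z \<noteq> 0 \<and> ev Td z \<noteq> 0"

definition S :: "complex \<times> complex \<Rightarrow> complex" where "S z = ev Sn z / ev Sd z"
definition T :: "complex \<times> complex \<Rightarrow> complex" where "T z = ev Tn z / ev Td z"
definition G :: "complex \<times> complex \<Rightarrow> complex \<times> complex" where "G z = (S z, T z)"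

definition "Ss = quot_deriv ds Sn Sd"
definition "St = quot_deriv dt Sn Sd"
definition "Ts = quot_deriv ds Tn Td"
definition "Tt = quot_deriv dt Tn Td"

definition jac :: "complex \<times> complex \<Rightarrow> complex" where
  "jac z = Ss z * Tt z - St z * Ts z"

lemma ev_G_deriv_s:
  assumes "regular (s, t)"
  shows "((\<lambda>x. ev p (G (x, t))) has_field_derivative
    ev (ds p) (G (s, t)) * Ss (s, t) + ev (dt p) (G (s, t)) * Ts (s, t)) (at s)"
  unfolding G_def S_def T_def Ss_def Ts_def
  using assms by (intro ev_chain_rule quot_deriv_s) (auto simp: regular_def)

lemma ev_G_deriv_t:
  assumes "regular (s, t)"
  shows "((\<lambda>x. ev p (G (s, x))) has_field_derivative
    ev (ds p) (G (s, t)) * St (s, t) + ev (dt p) (G (s, t)) * Tt (s, t)) (at t)"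
  unfolding G_def S_def T_def St_def Tt_def
  using assms by (intro ev_chain_rule quot_deriv_t) (auto simp: regular_def)

lemma regular_nearby_s: "regular (s, t) \<Longrightarrow> \<forall>\<^sub>F x in nhds s. regular (x, t)"
  unfolding regular_def by (simp add: eventually_conj_iff ev_neq_0_nearby_s)

lemma regular_nearby_t: "regular (s, t) \<Longrightarrow> \<forall>\<^sub>F x in nhds t. regular (s, x)"
  unfolding regular_def by (simp add: eventually_conj_iff ev_neq_0_nearby_t)

text \<open>
  \<open>cleared \<phi> N F\<close>: the \<open>N\<close>-th power of the two denominators turns \<open>\<phi>\<close> into the polynomial \<open>F\<close>.
  The functions \<open>\<phi>\<close> for which this is possible are the regular functions on the set of regular
  points; they stand in for elements of a localised polynomial ring.
\<close>

definition cleared :: "(complex \<times> complex \<Rightarrow> complex) \<Rightarrow> nat \<Rightarrow> bipoly \<Rightarrow> bool" where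
  "cleared \<phi> N F \<longleftrightarrow> (\<forall>z. regular z \<longrightarrow> ev F z = ev (Sd * Td) z ^ N * \<phi> z)"

definition rat :: "(complex \<times> complex \<Rightarrow> complex) \<Rightarrow> bool" where
  "rat \<phi> \<longleftrightarrow> (\<exists>N F. cleared \<phi> N F)"

lemma clearedD: "cleared \<phi> N F \<Longrightarrow> regular z \<Longrightarrow> ev F z = (ev Sd z * ev Td z) ^ N * \<phi> z"
  unfolding cleared_def by (metis ev_simps(7))

lemma cleared_eq_0: "cleared \<phi> N F \<Longrightarrow> regular z \<Longrightarrow> ev F z = 0 \<longleftrightarrow> \<phi> z = 0"
  by (simp add: clearedD regular_def)

lemma cleared_add: "cleared \<phi> M A \<Longrightarrow> cleared \<psi> N B \<Longrightarrow>
    cleared (\<lambda>z. \<phi> z + \<psi> z) (M + N) ((Sd * Td) ^ N * A + (Sd * Td) ^ M * B)"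
  by (auto simp: cleared_def algebra_simps power_add)

lemma cleared_mult: "cleared \<phi> M A \<Longrightarrow> cleared \<psi> N B \<Longrightarrow>
    cleared (\<lambda>z. \<phi> z * \<psi> z) (M + N) (A * B)"
  by (auto simp: cleared_def algebra_simps power_add)

lemma cleared_raise: "cleared \<phi> M A \<Longrightarrow> cleared \<phi> (M + N) ((Sd * Td) ^ N * A)"
  by (auto simp: cleared_def algebra_simps power_add)

lemma rat_ev [intro]: "rat (ev p)"
  unfolding rat_def cleared_def by (rule exI[of _ 0], rule exI[of _ p]) simp

lemma rat_cong: "rat \<phi> \<Longrightarrow> (\<And>z. regular z \<Longrightarrow> \<phi> z = \<psi> z) \<Longrightarrow> rat \<psi>"
  by (auto simp: rat_def cleared_def)

lemma rat_const [intro]: "rat (\<lambda>z. c)"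
  by (rule rat_cong[OF rat_ev[of "const c"]]) simp

lemma rat_add [intro]: "rat \<phi> \<Longrightarrow> rat \<psi> \<Longrightarrow> rat (\<lambda>z. \<phi> z + \<psi> z)"
  unfolding rat_def using cleared_add by blast

lemma rat_mult [intro]: "rat \<phi> \<Longrightarrow> rat \<psi> \<Longrightarrow> rat (\<lambda>z. \<phi> z * \<psi> z)"
  unfolding rat_def using cleared_mult by blast

lemma rat_diff [intro]: "rat \<phi> \<Longrightarrow> rat \<psi> \<Longrightarrow> rat (\<lambda>z. \<phi> z - \<psi> z)"
  using rat_add[of \<phi> "\<lambda>z. -1 * \<psi> z"] rat_mult[of "\<lambda>z. -1" \<psi>] by auto

lemma rat_S [intro]: "rat S"
  unfolding rat_def cleared_def
  by (rule exI[of _ 1], rule exI[of _ "Sn * Td"]) (auto simp: S_def regular_def)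

lemma rat_T [intro]: "rat T"
  unfolding rat_def cleared_def
  by (rule exI[of _ 1], rule exI[of _ "Tn * Sd"]) (auto simp: T_def regular_def)

lemma rat_quot_deriv_S: "rat (quot_deriv D Sn Sd)"
  unfolding rat_def cleared_def
  by (rule exI[of _ 2], rule exI[of _ "(D Sn * Sd - Sn * D Sd) * Td\<^sup>2"])
    (auto simp: quot_deriv_def regular_def power2_eq_square)

lemma rat_quot_deriv_T: "rat (quot_deriv D Tn Td)"
  unfolding rat_def cleared_def
  by (rule exI[of _ 2], rule exI[of _ "(D Tn * Td - Tn * D Td) * Sd\<^sup>2"])
    (auto simp: quot_deriv_def regular_def power2_eq_square)

lemma rat_partials [intro]: "rat Ss" "rat St" "rat Ts" "rat Tt"
  unfolding Ss_def St_def Ts_def Tt_def by (rule rat_quot_deriv_S rat_quot_deriv_T)+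

lemma rat_jac [intro]: "rat jac"
  using rat_diff[OF rat_mult[OF rat_partials(1,4)] rat_mult[OF rat_partials(2,3)]]
  by (simp add: jac_def[abs_def])

lemma rat_poly: "rat \<phi> \<Longrightarrow> rat (\<lambda>z. poly q (\<phi> z))"
  by (induction q) auto

lemma rat_ev_G [intro]: "rat (\<lambda>z. ev p (G z))"
proof (induction p)
  case (pCons a p)
  have "rat (\<lambda>z. poly a (S z) + T z * ev p (G z))"
    using pCons(2) by (intro rat_add rat_mult rat_poly rat_S rat_T)
  then show ?case by (simp add: G_def)
qed auto

end

text \<open>
  By the next lemmas, a nonzero Jacobian at a single point makes the image Zariski dense: an
  equation of least degree for the image would have partial derivatives that also vanish on the
  image, because the Jacobian matrix is invertible generically.
\<close>

locale dominant_plane_map = plane_map +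
  assumes dominant: "\<exists>z. regular z \<and> jac z \<noteq> 0"
begin

lemma denominators_neq_0: "Sd \<noteq> 0" "Td \<noteq> 0"
  using dominant by (auto simp: regular_def)

lemma generic_regular: "\<forall>\<^sub>F z in generic. regular z"
  unfolding regular_def
  by (intro eventually_conj eventually_ev_neq_0 denominators_neq_0)

lemma rat_eq_0_if_generically_0:
  assumes "rat \<phi>" "\<forall>\<^sub>F z in generic. \<phi> z = 0" "regular z"
  shows "\<phi> z = 0"
proof -
  obtain N F where F: "cleared \<phi> N F" using assms(1) by (auto simp: rat_def)
  have "\<forall>\<^sub>F z in generic. ev F z = 0"
    using assms(2) generic_regular by eventually_elim (simp add: clearedD[OF F])
  then have "F = 0" by (rule bipoly_eq_0_if_generically_0)
  then show ?thesis using cleared_eq_0[OF F assms(3)] by simp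
qed

lemma rat_generically_neq_0:
  assumes "rat \<phi>" "regular z" "\<phi> z \<noteq> 0"
  shows "\<forall>\<^sub>F z in generic. \<phi> z \<noteq> 0"
proof -
  obtain N F where F: "cleared \<phi> N F" using assms(1) by (auto simp: rat_def)
  then have "ev F z \<noteq> 0"
    using cleared_eq_0[OF F assms(2)] assms(3) by simp
  then have "F \<noteq> 0" by auto
  from eventually_ev_neq_0[OF this] generic_regular show ?thesis
    by eventually_elim (simp add: cleared_eq_0[OF F])
qed

lemma generic_jac: "\<forall>\<^sub>F z in generic. jac z \<noteq> 0"
  using dominant rat_generically_neq_0[OF rat_jac] by blast

lemma partials_vanish_on_image:
  assumes "\<And>z. regular z \<Longrightarrow> ev g (G z) = 0" and z: "regular z"
  shows "ev (ds g) (G z) = 0" "ev (dt g) (G z) = 0"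
proof -
  have *: "\<forall>\<^sub>F z in generic. ev (ds g) (G z) = 0 \<and> ev (dt g) (G z) = 0"
    using generic_regular generic_jac
  proof eventually_elim
    case (elim z)
    obtain s t where z: "z = (s, t)" by (cases z)
    have reg: "regular (s, t)" using elim z by simp
    have "((\<lambda>x. ev g (G (x, t))) has_field_derivative 0) (at s)"
      by (subst DERIV_cong_ev[OF refl _ refl, of _ "\<lambda>_. 0"])
        (use regular_nearby_s[OF reg] assms(1) in \<open>auto elim: eventually_mono\<close>)
    then have 1: "Ss z * ev (ds g) (G z) + Ts z * ev (dt g) (G z) = 0"
      using DERIV_unique[OF ev_G_deriv_s[OF reg]] z by (simp add: mult.commute)
    have "((\<lambda>x. ev g (G (s, x))) has_field_derivative 0) (at t)"
      by (subst DERIV_cong_ev[OF refl _ refl, of _ "\<lambda>_. 0"])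
        (use regular_nearby_t[OF reg] assms(1) in \<open>auto elim: eventually_mono\<close>)
    then have 2: "St z * ev (ds g) (G z) + Tt z * ev (dt g) (G z) = 0"
      using DERIV_unique[OF ev_G_deriv_t[OF reg]] z by (simp add: mult.commute)
    have "Ss z * Tt z - Ts z * St z \<noteq> 0" using elim(2) by (simp add: jac_def mult.commute)
    with linear_system_2[OF 1 2] show ?case by blast
  qed
  show "ev (ds g) (G z) = 0" "ev (dt g) (G z) = 0"
    by (rule rat_eq_0_if_generically_0[OF rat_ev_G _ z], use * in \<open>auto elim: eventually_mono\<close>)+
qed

lemma image_not_in_curve:
  assumes "\<And>z. regular z \<Longrightarrow> ev g (G z) = 0"
  shows "g = 0"
  using assms
proof (induction "degree g" arbitrary: g rule: less_induct)
  case less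
  have "degree g = 0"
  proof (rule ccontr)
    assume deg: "degree g \<noteq> 0"
    then have "dt g = 0" using less partials_vanish_on_image(2) by (simp add: degree_pderiv)
    with deg show False by (simp add: pderiv_eq_0_iff)
  qed
  then obtain r where g: "g = [:r:]" by (metis degree_eq_zeroE)
  have "r = 0" if "\<And>z. regular z \<Longrightarrow> ev [:r:] (G z) = 0" for r
    using that
  proof (induction "degree r" arbitrary: r rule: less_induct)
    case less
    have "degree r = 0"
    proof (rule ccontr)
      assume deg: "degree r \<noteq> 0"
      have "ev [:pderiv r:] (G z) = 0" if "regular z" for z
        using partials_vanish_on_image(1)[of "[:r:]", OF less(2) that] by simp
      then have "pderiv r = 0" using less(1) deg by (simp add: degree_pderiv)
      with deg show False by (simp add: pderiv_eq_0_iff)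
    qed
    then obtain c where "r = [:c:]" by (metis degree_eq_zeroE)
    then show ?case using less(2) dominant by auto
  qed
  with less(2) g show ?case by auto
qed

lemma generic_ev_G_neq_0:
  assumes "g \<noteq> 0"
  shows "\<forall>\<^sub>F z in generic. ev g (G z) \<noteq> 0"
  using image_not_in_curve[of g] assms rat_generically_neq_0[OF rat_ev_G] by blast

text \<open>
  \<open>G\<close> maps the foliation of \<open>\<omega> = P ds + Q dt\<close> into itself iff the pull-back of \<open>\<omega>\<close> is
  proportional to \<open>\<omega>\<close>; the equation says that their wedge product vanishes.
\<close>

definition invariant :: "bipoly \<Rightarrow> bipoly \<Rightarrow> bool" where
  "invariant P Q \<longleftrightarrow> (\<forall>z. regular z \<longrightarrow>
     ev P z * (ev P (G z) * St z + ev Q (G z) * Tt z) =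
     ev Q z * (ev P (G z) * Ss z + ev Q (G z) * Ts z))"

lemma pulled_back_form_multiple:
  assumes "coprime P Q" "invariant P Q"
  obtains N K where "cleared (\<lambda>z. ev P (G z) * Ss z + ev Q (G z) * Ts z) N (K * P)"
    "cleared (\<lambda>z. ev P (G z) * St z + ev Q (G z) * Tt z) N (K * Q)"
proof -
  define m1 where "m1 = (\<lambda>z. ev P (G z) * Ss z + ev Q (G z) * Ts z)"
  define m2 where "m2 = (\<lambda>z. ev P (G z) * St z + ev Q (G z) * Tt z)"
  have "rat m1" "rat m2"
    unfolding m1_def m2_def by (intro rat_add rat_mult rat_ev_G rat_partials)+
  then obtain N1 F1 N2 F2 where F: "cleared m1 N1 F1" "cleared m2 N2 F2"
    by (auto simp: rat_def)
  define M1 where "M1 = (Sd * Td) ^ N2 * F1"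
  define M2 where "M2 = (Sd * Td) ^ N1 * F2"
  have M: "cleared m1 (N1 + N2) M1" "cleared m2 (N1 + N2) M2"
    using cleared_raise[OF F(1), of N2] cleared_raise[OF F(2), of N1]
    by (simp_all add: M1_def M2_def add.commute)
  have "\<forall>\<^sub>F z in generic. ev (P * M2) z = ev (Q * M1) z"
    using generic_regular
  proof eventually_elim
    case (elim z)
    have "ev P z * m2 z = ev Q z * m1 z"
      using assms(2) elim by (simp add: invariant_def m1_def m2_def del: split_paired_All)
    then show ?case
      by (simp add: clearedD[OF M(1) elim] clearedD[OF M(2) elim] mult.left_commute)
  qed
  then have "P * M2 = Q * M1" by (rule bipoly_eqI_generic)
  then obtain K where "M1 = K * P" "M2 = K * Q"
    using coprime_common_multiplier[OF assms(1)] by blast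
  with M that show ?thesis by (simp add: m1_def m2_def)
qed

text \<open>
  Where \<open>G\<close> is a local isomorphism, it carries the foliation near \<open>z\<close> to the foliation near
  \<open>G z\<close>. In terms of forms, the pull-back of \<open>\<omega>\<close> is \<open>K \<omega>\<close> with a polynomial \<open>K\<close> up to
  denominators; so it vanishes where \<open>\<omega>\<close> does, and an invertible Jacobian matrix then forces
  \<open>\<omega>\<close> to vanish at \<open>G z\<close>. The converse is harder, because \<open>K\<close> might vanish at \<open>z\<close>.
\<close>

lemma singular_forward:
  assumes "coprime P Q" "invariant P Q" "regular z" "jac z \<noteq> 0"
    and "ev P z = 0" "ev Q z = 0"
  shows "ev P (G z) = 0" "ev Q (G z) = 0"
proof -
  obtain N K where m: "cleared (\<lambda>z. ev P (G z) * Ss z + ev Q (G z) * Ts z) N (K * P)"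
    "cleared (\<lambda>z. ev P (G z) * St z + ev Q (G z) * Tt z) N (K * Q)"
    using pulled_back_form_multiple[OF assms(1,2)] .
  have L: "Ss z * ev P (G z) + Ts z * ev Q (G z) = 0" "St z * ev P (G z) + Tt z * ev Q (G z) = 0"
    using cleared_eq_0[OF m(1) assms(3)] cleared_eq_0[OF m(2) assms(3)]
      assms(5,6) by (simp_all add: mult.commute)
  have "Ss z * Tt z - Ts z * St z \<noteq> 0" using assms(4) by (simp add: jac_def mult.commute)
  from linear_system_2[OF L this] show "ev P (G z) = 0" "ev Q (G z) = 0" .
qed

text \<open>
  For the converse, fix an irreducible curve through a regular point \<open>z0\<close>, with equation \<open>k\<close>,
  and consider the regular functions that vanish on it. They form a prime ideal.
\<close>

context
  fixes k :: bipoly and z0 :: "complex \<times> complex"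
  assumes k: "prime k" "ev k z0 = 0" and z0: "regular z0"
begin

definition zero_on where
  "zero_on \<phi> \<longleftrightarrow> (\<exists>N F. cleared \<phi> N F \<and> k dvd F)"

lemma not_k_dvd_denominators: "\<not> k dvd (Sd * Td) ^ N"
proof
  assume "k dvd (Sd * Td) ^ N"
  then have "k dvd Sd * Td" using k(1) prime_dvd_power by blast
  then obtain l where "Sd * Td = k * l" by auto
  then have "ev Sd z0 * ev Td z0 = ev k z0 * ev l z0" by (metis ev_simps(7))
  then show False using k(2) z0 by (auto simp: regular_def)
qed

lemma zero_on_at:
  assumes "zero_on \<phi>" shows "\<phi> z0 = 0"
proof -
  obtain N l where "cleared \<phi> N (k * l)" using assms by (auto simp: zero_on_def elim!: dvdE)
  from cleared_eq_0[OF this z0] show ?thesis using k(2) by simp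
qed

lemma zero_on_add: "zero_on \<phi> \<Longrightarrow> zero_on \<psi> \<Longrightarrow> zero_on (\<lambda>z. \<phi> z + \<psi> z)"
  unfolding zero_on_def using cleared_add by (meson dvd_add dvd_mult)

lemma zero_on_mult: "zero_on \<phi> \<Longrightarrow> rat \<psi> \<Longrightarrow> zero_on (\<lambda>z. \<phi> z * \<psi> z)"
  unfolding zero_on_def rat_def using cleared_mult by (meson dvd_mult2)

lemma zero_on_diff: "zero_on \<phi> \<Longrightarrow> zero_on \<psi> \<Longrightarrow> zero_on (\<lambda>z. \<phi> z - \<psi> z)"
  using zero_on_add[of \<phi> "\<lambda>z. \<psi> z * -1"] zero_on_mult[of \<psi> "\<lambda>z. -1"] by auto

lemma zero_on_cong: "zero_on \<phi> \<Longrightarrow> (\<And>z. regular z \<Longrightarrow> \<phi> z = \<psi> z) \<Longrightarrow> zero_on \<psi>"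
  by (auto simp: zero_on_def cleared_def)

lemma zero_on_cleared:
  assumes "zero_on \<phi>" "cleared \<phi> N F"
  shows "k dvd F"
proof -
  obtain M A where A: "cleared \<phi> M A" "k dvd A" using assms(1) by (auto simp: zero_on_def)
  have "\<forall>\<^sub>F z in generic. ev ((Sd * Td) ^ M * F) z = ev ((Sd * Td) ^ N * A) z"
    using generic_regular
    by eventually_elim (use A assms(2) in \<open>auto simp: cleared_def\<close>)
  then have "(Sd * Td) ^ M * F = (Sd * Td) ^ N * A" by (rule bipoly_eqI_generic)
  then have "k dvd (Sd * Td) ^ M * F" using A(2) by simp
  then show ?thesis using k(1) not_k_dvd_denominators prime_dvd_mult_iff by blast
qed

lemma zero_on_prime:
  assumes "zero_on (\<lambda>z. \<phi> z * \<psi> z)" "rat \<phi>" "rat \<psi>"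
  shows "zero_on \<phi> \<or> zero_on \<psi>"
proof -
  obtain M A N B where AB: "cleared \<phi> M A" "cleared \<psi> N B" using assms(2,3) by (auto simp: rat_def)
  have "k dvd A * B" using zero_on_cleared[OF assms(1) cleared_mult[OF AB]] .
  then have "k dvd A \<or> k dvd B" using k(1) prime_dvd_mult_iff by blast
  with AB show ?thesis by (auto simp: zero_on_def)
qed

text \<open>
  A polynomial equation for \<open>\<phi>\<close> splits into linear factors, and one of them vanishes on the whole
  curve, because the curve is irreducible.
\<close>

lemma constant_on:
  assumes "rat \<phi>" "q \<noteq> 0" "zero_on (\<lambda>z. poly q (\<phi> z))"
  obtains c where "zero_on (\<lambda>z. \<phi> z - c)"
proof -
  have "\<exists>c. zero_on (\<lambda>z. \<phi> z - c)"
    using assms(2,3)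
  proof (induction "degree q" arbitrary: q)
    case 0
    then obtain a where "q = [:a:]" by (metis degree_eq_zeroE)
    then show ?case using zero_on_at[OF 0(3)] 0(2) by simp
  next
    case (Suc n)
    then obtain c where "poly q c = 0"
      using fundamental_theorem_of_algebra by (metis constant_degree nat.distinct(1))
    then obtain r where r: "q = [:-c, 1:] * r" by (metis dvdE poly_eq_0_iff_dvd)
    have "r \<noteq> 0" using r Suc by auto
    then have "n = degree r" using Suc(2) r by (simp add: degree_mult_eq del: mult_pCons_left)
    have "zero_on (\<lambda>z. (\<phi> z - c) * poly r (\<phi> z))"
      using Suc(4) by (rule zero_on_cong) (simp add: r algebra_simps)
    then have "zero_on (\<lambda>z. \<phi> z - c) \<or> zero_on (\<lambda>z. poly r (\<phi> z))"
      by (rule zero_on_prime) (intro rat_diff rat_const rat_poly assms(1))+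
    then show ?case
      using Suc(1)[OF \<open>n = degree r\<close> \<open>r \<noteq> 0\<close>] by blast
  qed
  with that show ?thesis by blast
qed

lemma gradient_if_constant_on:
  assumes "k dvd n - const c * d" "ev d z0 \<noteq> 0"
  obtains l where "quot_deriv ds n d z0 = l * ev (ds k) z0" "quot_deriv dt n d z0 = l * ev (dt k) z0"
proof -
  obtain l where "n - const c * d = k * l" using assms(1) by auto
  then have n: "n = const c * d + k * l" by (simp add: algebra_simps)
  have c: "ds (const c) = 0" "dt (const c) = 0" by (simp_all add: const_def pderiv_pCons)
  have "quot_deriv ds n d z0 = ev l z0 / ev d z0 * ev (ds k) z0"
    "quot_deriv dt n d z0 = ev l z0 / ev d z0 * ev (dt k) z0"
    using k(2) assms(2) unfolding n
    by (simp_all add: quot_deriv_def pderiv_mult pderiv_add c field_simps power2_eq_square)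
  then show ?thesis by (rule that)
qed

text \<open>
  A curve that \<open>G\<close> contracts consists of critical points of \<open>G\<close>, since both components of \<open>G\<close>
  have a gradient proportional to that of \<open>k\<close>.
\<close>

lemma jac_0_if_image_constant_on:
  assumes "zero_on (\<lambda>z. S z - c)" "zero_on (\<lambda>z. T z - c')"
  shows "jac z0 = 0"
proof -
  have "cleared (\<lambda>z. S z - c) 1 ((Sn - const c * Sd) * Td)"
    "cleared (\<lambda>z. T z - c') 1 ((Tn - const c' * Td) * Sd)"
    by (auto simp: cleared_def S_def T_def regular_def field_simps)
  then have "k dvd (Sn - const c * Sd) * Td" "k dvd (Tn - const c' * Td) * Sd"
    using zero_on_cleared assms by blast+
  moreover have "\<not> k dvd Td" "\<not> k dvd Sd"
    using not_k_dvd_denominators[of 1] by auto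
  ultimately have "k dvd Sn - const c * Sd" "k dvd Tn - const c' * Td"
    using k(1) prime_dvd_mult_iff by blast+
  then obtain l l' where "Ss z0 = l * ev (ds k) z0" "St z0 = l * ev (dt k) z0"
    "Ts z0 = l' * ev (ds k) z0" "Tt z0 = l' * ev (dt k) z0"
    using z0 gradient_if_constant_on unfolding Ss_def St_def Ts_def Tt_def regular_def by metis
  then show ?thesis by (simp add: jac_def)
qed

end

text \<open>
  If \<open>K\<close> vanished at \<open>z0\<close>, it would vanish on an irreducible curve through \<open>z0\<close>. Since \<open>z0\<close> is
  not critical, this curve would be mapped to common zeros of \<open>P\<close> and \<open>Q\<close>. These are isolated, so
  the curve would be contracted, which is impossible at a noncritical point.
\<close>

lemma singular_backward:
  assumes "coprime P Q" "invariant P Q" "regular z0" "jac z0 \<noteq> 0"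
    and "ev P (G z0) = 0" "ev Q (G z0) = 0"
  shows "ev P z0 = 0" "ev Q z0 = 0"
proof -
  obtain N K where m: "cleared (\<lambda>z. ev P (G z) * Ss z + ev Q (G z) * Ts z) N (K * P)"
    "cleared (\<lambda>z. ev P (G z) * St z + ev Q (G z) * Tt z) N (K * Q)"
    using pulled_back_form_multiple[OF assms(1,2)] .
  have P: "jac z * ev P (G z) =
      (ev P (G z) * Ss z + ev Q (G z) * Ts z) * Tt z - (ev P (G z) * St z + ev Q (G z) * Tt z) * Ts z"
    and Q: "jac z * ev Q (G z) =
      (ev P (G z) * St z + ev Q (G z) * Tt z) * Ss z - (ev P (G z) * Ss z + ev Q (G z) * Ts z) * St z"
    for z by (simp_all add: jac_def algebra_simps)
  have "ev K z0 \<noteq> 0"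
  proof
    assume K0: "ev K z0 = 0"
    have "K \<noteq> 0"
    proof
      assume "K = 0"
      have PQ: "\<forall>\<^sub>F z in generic. ev P (G z) = 0 \<and> ev Q (G z) = 0"
        using generic_regular generic_jac
      proof eventually_elim
        case (elim z)
        have "ev P (G z) * Ss z + ev Q (G z) * Ts z = 0" "ev P (G z) * St z + ev Q (G z) * Tt z = 0"
          using cleared_eq_0[OF m(1) elim(1)] cleared_eq_0[OF m(2) elim(1)] \<open>K = 0\<close> by simp_all
        then have "jac z * ev P (G z) = 0" "jac z * ev Q (G z) = 0" unfolding P Q by simp_all
        then show ?case using elim(2) by simp
      qed
      have "ev P (G z) = 0" "ev Q (G z) = 0" if "regular z" for z
        by (rule rat_eq_0_if_generically_0[OF rat_ev_G _ that],
            rule eventually_mono[OF PQ], simp)+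
      then have "P = 0" "Q = 0"
        using image_not_in_curve by blast+
      with assms(1) show False by simp
    qed
    then obtain k where k: "prime k" "k dvd K" "ev k z0 = 0"
      using K0 prime_factor_through_point by blast
    note zero_on = k(1,3) assms(3)
    let ?Z = "zero_on k"
    have "k dvd K * P" "k dvd K * Q" using k(2) by simp_all
    then have Z1: "?Z (\<lambda>z. ev P (G z) * Ss z + ev Q (G z) * Ts z)"
      and Z2: "?Z (\<lambda>z. ev P (G z) * St z + ev Q (G z) * Tt z)"
      using m unfolding zero_on_def[OF zero_on] by blast+
    have "?Z (\<lambda>z. jac z * ev P (G z))" "?Z (\<lambda>z. jac z * ev Q (G z))"
      unfolding P Q
      using zero_on_diff[OF zero_on zero_on_mult[OF zero_on Z1 rat_partials(4)]
          zero_on_mult[OF zero_on Z2 rat_partials(3)]]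
        zero_on_diff[OF zero_on zero_on_mult[OF zero_on Z2 rat_partials(1)]
          zero_on_mult[OF zero_on Z1 rat_partials(2)]]
      by simp_all
    moreover have "\<not> ?Z jac" using zero_on_at[OF zero_on] assms(4) by blast
    ultimately have ZP: "?Z (\<lambda>z. ev P (G z))" and ZQ: "?Z (\<lambda>z. ev Q (G z))"
      using zero_on_prime[OF zero_on _ rat_jac rat_ev_G, of P]
        zero_on_prime[OF zero_on _ rat_jac rat_ev_G, of Q] by blast+
    obtain U V r where r: "r \<noteq> 0" "U * P + V * Q = [:r:]" using bezout_bipoly[OF assms(1)] .
    have "?Z (\<lambda>z. ev P (G z) * ev U (G z) + ev Q (G z) * ev V (G z))"
      by (rule zero_on_add[OF zero_on zero_on_mult[OF zero_on ZP rat_ev_G]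
            zero_on_mult[OF zero_on ZQ rat_ev_G]])
    moreover have "ev P (G z) * ev U (G z) + ev Q (G z) * ev V (G z) = poly r (S z)" for z
    proof -
      have "ev (U * P + V * Q) (G z) = ev [:r:] (G z)" unfolding r(2) ..
      then show ?thesis by (simp add: G_def mult.commute)
    qed
    ultimately have "?Z (\<lambda>z. poly r (S z))" by simp
    then obtain c where c: "?Z (\<lambda>z. S z - c)"
      by (rule constant_on[OF zero_on rat_S r(1)])
    have slice: "?Z (\<lambda>z. poly (slice_s c p) (T z))" if p: "?Z (\<lambda>z. ev p (G z))" for p
    proof -
      obtain p1 where p1: "\<And>z. ev p z = poly (slice_s c p) (snd z) + (fst z - c) * ev p1 z"
        using bipoly_restrict_s by blast
      have "?Z (\<lambda>z. ev p (G z) - (S z - c) * ev p1 (G z))"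
        by (rule zero_on_diff[OF zero_on p zero_on_mult[OF zero_on c rat_ev_G]])
      then show ?thesis
        by (rule zero_on_cong[OF zero_on]) (use p1 in \<open>simp add: G_def\<close>)
    qed
    obtain q where "q \<noteq> 0" "?Z (\<lambda>z. poly q (T z))"
      using coprime_slice_neq_0[OF assms(1), of c] slice[OF ZP] slice[OF ZQ] by blast
    then obtain c' where "?Z (\<lambda>z. T z - c')"
      by (rule constant_on[OF zero_on rat_T])
    then have "jac z0 = 0" by (rule jac_0_if_image_constant_on[OF zero_on c])
    with assms(4) show False by simp
  qed
  moreover have "ev (K * P) z0 = 0" "ev (K * Q) z0 = 0"
    using cleared_eq_0[OF m(1) assms(3)] cleared_eq_0[OF m(2) assms(3)] assms(5,6) by simp_all
  ultimately show "ev P z0 = 0" "ev Q z0 = 0" by auto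
qed

end

lemma tendsto_ev:
  assumes "(f \<longlongrightarrow> a) F" "(g \<longlongrightarrow> b) F"
  shows "((\<lambda>x. ev p (f x, g x)) \<longlongrightarrow> ev p (a, b)) F"
proof (induction p)
  case (pCons c p)
  show ?case
    by (simp, intro tendsto_intros pCons(2) assms isCont_tendsto_compose[OF poly_isCont])
qed simp

lemma quot_deriv_curve:
  assumes "(f has_field_derivative f') (at u)" "(g has_field_derivative g') (at u)"
    and "ev q (f u, g u) \<noteq> 0"
  shows "((\<lambda>u. ev p (f u, g u) / ev q (f u, g u)) has_field_derivative
    quot_deriv ds p q (f u, g u) * f' + quot_deriv dt p q (f u, g u) * g') (at u)"
  using DERIV_divide[OF ev_chain_rule[OF assms(1,2), of p] ev_chain_rule[OF assms(1,2), of q] assms(3)]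
  by (simp add: quot_deriv_def power2_eq_square add_divide_distrib[symmetric] algebra_simps)

text \<open>
  Blow-up computations. Along the path \<open>\<zeta>\<close>, the factors \<open>W\<close> and \<open>E\<close> vanish to first order at
  \<open>\<epsilon> = 0\<close>. So the quotient \<open>U W / (C E)\<close> has a limit, while its partial derivatives grow like
  \<open>1 / \<epsilon>\<close>.
\<close>

lemma quot_deriv_blow_up:
  assumes D: "\<And>p q. D (p * q) = D p * q + p * D q"
    and W: "\<And>\<epsilon>. ev W (\<zeta> \<epsilon>) = \<epsilon> * w \<epsilon>" and E: "\<And>\<epsilon>. ev E (\<zeta> \<epsilon>) = \<epsilon> * e \<epsilon>"
    and \<zeta>: "\<And>p. isCont (\<lambda>\<epsilon>. ev p (\<zeta> \<epsilon>)) 0" and w: "isCont w 0" and e: "isCont e 0"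
    and nz: "e 0 \<noteq> 0" "ev C (\<zeta> 0) \<noteq> 0"
  shows "((\<lambda>\<epsilon>. \<epsilon> * quot_deriv D (U * W) (C * E) (\<zeta> \<epsilon>)) \<longlongrightarrow>
    ev U (\<zeta> 0) * (ev (D W) (\<zeta> 0) * e 0 - w 0 * ev (D E) (\<zeta> 0)) / (ev C (\<zeta> 0) * (e 0)\<^sup>2)) (at 0)"
proof -
  define f where "f = (\<lambda>\<epsilon>. ((ev (D U) (\<zeta> \<epsilon>) * \<epsilon> * w \<epsilon> + ev U (\<zeta> \<epsilon>) * ev (D W) (\<zeta> \<epsilon>)) * (ev C (\<zeta> \<epsilon>) * e \<epsilon>)
    - ev U (\<zeta> \<epsilon>) * w \<epsilon> * (ev (D C) (\<zeta> \<epsilon>) * \<epsilon> * e \<epsilon> + ev C (\<zeta> \<epsilon>) * ev (D E) (\<zeta> \<epsilon>))) / (ev C (\<zeta> \<epsilon>) * e \<epsilon>)\<^sup>2)"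
  have eq: "\<epsilon> * quot_deriv D (U * W) (C * E) (\<zeta> \<epsilon>) = f \<epsilon>" if "\<epsilon> \<noteq> 0" for \<epsilon>
  proof -
    let ?n = "(ev (D U) (\<zeta> \<epsilon>) * \<epsilon> * w \<epsilon> + ev U (\<zeta> \<epsilon>) * ev (D W) (\<zeta> \<epsilon>)) * (ev C (\<zeta> \<epsilon>) * e \<epsilon>)
      - ev U (\<zeta> \<epsilon>) * w \<epsilon> * (ev (D C) (\<zeta> \<epsilon>) * \<epsilon> * e \<epsilon> + ev C (\<zeta> \<epsilon>) * ev (D E) (\<zeta> \<epsilon>))"
    have "\<epsilon> * quot_deriv D (U * W) (C * E) (\<zeta> \<epsilon>) = (\<epsilon>\<^sup>2 * ?n) / (\<epsilon>\<^sup>2 * (ev C (\<zeta> \<epsilon>) * e \<epsilon>)\<^sup>2)"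
      by (simp add: quot_deriv_def D W E algebra_simps power2_eq_square)
    then show ?thesis using that by (simp add: f_def)
  qed
  have "isCont f 0"
    unfolding f_def using nz by (intro continuous_intros \<zeta> w e) auto
  then have "(f \<longlongrightarrow> f 0) (at 0)" by (simp add: isCont_def)
  moreover have "\<forall>\<^sub>F \<epsilon> in at 0. f \<epsilon> = \<epsilon> * quot_deriv D (U * W) (C * E) (\<zeta> \<epsilon>)"
    using eq by (auto simp: eventually_at_filter)
  moreover have "f 0 = ev U (\<zeta> 0) * (ev (D W) (\<zeta> 0) * e 0 - w 0 * ev (D E) (\<zeta> 0)) / (ev C (\<zeta> 0) * (e 0)\<^sup>2)"
    using nz by (simp add: f_def power2_eq_square field_simps)
  ultimately show ?thesis using tendsto_cong by fastforce
qed

lemma quot_blow_up: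
  assumes W: "\<And>\<epsilon>. ev W (\<zeta> \<epsilon>) = \<epsilon> * w \<epsilon>" and E: "\<And>\<epsilon>. ev E (\<zeta> \<epsilon>) = \<epsilon> * e \<epsilon>"
    and \<zeta>: "\<And>p. isCont (\<lambda>\<epsilon>. ev p (\<zeta> \<epsilon>)) 0" and w: "isCont w 0" and e: "isCont e 0"
    and nz: "e 0 \<noteq> 0" "ev C (\<zeta> 0) \<noteq> 0"
  shows "((\<lambda>\<epsilon>. ev (U * W) (\<zeta> \<epsilon>) / ev (C * E) (\<zeta> \<epsilon>)) \<longlongrightarrow>
    ev U (\<zeta> 0) * w 0 / (ev C (\<zeta> 0) * e 0)) (at 0)"
proof -
  define f where "f = (\<lambda>\<epsilon>. ev U (\<zeta> \<epsilon>) * w \<epsilon> / (ev C (\<zeta> \<epsilon>) * e \<epsilon>))"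
  have "isCont f 0"
    unfolding f_def using nz by (intro continuous_intros \<zeta> w e) auto
  then have "(f \<longlongrightarrow> f 0) (at 0)" by (simp add: isCont_def)
  moreover have "\<forall>\<^sub>F \<epsilon> in at 0. f \<epsilon> = ev (U * W) (\<zeta> \<epsilon>) / ev (C * E) (\<zeta> \<epsilon>)"
    by (auto simp: eventually_at_filter W E f_def)
  ultimately show ?thesis using tendsto_cong by (fastforce simp: f_def)
qed

lemma cofinite_poly_neq_0:
  fixes q :: "complex poly"
  shows "q \<noteq> 0 \<Longrightarrow> \<forall>\<^sub>F t in cofinite. poly q t \<noteq> 0"
  by (simp add: eventually_cofinite poly_roots_finite)

lemma cofinite_neq: "\<forall>\<^sub>F t in cofinite. t \<noteq> (a :: complex)"
  by (simp add: eventually_cofinite)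

section \<open>The heat map in the blow-up chart\<close>

text \<open>
  The chart \<open>x = 1 + s\<close>, \<open>y = 1 + t s\<close> blows up the indeterminacy point \<open>(1, 1)\<close>: the line
  \<open>s = 0\<close> is the exceptional curve, and \<open>t = 1\<close> is the diagonal \<open>x = y\<close>. The polynomials \<open>fB\<close>,
  \<open>fC\<close>, \<open>fD\<close>, \<open>fF\<close> are the factors \<open>B\<close>, \<open>C\<close>, \<open>D\<close>, \<open>F\<close> of the heat map divided by \<open>s\<close>.
  The numerators of \<open>x' - 1\<close> and \<open>y' - 1\<close> have the common factor
  \<open>(x y - 1) (2 x y + x + y - 4)\<close>; here \<open>fW\<close> is its second factor divided by \<open>s\<close>, and
  \<open>x y - 1 = s (1 + t + s t)\<close>, a factor that is part of \<open>fU\<close>. What remains of these numerators is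
  \<open>fM = 3 + y - x y\<close> and \<open>fN = 3 + x - x y\<close>.
\<close>

definition fB :: bipoly where
  "fB = \<s> * \<s>^2 * \<t>^2 + 2 * \<s>^2 * \<t>^2 + 2 * \<s>^2 * \<t> + \<s> * \<t>^2 - 2 * \<s> * \<t> + \<s> - 4 * \<t> - 5"
definition fC :: bipoly where
  "fC = \<s>^2 * \<t>^2 + \<s> * \<t>^2 + 6 * \<s> * \<t> + 5 * \<t> + 6"
definition fD :: bipoly where
  "fD = \<s> * \<s>^2 * \<t>^2 + 2 * \<s>^2 * \<t>^2 + 2 * \<s>^2 * \<t> + \<s> * \<t>^2 - 2 * \<s> * \<t> + \<s> - 5 * \<t> - 4"
definition fF :: bipoly where
  "fF = \<s>^2 * \<t> + 6 * \<s> * \<t> + \<s> + 6 * \<t> + 5"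
definition fM :: bipoly where "fM = 3 - \<s> - \<s>^2 * \<t>"
definition fN :: bipoly where "fN = 3 - \<s> * \<t> - \<s>^2 * \<t>"
definition fW :: bipoly where "fW = 3 + 3 * \<t> + 2 * \<s> * \<t>"
definition fU :: bipoly where "fU = (1 + \<t> + \<s> * \<t>) * fM"

lemmas fac_defs = fB_def fC_def fD_def fF_def fM_def fN_def fW_def fU_def

lemmas pderiv_rules = pderiv_add pderiv_diff pderiv_mult pderiv_numeral pderiv_1

definition Snum :: bipoly where "Snum = fU * fW"
definition Sden :: bipoly where "Sden = fC * fD"
definition Tnum :: bipoly where "Tnum = (fN * fC) * fD"
definition Tden :: bipoly where "Tden = (fM * fF) * fB"

lemmas map_defs = Snum_def Sden_def Tnum_def Tden_def

text \<open>
  The heat map in the chart: \<open>S = x' - 1\<close> and \<open>T = (y' - 1) / (x' - 1)\<close>, after cancellation of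
  the common factors.
\<close>

interpretation heat: plane_map Snum Sden Tnum Tden .

text \<open>
  On the diagonal the heat map is \<open>x \<mapsto> (x\<^sup>2 + 3 x + 3) / (x\<^sup>2 + 5 x + 5)\<close>. The chart moves the
  diagonal to \<open>t = 1\<close>, so the Jacobian is the product of the derivative of this function and of
  the transversal derivative of \<open>T\<close>. The map is left undefined only where one of the stated
  denominators vanishes; \<open>x = 1\<close> is no longer one of these points.
\<close>

lemma heat_on_diagonal:
  fixes x :: complex
  defines "c \<equiv> x^2 + 5 * x + 5" and "e \<equiv> x^2 - x - 3"
  assumes nz: "c \<noteq> 0" "e \<noteq> 0" "x + 2 \<noteq> 0"
  shows "heat.regular (x - 1, 1)"
    and "heat.G (x - 1, 1) = ((x^2 + 3 * x + 3) / c - 1, 1)"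
    and "heat.jac (x - 1, 1) =
      2 * x * (x + 2) / c^2 * ((x^5 + 2 * x^4 - x^3 - x^2 - 3) / ((x + 2) * e * c))"
proof -
  have v: "ev fC (x - 1, 1) = c" "ev fD (x - 1, 1) = (x + 2) * e" "ev fB (x - 1, 1) = (x + 2) * e"
    "ev fF (x - 1, 1) = c" "ev fM (x - 1, 1) = - e" "ev fN (x - 1, 1) = - e"
    "ev fW (x - 1, 1) = 2 * (x + 2)" "ev fU (x - 1, 1) = - (x + 1) * e"
    unfolding fac_defs c_def e_def by simp_all algebra+
  show reg: "heat.regular (x - 1, 1)"
    unfolding heat.regular_def using nz by (simp add: v map_defs)
  have "heat.T (x - 1, 1) = 1"
    unfolding heat.T_def using nz by (simp add: v map_defs)
  moreover have "heat.S (x - 1, 1) = - (2 * (x + 1)) / c"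
  proof -
    have "heat.S (x - 1, 1) = - (2 * (x + 1)) * ((x + 2) * e) / (c * ((x + 2) * e))"
      unfolding heat.S_def unfolding map_defs ev_simps v by (simp add: algebra_simps)
    then show ?thesis using nz by simp
  qed
  moreover have "(x^2 + 3 * x + 3) / c - 1 = - (2 * (x + 1)) / c"
    using nz(1) by (simp add: field_simps) (simp add: c_def)
  ultimately show "heat.G (x - 1, 1) = ((x^2 + 3 * x + 3) / c - 1, 1)"
    by (simp add: heat.G_def)
  have ds: "ev (ds fB) (x - 1, 1) = 3 * x^2 + 2 * x - 5" "ev (ds fC) (x - 1, 1) = 2 * x + 5"
    "ev (ds fD) (x - 1, 1) = 3 * x^2 + 2 * x - 5" "ev (ds fF) (x - 1, 1) = 2 * x + 5"
    "ev (ds fM) (x - 1, 1) = 1 - 2 * x" "ev (ds fN) (x - 1, 1) = 1 - 2 * x"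
    "ev (ds fW) (x - 1, 1) = 2" "ev (ds fU) (x - 1, 1) = 4 - 3 * x^2"
    unfolding fac_defs by simp_all algebra+
  have dt: "ev (dt fB) (x - 1, 1) = 2 * x^3 - 6 * x" "ev (dt fC) (x - 1, 1) = 2 * x^2 + 4 * x - 1"
    "ev (dt fD) (x - 1, 1) = 2 * x^3 - 6 * x - 1" "ev (dt fF) (x - 1, 1) = x^2 + 4 * x + 1"
    "ev (dt fM) (x - 1, 1) = 2 * x - 1 - x^2" "ev (dt fN) (x - 1, 1) = x - x^2"
    unfolding fac_defs by (simp_all add: pderiv_rules) algebra+
  have "heat.Ss (x - 1, 1) = 2 * x * (x + 2) * ((x + 2) * e)^2 / (c * ((x + 2) * e))^2"
    unfolding heat.Ss_def quot_deriv_def unfolding map_defs ds_mult ev_simps v ds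
    by (rule arg_cong2[of _ _ _ _ "(/)"]) (unfold c_def e_def, algebra, rule refl)
  then have Ss: "heat.Ss (x - 1, 1) = 2 * x * (x + 2) / c^2"
    using nz by (simp add: power_mult_distrib)
  have Ts: "heat.Ts (x - 1, 1) = 0"
    unfolding heat.Ts_def quot_deriv_def unfolding map_defs by (simp add: v ds)
  have "heat.Tt (x - 1, 1) =
      (x^5 + 2 * x^4 - x^3 - x^2 - 3) * ((x + 2) * e^3 * c) / (e * c * ((x + 2) * e))^2"
    unfolding heat.Tt_def quot_deriv_def unfolding map_defs pderiv_mult ev_simps v dt
    by (rule arg_cong2[of _ _ _ _ "(/)"]) (unfold c_def e_def, algebra+)
  also have "\<dots> = (x^5 + 2 * x^4 - x^3 - x^2 - 3) / ((x + 2) * e * c)"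
  proof -
    have "(e * c * ((x + 2) * e))^2 = ((x + 2) * e * c) * ((x + 2) * e^3 * c)" by algebra
    moreover have "(x + 2) * e^3 * c \<noteq> 0" using nz by simp
    ultimately show ?thesis using mult_divide_mult_cancel_right by metis
  qed
  finally show "heat.jac (x - 1, 1) =
      2 * x * (x + 2) / c^2 * ((x^5 + 2 * x^4 - x^3 - x^2 - 3) / ((x + 2) * e * c))"
    by (simp add: heat.jac_def Ss Ts)
qed

lemma heat_on_real_diagonal:
  fixes x :: real
  assumes "x^2 + 5 * x + 5 \<noteq> 0" "x^2 - x - 3 \<noteq> 0" "x + 2 \<noteq> 0" "x \<noteq> 0"
    and "x^5 + 2 * x^4 - x^3 - x^2 - 3 \<noteq> 0"
  defines "z \<equiv> (complex_of_real x - 1, 1)"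
  shows "heat.regular z" "heat.jac z \<noteq> 0"
    "heat.G z = (complex_of_real ((x^2 + 3 * x + 3) / (x^2 + 5 * x + 5)) - 1, 1)"
proof -
  define X where "X = complex_of_real x"
  have "complex_of_real (x^2 + 5 * x + 5) \<noteq> 0" "complex_of_real (x^2 - x - 3) \<noteq> 0"
    "complex_of_real (x + 2) \<noteq> 0" "complex_of_real (x^5 + 2 * x^4 - x^3 - x^2 - 3) \<noteq> 0"
    using assms(1,2,3,5) by (simp_all only: of_real_eq_0_iff not_False_eq_True)
  then have X: "X^2 + 5 * X + 5 \<noteq> 0" "X^2 - X - 3 \<noteq> 0" "X + 2 \<noteq> 0"
    "X^5 + 2 * X^4 - X^3 - X^2 - 3 \<noteq> 0" by (simp_all add: X_def)
  have "X \<noteq> 0" using assms(4) by (simp add: X_def)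
  note H = heat_on_diagonal[OF X(1-3)]
  show "heat.regular z" using H(1) by (simp add: z_def X_def)
  show "heat.jac z \<noteq> 0" using H(3) X \<open>X \<noteq> 0\<close> by (simp add: z_def X_def)
  show "heat.G z = (complex_of_real ((x^2 + 3 * x + 3) / (x^2 + 5 * x + 5)) - 1, 1)"
    using H(2) by (simp add: z_def X_def)
qed

interpretation heat: dominant_plane_map Snum Sden Tnum Tden
proof
  have "heat.regular (0, 1)" "heat.jac (0, 1) \<noteq> 0"
    using heat_on_real_diagonal[of 1] by simp_all
  then show "\<exists>z. heat.regular z \<and> heat.jac z \<noteq> 0" by blast
qed

subsection \<open>Singular points on the diagonal\<close>

text \<open>
  Now let \<open>P ds + Q dt\<close> define a foliation that is invariant under the heat map.
\<close>

context
  fixes P Q :: bipoly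
  assumes coprime: "coprime P Q" and invariant: "heat.invariant P Q"
begin

definition singular :: "complex \<times> complex \<Rightarrow> bool" where
  "singular z \<longleftrightarrow> ev P z = 0 \<and> ev Q z = 0"

lemma finite_singular_diagonal: "finite {x :: real. singular (complex_of_real x - 1, 1)}"
proof (rule inj_on_finite[OF _ _ coprime_common_zeros_finite[OF coprime]])
  show "inj_on (\<lambda>x. complex_of_real x - 1) {x. singular (complex_of_real x - 1, 1)}"
    by (auto simp: inj_on_def)
  show "(\<lambda>x. complex_of_real x - 1) ` {x. singular (complex_of_real x - 1, 1)}
      \<subseteq> {s. \<exists>t. ev P (s, t) = 0 \<and> ev Q (s, t) = 0}"
    by (auto simp: singular_def)
qed

text \<open>
  The point \<open>s = 0\<close>, \<open>t = 1\<close> where the diagonal meets the exceptional curve has an infinite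
  forward orbit: on the diagonal it is \<open>x = 1\<close>, and the iterates decrease to the fixed point
  \<open>(\<surd>5 - 1) / 2\<close>. If it were singular, all of these would be. Rather than iterating, the proof looks at the
  smallest singular point in an interval that the map sends into itself.
\<close>

lemma nonsingular_exceptional_point: "\<not> singular (0, 1)"
proof
  assume "singular (0, 1)"
  define h where "h = (\<lambda>x :: real. (x^2 + 3 * x + 3) / (x^2 + 5 * x + 5))"
  define I where "I = {x :: real. 0 < x \<and> x \<le> 1 \<and> x^2 + x - 1 > 0}"
  define Z where "Z = {x \<in> I. singular (complex_of_real x - 1, 1)}"
  have step: "h x \<in> Z \<and> h x < x" if "x \<in> Z" for x
  proof -
    have x: "0 < x" "x \<le> 1" "x^2 + x - 1 > 0" "singular (complex_of_real x - 1, 1)"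
      using that by (auto simp: Z_def I_def)
    have x2: "0 < x^2" "x^2 \<le> x" using x by (auto simp: power2_eq_square mult_left_le)
    have c: "x^2 + 5 * x + 5 > 0" using x x2 by auto
    have "x^5 \<le> x^3" "x^4 \<le> x^2"
      using x by (auto intro: power_decreasing)
    moreover have "x^2 \<le> 1" using x2 x by linarith
    ultimately have N: "x^5 + 2 * x^4 - x^3 - x^2 - 3 \<noteq> 0" by linarith
    have "x^2 + 5 * x + 5 \<noteq> 0" "x^2 - x - 3 \<noteq> 0" "x + 2 \<noteq> 0" "x \<noteq> 0"
      using c x x2 by auto
    note H = heat_on_real_diagonal[OF this N]
    have "singular (complex_of_real (h x) - 1, 1)"
      using heat.singular_forward[OF coprime invariant H(1,2)] x(4)
      unfolding singular_def H(3) h_def by blast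
    moreover have "h x < x"
    proof -
      have "0 < (x + 3) * (x^2 + x - 1)" using x by simp
      then have "x^2 + 3 * x + 3 < x * (x^2 + 5 * x + 5)"
        by (simp add: algebra_simps power2_eq_square)
      then show ?thesis using c by (simp add: h_def divide_simps)
    qed
    moreover have "h x > 0" using x c by (simp add: h_def add_pos_pos)
    moreover have "(h x)^2 + h x - 1 > 0"
    proof -
      have "(n / d)^2 + n / d - 1 = (n^2 + n * d - d^2) / d^2" if "d \<noteq> 0" for n d :: real
        using that by (simp add: field_simps power2_eq_square)
      then have "(h x)^2 + h x - 1 =
          ((x^2 + 3 * x + 3)^2 + (x^2 + 3 * x + 3) * (x^2 + 5 * x + 5) - (x^2 + 5 * x + 5)^2)
            / (x^2 + 5 * x + 5)^2"
        using c unfolding h_def by simp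
      \<comment> \<open>the zeros of \<open>x\<^sup>2 + x - 1\<close> are the fixed points other than \<open>-3\<close>\<close>
      also have "(x^2 + 3 * x + 3)^2 + (x^2 + 3 * x + 3) * (x^2 + 5 * x + 5) - (x^2 + 5 * x + 5)^2
          = (x^2 + x - 1) * (x^2 + 3 * x + 1)" by algebra
      finally show ?thesis using x c x2 by (simp add: add_pos_pos)
    qed
    ultimately show ?thesis using x by (auto simp: Z_def I_def)
  qed
  have "finite Z" using finite_singular_diagonal by (rule finite_subset[rotated]) (auto simp: Z_def)
  moreover have "1 \<in> Z" using \<open>singular (0, 1)\<close> by (simp add: Z_def I_def)
  ultimately have "Min Z \<in> Z" by (intro Min_in) auto
  from step[OF this] show False using \<open>finite Z\<close> by (meson Min_le not_le)
qed

text \<open>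
  The point \<open>x = y = -2\<close> is an indeterminacy point, so nothing can be said about its image. But
  it has an infinite backward orbit that decreases to the repelling fixed point \<open>-3\<close>, and the
  heat map is a local isomorphism along it.
\<close>

lemma nonsingular_indeterminacy_point: "\<not> singular (-3, 1)"
proof
  assume "singular (-3, 1)"
  define h where "h = (\<lambda>x :: real. (x^2 + 3 * x + 3) / (x^2 + 5 * x + 5))"
  define Z where "Z = {x :: real. -3 < x \<and> x \<le> -2 \<and> singular (complex_of_real x - 1, 1)}"
  have step: "\<exists>x\<in>Z. x < y" if "y \<in> Z" for y
  proof -
    have y: "-3 < y" "y \<le> -2" "singular (complex_of_real y - 1, 1)"
      using that by (auto simp: Z_def)
    have neg: "x^2 + 5 * x + 5 < 0" if "-3 \<le> x" "x \<le> -2" for x :: real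
    proof -
      have "(x + 3) * (x + 2) \<le> 0" using that by (simp add: mult_nonneg_nonpos)
      then show ?thesis by (simp add: algebra_simps power2_eq_square)
    qed
    have "continuous_on {-3..-2} h"
      unfolding h_def using neg by (intro continuous_intros) force
    moreover have "h (-3) \<le> y" "y \<le> h (-2)" using y by (simp_all add: h_def)
    ultimately obtain x where x: "-3 \<le> x" "x \<le> -2" "h x = y"
      using IVT'[of h "-3" y "-2"] by auto
    have "x \<noteq> -3" "x \<noteq> -2" using x(3) y by (auto simp: h_def)
    then have x': "-3 < x" "x < -2" using x by auto
    have c: "x^2 + 5 * x + 5 < 0" using neg x by simp
    have yc: "x^2 + 3 * x + 3 = y * (x^2 + 5 * x + 5)"
      using x(3) c by (simp add: h_def field_simps)
    have "x < y"
    proof -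
      have "(x + 1) * (x + 2) > 0" using x' by (simp add: mult_neg_neg)
      then have "x^2 + x - 1 > 0" using x' by (simp add: algebra_simps power2_eq_square)
      then have "0 < (x + 3) * (x^2 + x - 1)" using x' by simp
      then have "(y - x) * (x^2 + 5 * x + 5) < 0"
        using yc by (simp add: algebra_simps power2_eq_square)
      then show ?thesis using c by (auto simp: mult_less_0_iff)
    qed
    \<comment> \<open>this keeps \<open>x\<close> away from the zero of the transversal derivative near \<open>-2.1\<close>\<close>
    have "x \<le> -11/4"
    proof (rule ccontr)
      assume "\<not> x \<le> -11/4"
      then have "(4 * x + 11) * (x + 2) < 0" using x' by (simp add: mult_pos_neg)
      then have "4 * x^2 + 19 * x + 22 < 0" by (simp add: algebra_simps power2_eq_square)
      then have "3 * x^2 + 13 * x + 13 < 0"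
        using \<open>\<not> x \<le> -11/4\<close> by linarith
      moreover have "y * (x^2 + 5 * x + 5) \<ge> -2 * (x^2 + 5 * x + 5)"
        using y c by (intro mult_right_mono_neg) auto
      ultimately show False using yc by simp
    qed
    have N: "x^5 + 2 * x^4 - x^3 - x^2 - 3 < 0"
    proof -
      have "(4 * x + 11) * x^4 \<le> 0" using \<open>x \<le> -11/4\<close> by (simp add: mult_nonpos_nonneg)
      moreover have "(4 * x + 11) * x^4 = 4 * x^5 + 11 * x^4" by algebra
      moreover have "(11/4)^2 \<le> x^2" using \<open>x \<le> -11/4\<close> by (subst abs_le_square_iff[symmetric]) auto
      then have "(11/4)^2 * x^2 \<le> x^2 * x^2" by (rule mult_right_mono) simp
      then have "121/16 * x^2 \<le> x^4" by (simp add: power2_eq_square power4_eq_xxxx mult.assoc)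
      moreover have "0 \<le> (x + 3) * x^2" using x' by simp
      moreover have "(x + 3) * x^2 = x^3 + 3 * x^2" by algebra
      moreover have "0 \<le> x^2" by simp
      ultimately show ?thesis by linarith
    qed
    have e: "x^2 - x - 3 \<noteq> 0"
    proof -
      have "x * x > 4" using x' mult_strict_mono'[of 2 "-x" 2 "-x"] by simp
      then show ?thesis using x' by (simp add: power2_eq_square)
    qed
    have "x^2 + 5 * x + 5 \<noteq> 0" "x + 2 \<noteq> 0" "x \<noteq> 0" "x^5 + 2 * x^4 - x^3 - x^2 - 3 \<noteq> 0"
      using c x' N by auto
    note H = heat_on_real_diagonal[OF this(1) e this(2-)]
    have "heat.G (complex_of_real x - 1, 1) = (complex_of_real y - 1, 1)"
      unfolding H(3) using x(3) by (simp only: h_def)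
    then have "singular (complex_of_real x - 1, 1)"
      using heat.singular_backward[OF coprime invariant H(1,2)] y(3) by (simp add: singular_def)
    with x' \<open>x < y\<close> show ?thesis by (auto simp: Z_def)
  qed
  have "finite Z" using finite_singular_diagonal by (rule finite_subset[rotated]) (auto simp: Z_def)
  moreover have "-2 \<in> Z" using \<open>singular (-3, 1)\<close> by (simp add: Z_def)
  ultimately have "Min Z \<in> Z" by (intro Min_in) auto
  from step[OF this] show False using \<open>finite Z\<close> by (meson Min_le not_le)
qed

text \<open>
  Blow up \<open>x = y = -2\<close> by \<open>s = -3 + \<epsilon>\<close>, \<open>t = 1 + \<epsilon> v\<close>. As \<open>\<epsilon> \<rightarrow> 0\<close>, the heat map tends to a
  parametrisation \<open>z\<close> of the curve \<open>x y = 1\<close> by \<open>v\<close>, and its differential stretches directions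
  transversal to the radial one by \<open>1 / \<epsilon>\<close>. A leaf through \<open>-2\<close> in a direction other than the
  radial one \<open>v\<close> is therefore mapped to a leaf tangent to \<open>x y = 1\<close> at \<open>z\<close>. The conclusion says
  this: either \<open>v\<close> is the direction of the leaf, or the form vanishes on the tangent vector of
  \<open>x y = 1\<close>.
\<close>

lemma blow_up_at_minus_2:
  fixes v :: complex
  assumes "3 - 5 * v \<noteq> 0" "3 - 4 * v \<noteq> 0"
  defines "z \<equiv> (- 3 * (2 - 3 * v) / (3 - 5 * v), (3 - 5 * v) / (3 - 4 * v))"
  shows "(ev P (-3, 1) + v * ev Q (-3, 1)) *
    (ev P z * (3 - 4 * v)\<^sup>2 + ev Q z * (3 - 5 * v)\<^sup>2) = 0"
proof -
  define \<zeta> where "\<zeta> = (\<lambda>\<epsilon> :: complex. (-3 + \<epsilon>, 1 + \<epsilon> * v))"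
  have \<zeta>_cont: "isCont (\<lambda>\<epsilon>. ev p (\<zeta> \<epsilon>)) 0" for p
    unfolding \<zeta>_def
    by (rule DERIV_isCont, rule ev_chain_rule) (auto intro!: derivative_eq_intros)
  have \<zeta>0: "\<zeta> 0 = (-3, 1)" by (simp add: \<zeta>_def)
  define r where "r = (\<lambda>\<epsilon> :: complex. \<epsilon>^4 * v^2 - 7 * \<epsilon>^3 * v^2 + 2 * \<epsilon>^3 * v + 16 * \<epsilon>^2 * v^2
    - 12 * \<epsilon>^2 * v + \<epsilon>^2 - 12 * \<epsilon> * v^2 + 18 * \<epsilon> * v - 5 * \<epsilon> + 3)"
  have r0: "r 0 = 3" by (simp add: r_def)
  have rc: "isCont r 0" unfolding r_def by (intro continuous_intros)
  have B: "ev fB (\<zeta> \<epsilon>) = \<epsilon> * (r \<epsilon> - 4 * v)" for \<epsilon>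
    unfolding fB_def \<zeta>_def r_def by simp algebra
  have D: "ev fD (\<zeta> \<epsilon>) = \<epsilon> * (r \<epsilon> - 5 * v)" for \<epsilon>
    unfolding fD_def \<zeta>_def r_def by simp algebra
  have W: "ev fW (\<zeta> \<epsilon>) = \<epsilon> * (2 * \<epsilon> * v - 3 * v + 2)" for \<epsilon>
    unfolding fW_def \<zeta>_def by simp algebra
  have cont: "isCont (\<lambda>\<epsilon>. r \<epsilon> - 4 * v) 0" "isCont (\<lambda>\<epsilon>. r \<epsilon> - 5 * v) 0"
    "isCont (\<lambda>\<epsilon>. 2 * \<epsilon> * v - 3 * v + 2) 0"
    by (intro continuous_intros rc)+
  have val: "ev fU (-3, 1) = 3" "ev fC (-3, 1) = -1" "ev fN (-3, 1) = -3" "ev fM (-3, 1) = -3"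
    "ev fF (-3, 1) = -1"
    unfolding fac_defs by simp_all
  have ds: "ev (ds fW) (-3, 1) = 2" "ev (ds fD) (-3, 1) = 3" "ev (ds fB) (-3, 1) = 3"
    unfolding fac_defs by simp_all
  have dt: "ev (dt fW) (-3, 1) = -3" "ev (dt fD) (-3, 1) = -5" "ev (dt fB) (-3, 1) = -4"
    unfolding fac_defs by (simp_all add: pderiv_rules)
  have dt_mult: "dt (p * q) = dt p * q + p * dt q" for p q :: bipoly
    by (simp add: pderiv_mult algebra_simps)
  let ?a = "-3 / (3 - 5 * v)\<^sup>2" and ?b = "-3 / (3 - 4 * v)\<^sup>2"
  \<comment> \<open>the limits of \<open>\<epsilon>\<close> times the partial derivatives\<close>
  have lim_St: "((\<lambda>\<epsilon>. \<epsilon> * heat.St (\<zeta> \<epsilon>)) \<longlongrightarrow> ?a) (at 0)"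
    using quot_deriv_blow_up[where \<zeta> = \<zeta> and D = dt and U = fU and C = fC, OF dt_mult W D \<zeta>_cont cont(3,2)]
      assms(1) unfolding heat.St_def unfolding Snum_def Sden_def \<zeta>0 val dt r0
    by (simp add: algebra_simps)
  have lim_Ss: "((\<lambda>\<epsilon>. \<epsilon> * heat.Ss (\<zeta> \<epsilon>)) \<longlongrightarrow> - v * ?a) (at 0)"
    using quot_deriv_blow_up[where \<zeta> = \<zeta> and D = ds and U = fU and C = fC, OF ds_mult W D \<zeta>_cont cont(3,2)]
      assms(1) unfolding heat.Ss_def unfolding Snum_def Sden_def \<zeta>0 val ds r0
    by (simp add: algebra_simps)
  have lim_Tt: "((\<lambda>\<epsilon>. \<epsilon> * heat.Tt (\<zeta> \<epsilon>)) \<longlongrightarrow> ?b) (at 0)"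
    using quot_deriv_blow_up[where \<zeta> = \<zeta> and D = dt and U = "fN * fC" and C = "fM * fF",
        OF dt_mult D B \<zeta>_cont cont(2,1)]
      assms(2) unfolding heat.Tt_def unfolding Tnum_def Tden_def \<zeta>0 ev_simps(7) val dt r0
    by (simp add: algebra_simps)
  have lim_Ts: "((\<lambda>\<epsilon>. \<epsilon> * heat.Ts (\<zeta> \<epsilon>)) \<longlongrightarrow> - v * ?b) (at 0)"
    using quot_deriv_blow_up[where \<zeta> = \<zeta> and D = ds and U = "fN * fC" and C = "fM * fF",
        OF ds_mult D B \<zeta>_cont cont(2,1)]
      assms(2) unfolding heat.Ts_def unfolding Tnum_def Tden_def \<zeta>0 ev_simps(7) val ds r0
    by (simp add: algebra_simps)
  have "((\<lambda>\<epsilon>. heat.S (\<zeta> \<epsilon>)) \<longlongrightarrow> 3 * (2 - 3 * v) / - (3 - 5 * v)) (at 0)"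
    using quot_blow_up[where \<zeta> = \<zeta> and U = fU and C = fC, OF W D \<zeta>_cont cont(3,2)]
      assms(1) unfolding heat.S_def unfolding Snum_def Sden_def \<zeta>0 val r0
    by (simp add: algebra_simps)
  then have lim_S: "((\<lambda>\<epsilon>. heat.S (\<zeta> \<epsilon>)) \<longlongrightarrow> fst z) (at 0)"
    by (simp add: z_def del: minus_diff_eq)
  have "((\<lambda>\<epsilon>. heat.T (\<zeta> \<epsilon>)) \<longlongrightarrow> 3 * (3 - 5 * v) / (3 * (3 - 4 * v))) (at 0)"
    using quot_blow_up[where \<zeta> = \<zeta> and U = "fN * fC" and C = "fM * fF", OF D B \<zeta>_cont cont(2,1)]
      assms(2) unfolding heat.T_def unfolding Tnum_def Tden_def \<zeta>0 ev_simps(7) val r0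
    by (simp add: algebra_simps)
  then have lim_T: "((\<lambda>\<epsilon>. heat.T (\<zeta> \<epsilon>)) \<longlongrightarrow> snd z) (at 0)"
    unfolding z_def snd_conv by (subst (asm) mult_divide_mult_cancel_left) simp_all
  have lim_G: "((\<lambda>\<epsilon>. ev p (heat.G (\<zeta> \<epsilon>))) \<longlongrightarrow> ev p z) (at 0)" for p
    using tendsto_ev[OF lim_S lim_T, of p] by (simp add: heat.G_def)
  have lim: "((\<lambda>\<epsilon>. ev p (\<zeta> \<epsilon>)) \<longlongrightarrow> ev p (-3, 1)) (at 0)" for p
    using \<zeta>_cont[of p] by (simp add: isCont_def \<zeta>0)
  have "\<forall>\<^sub>F \<epsilon> in at 0. heat.regular (\<zeta> \<epsilon>)"
  proof -
    have "\<forall>\<^sub>F \<epsilon> in at 0. r \<epsilon> - 4 * v \<noteq> 0" "\<forall>\<^sub>F \<epsilon> in at 0. r \<epsilon> - 5 * v \<noteq> 0"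
      by (rule tendsto_imp_eventually_ne[OF cont(1)[unfolded isCont_def r0] assms(2)]
          tendsto_imp_eventually_ne[OF cont(2)[unfolded isCont_def r0] assms(1)])+
    moreover have "\<forall>\<^sub>F \<epsilon> in at 0. ev (fC * (fM * fF)) (\<zeta> \<epsilon>) \<noteq> 0"
      by (rule tendsto_imp_eventually_ne[OF lim]) (simp add: val)
    moreover have "\<forall>\<^sub>F \<epsilon> in at (0 :: complex). \<epsilon> \<noteq> 0" by (simp add: eventually_at_filter)
    ultimately show ?thesis
    proof eventually_elim
      case (elim \<epsilon>)
      then show ?case unfolding heat.regular_def by (simp add: Sden_def Tden_def B D)
    qed
  qed
  then have "\<forall>\<^sub>F \<epsilon> in at 0.
      ev P (\<zeta> \<epsilon>) * (ev P (heat.G (\<zeta> \<epsilon>)) * (\<epsilon> * heat.St (\<zeta> \<epsilon>)) + ev Q (heat.G (\<zeta> \<epsilon>)) * (\<epsilon> * heat.Tt (\<zeta> \<epsilon>)))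
    = ev Q (\<zeta> \<epsilon>) * (ev P (heat.G (\<zeta> \<epsilon>)) * (\<epsilon> * heat.Ss (\<zeta> \<epsilon>)) + ev Q (heat.G (\<zeta> \<epsilon>)) * (\<epsilon> * heat.Ts (\<zeta> \<epsilon>)))"
  proof eventually_elim
    case (elim \<epsilon>)
    have "\<epsilon> * (ev P (\<zeta> \<epsilon>) * (ev P (heat.G (\<zeta> \<epsilon>)) * heat.St (\<zeta> \<epsilon>) + ev Q (heat.G (\<zeta> \<epsilon>)) * heat.Tt (\<zeta> \<epsilon>)))
      = \<epsilon> * (ev Q (\<zeta> \<epsilon>) * (ev P (heat.G (\<zeta> \<epsilon>)) * heat.Ss (\<zeta> \<epsilon>) + ev Q (heat.G (\<zeta> \<epsilon>)) * heat.Ts (\<zeta> \<epsilon>)))"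
      using invariant elim unfolding heat.invariant_def by metis
    then show ?case by (simp add: algebra_simps)
  qed
  then have "((\<lambda>\<epsilon>. ev P (\<zeta> \<epsilon>) * (ev P (heat.G (\<zeta> \<epsilon>)) * (\<epsilon> * heat.St (\<zeta> \<epsilon>)) + ev Q (heat.G (\<zeta> \<epsilon>)) * (\<epsilon> * heat.Tt (\<zeta> \<epsilon>))))
     \<longlongrightarrow> ev Q (-3, 1) * (ev P z * (- v * ?a) + ev Q z * (- v * ?b))) (at 0)"
    by (subst tendsto_cong, assumption) (intro tendsto_intros lim lim_G lim_Ss lim_Ts)
  moreover have "((\<lambda>\<epsilon>. ev P (\<zeta> \<epsilon>) * (ev P (heat.G (\<zeta> \<epsilon>)) * (\<epsilon> * heat.St (\<zeta> \<epsilon>)) + ev Q (heat.G (\<zeta> \<epsilon>)) * (\<epsilon> * heat.Tt (\<zeta> \<epsilon>))))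
     \<longlongrightarrow> ev P (-3, 1) * (ev P z * ?a + ev Q z * ?b)) (at 0)"
    by (intro tendsto_intros lim lim_G lim_St lim_Tt)
  ultimately have "ev Q (-3, 1) * (ev P z * (- v * ?a) + ev Q z * (- v * ?b)) =
      ev P (-3, 1) * (ev P z * ?a + ev Q z * ?b)"
    using tendsto_unique[OF at_neq_bot] by blast
  moreover have "(p + v * q) * (x * a + y * b) = 0"
    if "q * (x * (- v * a) + y * (- v * b)) = p * (x * a + y * b)" for p q x y a b :: complex
    using that by algebra
  ultimately have "(ev P (-3, 1) + v * ev Q (-3, 1)) * (ev P z * ?a + ev Q z * ?b) = 0"
    by blast
  moreover have "(ev P z * ?a + ev Q z * ?b) * ((3 - 5 * v)\<^sup>2 * (3 - 4 * v)\<^sup>2) =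
      -3 * (ev P z * (3 - 4 * v)\<^sup>2 + ev Q z * (3 - 5 * v)\<^sup>2)"
    using assms(1,2) by (simp add: field_simps)
  moreover have "A * Z = 0" if "A * Y = 0" "Y * K = -3 * Z" for A Y K Z :: complex
    using that by (metis mult.assoc mult_eq_0_iff neg_equal_0_iff_equal zero_neq_numeral)
  ultimately show ?thesis by blast
qed

text \<open>
  Since \<open>-2\<close> is not singular, \<open>x y = 1\<close> is a leaf. In the chart it is the curve
  \<open>s = - (1 + t) / t\<close>, with tangent vector \<open>(1 / t\<^sup>2, 1)\<close>.
\<close>

lemma leaf_xy_eq_1:
  "\<forall>\<^sub>F t in cofinite. ev P (- (1 + t) / t, t) + t\<^sup>2 * ev Q (- (1 + t) / t, t) = 0"
proof -
  define p q where "p = ev P (-3, 1)" and "q = ev Q (-3, 1)"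
  have "[:5 * p + 3 * q, - (4 * p + 3 * q):] \<noteq> 0"
  proof
    assume "[:5 * p + 3 * q, - (4 * p + 3 * q):] = 0"
    then have "5 * p + 3 * q = 0" "4 * p + 3 * q = 0"
      by (simp_all add: neg_eq_iff_add_eq_0)
    then have "p = 0" "q = 0" by algebra+
    then show False using nonsingular_indeterminacy_point by (simp add: singular_def p_def q_def)
  qed
  from cofinite_poly_neq_0[OF this] cofinite_neq[of 0] cofinite_poly_neq_0[of "[:5, -4:]", simplified]
  show ?thesis
  proof eventually_elim
    case (elim t)
    \<comment> \<open>the parameter of the point with coordinate \<open>t\<close> on \<open>x y = 1\<close>\<close>
    define v where "v = 3 * (1 - t) / (5 - 4 * t)"
    have t: "5 - 4 * t \<noteq> 0" using elim(3) by (simp add: mult.commute)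
    have v: "3 - 5 * v = 3 * t / (5 - 4 * t)" "3 - 4 * v = 3 / (5 - 4 * t)"
      "2 - 3 * v = (1 + t) / (5 - 4 * t)"
      using t by (simp_all add: v_def field_simps)
    have "3 - 5 * v \<noteq> 0" "3 - 4 * v \<noteq> 0" using t elim(2) by (simp_all add: v)
    note R = blow_up_at_minus_2[OF this, unfolded v, folded p_def q_def]
    have "(p + v * q) * (5 - 4 * t) = poly [:5 * p + 3 * q, - (4 * p + 3 * q):] t"
      using t by (simp add: v_def field_simps)
    then have "p + v * q \<noteq> 0" using elim(1) by auto
    moreover have "- 3 * ((1 + t) / (5 - 4 * t)) / (3 * t / (5 - 4 * t)) = - (1 + t) / t"
      "3 * t / (5 - 4 * t) / (3 / (5 - 4 * t)) = t"
      using t elim(2) by (simp_all add: divide_simps)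
    ultimately have "ev P (- (1 + t) / t, t) * (3 / (5 - 4 * t))\<^sup>2 +
        ev Q (- (1 + t) / t, t) * (3 * t / (5 - 4 * t))\<^sup>2 = 0"
      using R by simp
    then have "(ev P (- (1 + t) / t, t) + t\<^sup>2 * ev Q (- (1 + t) / t, t)) * (3 / (5 - 4 * t))\<^sup>2 = 0"
      by (simp add: power_divide power_mult_distrib algebra_simps)
    then show ?case using t by simp
  qed
qed

text \<open>
  The heat map contracts \<open>x y = 1\<close> to \<open>(1, 1)\<close>; in the chart it maps this curve onto the
  exceptional curve, by \<open>t \<mapsto> (2 t - 1) / (t (2 - t))\<close>. So the exceptional curve is a leaf, too.
\<close>

lemma leaf_exceptional_curve: "slice_s 0 Q = 0"
proof (rule ccontr)
  assume nz: "slice_s 0 Q \<noteq> 0"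
  define \<rho> where "\<rho> = (\<lambda>t :: complex. - (1 + t) / t)"
  define \<tau> where "\<tau> = (\<lambda>t :: complex. (2 * t - 1) / (t * (2 - t)))"
  have val: "ev fB (\<rho> t, t) = -1" "ev fC (\<rho> t, t) = 1" "ev fD (\<rho> t, t) = -t"
    "ev fF (\<rho> t, t) = t" "ev fM (\<rho> t, t) = 2 - t" "ev fN (\<rho> t, t) = (2 * t - 1) / t"
    "ev fU (\<rho> t, t) = 0" if "t \<noteq> 0" for t
  proof -
    have "\<rho> t * t = - (1 + t)" using that by (simp add: \<rho>_def)
    then show "ev fB (\<rho> t, t) = -1" "ev fC (\<rho> t, t) = 1" "ev fD (\<rho> t, t) = -t"
      "ev fF (\<rho> t, t) = t" "ev fM (\<rho> t, t) = 2 - t" "ev fU (\<rho> t, t) = 0"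
      unfolding fac_defs using that by (simp_all, algebra+)
    have "ev fN (\<rho> t, t) * t = 2 * t - 1"
      unfolding fac_defs using \<open>\<rho> t * t = - (1 + t)\<close> by (simp, algebra)
    then show "ev fN (\<rho> t, t) = (2 * t - 1) / t" using that by (simp add: field_simps)
  qed
  have regular: "heat.regular (\<rho> t, t)" if "t \<noteq> 0" "t \<noteq> 2" for t
    unfolding heat.regular_def using that by (simp add: map_defs val)
  have S: "heat.S (\<rho> t, t) = 0" if "t \<noteq> 0" for t
    unfolding heat.S_def using that by (simp add: map_defs val)
  have T: "heat.T (\<rho> t, t) = \<tau> t" if "t \<noteq> 0" "t \<noteq> 2" for t
    unfolding heat.T_def using that by (simp add: map_defs val \<tau>_def field_simps)
  have "\<forall>\<^sub>F t in cofinite. poly (slice_s 0 Q) (\<tau> t) = 0"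
  proof -
    have "finite {t. singular (\<rho> t, t) \<and> t \<noteq> 0}"
    proof (rule inj_on_finite[OF _ _ coprime_common_zeros_finite[OF coprime]])
      show "inj_on \<rho> {t. singular (\<rho> t, t) \<and> t \<noteq> 0}"
        by (auto simp: inj_on_def \<rho>_def field_simps)
      show "\<rho> ` {t. singular (\<rho> t, t) \<and> t \<noteq> 0} \<subseteq> {s. \<exists>t. ev P (s, t) = 0 \<and> ev Q (s, t) = 0}"
        by (auto simp: singular_def)
    qed
    then have "\<forall>\<^sub>F t in cofinite. \<not> (singular (\<rho> t, t) \<and> t \<noteq> 0)"
      by (simp add: eventually_cofinite)
    \<comment> \<open>the numerator of the derivative of \<open>\<tau>\<close>\<close>
    moreover have "\<forall>\<^sub>F t in cofinite. poly [:2, -2, 2:] t \<noteq> (0 :: complex)"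
      by (rule cofinite_poly_neq_0) simp
    ultimately show ?thesis
      using leaf_xy_eq_1 cofinite_neq[of 0] cofinite_neq[of 2]
    proof eventually_elim
      case (elim t)
      have reg: "heat.regular (\<rho> t, t)" using regular elim(4,5) .
      have \<rho>': "(\<rho> has_field_derivative 1 / t\<^sup>2) (at t)"
        unfolding \<rho>_def using elim(4)
        by (auto intro!: derivative_eq_intros simp: field_simps power2_eq_square)
      have near: "\<forall>\<^sub>F u in nhds t. u \<noteq> 0 \<and> u \<noteq> 2"
        using elim(4,5) by (intro eventually_conj t1_space_nhds)
      have "((\<lambda>u. heat.S (\<rho> u, u)) has_field_derivative
          heat.Ss (\<rho> t, t) * (1 / t\<^sup>2) + heat.St (\<rho> t, t) * 1) (at t)"
        unfolding heat.S_def heat.Ss_def heat.St_def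
        using reg by (intro quot_deriv_curve \<rho>' DERIV_ident) (simp add: heat.regular_def)
      moreover have "((\<lambda>u. heat.S (\<rho> u, u)) has_field_derivative 0) (at t)"
        by (subst DERIV_cong_ev[OF refl _ refl, of _ "\<lambda>_. 0"])
          (use near S in \<open>auto elim: eventually_mono\<close>)
      ultimately have S': "heat.Ss (\<rho> t, t) * (1 / t\<^sup>2) + heat.St (\<rho> t, t) * 1 = 0"
        using DERIV_unique by blast
      have "((\<lambda>u. heat.T (\<rho> u, u)) has_field_derivative
          heat.Ts (\<rho> t, t) * (1 / t\<^sup>2) + heat.Tt (\<rho> t, t) * 1) (at t)"
        unfolding heat.T_def heat.Ts_def heat.Tt_def
        using reg by (intro quot_deriv_curve \<rho>' DERIV_ident) (simp add: heat.regular_def)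
      moreover have "((\<lambda>u. heat.T (\<rho> u, u)) has_field_derivative
          poly [:2, -2, 2:] t / (t * (2 - t))\<^sup>2) (at t)"
      proof -
        have "(\<tau> has_field_derivative poly [:2, -2, 2:] t / (t * (2 - t))\<^sup>2) (at t)"
          unfolding \<tau>_def using elim(4,5)
          by (auto intro!: derivative_eq_intros simp: power2_eq_square algebra_simps)
        then show ?thesis
          by (subst DERIV_cong_ev[OF refl _ refl, of _ \<tau>])
            (use near T in \<open>auto elim: eventually_mono\<close>)
      qed
      ultimately have T': "heat.Ts (\<rho> t, t) * (1 / t\<^sup>2) + heat.Tt (\<rho> t, t) * 1 =
          poly [:2, -2, 2:] t / (t * (2 - t))\<^sup>2"
        using DERIV_unique by blast
      have P: "ev P (\<rho> t, t) = - t\<^sup>2 * ev Q (\<rho> t, t)"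
        using elim(3) by (simp add: \<rho>_def eq_neg_iff_add_eq_0)
      have Q: "ev Q (\<rho> t, t) \<noteq> 0"
        using elim(1,4) P by (auto simp: singular_def)
      let ?G = "heat.G (\<rho> t, t)"
      have "ev Q (\<rho> t, t) * - (t\<^sup>2) * (ev P ?G * heat.St (\<rho> t, t) + ev Q ?G * heat.Tt (\<rho> t, t)) =
          ev Q (\<rho> t, t) * (ev P ?G * heat.Ss (\<rho> t, t) + ev Q ?G * heat.Ts (\<rho> t, t))"
        using invariant reg P unfolding heat.invariant_def by (metis mult.commute)
      then have "- (t\<^sup>2) * (ev P ?G * heat.St (\<rho> t, t) + ev Q ?G * heat.Tt (\<rho> t, t)) =
          ev P ?G * heat.Ss (\<rho> t, t) + ev Q ?G * heat.Ts (\<rho> t, t)"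
        using Q by (simp only: mult.assoc mult_cancel_left) blast
      moreover have "a * (p * (1 / t\<^sup>2) + q * 1) + b * (r * (1 / t\<^sup>2) + u * 1) = 0"
        if "- (t\<^sup>2) * (a * q + b * u) = a * p + b * r" for a b p q r u
      proof -
        have "a * (p * (1 / t\<^sup>2) + q * 1) + b * (r * (1 / t\<^sup>2) + u * 1) =
            (a * p + b * r) / t\<^sup>2 + (a * q + b * u)"
          by (simp add: algebra_simps add_divide_distrib)
        then show ?thesis unfolding that[symmetric] using elim(4) by simp
      qed
      ultimately have "ev P ?G * (heat.Ss (\<rho> t, t) * (1 / t\<^sup>2) + heat.St (\<rho> t, t) * 1) +
          ev Q ?G * (heat.Ts (\<rho> t, t) * (1 / t\<^sup>2) + heat.Tt (\<rho> t, t) * 1) = 0"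
        by blast
      then have "ev Q ?G = 0"
        unfolding S' T' using elim(2,4,5) by simp
      then show ?case
        using S T elim(4,5) by (simp add: heat.G_def poly_slice_s)
    qed
  qed
  moreover have "\<forall>\<^sub>F t in cofinite. poly (slice_s 0 Q) (\<tau> t) \<noteq> 0"
  proof -
    have "\<forall>\<^sub>F t in cofinite. \<tau> t \<noteq> r" for r
    proof -
      have "[:-1, 2 - 2 * r, r:] \<noteq> 0" by simp
      from cofinite_poly_neq_0[OF this] cofinite_neq[of 0] cofinite_neq[of 2] show ?thesis
        by eventually_elim (auto simp: \<tau>_def field_simps)
    qed
    then have "\<forall>\<^sub>F t in cofinite. \<forall>r\<in>{r. poly (slice_s 0 Q) r = 0}. \<tau> t \<noteq> r"
      by (intro eventually_ball_finite ballI poly_roots_finite[OF nz])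
    then show ?thesis by (auto elim: eventually_mono)
  qed
  ultimately have "\<forall>\<^sub>F t in cofinite :: complex filter. False"
    by eventually_elim simp
  then show False by (simp add: eventually_cofinite infinite_UNIV_char_0)
qed

text \<open>
  The image of the exceptional curve is a further leaf. Its parametrisation passes at \<open>t = -1\<close>
  through the point \<open>(0, 1)\<close> of the exceptional curve, where \<open>S\<close> has a double zero. Two different
  leaves meet there, so the point is singular, contrary to what was shown about it. Concretely,
  \<open>\<omega>\<close> vanishes on the velocity of the second leaf, and after division by \<open>1 + t\<close> the limit
  \<open>t \<rightarrow> -1\<close> gives \<open>P (0, 1) = 0\<close>.
\<close>

lemma no_invariant_foliation: False
proof -
  have P: "slice_s 0 P \<noteq> 0" using coprime_slice_neq_0[OF coprime, of 0] leaf_exceptional_curve by simp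
  obtain q where q: "\<And>z. ev Q z = fst z * ev q z"
    using bipoly_restrict_s[of Q 0] leaf_exceptional_curve by (metis add_0 diff_zero poly_0)
  define d where "d = (\<lambda>t :: complex. (5 * t + 6) * (5 * t + 4))"
  have val: "ev fB (0, t) = - (4 * t + 5)" "ev fC (0, t) = 5 * t + 6" "ev fD (0, t) = - (5 * t + 4)"
    "ev fF (0, t) = 6 * t + 5" "ev fM (0, t) = 3" "ev fN (0, t) = 3"
    "ev fU (0, t) = 3 * (1 + t)" "ev fW (0, t) = 3 * (1 + t)" for t
    unfolding fac_defs by simp_all
  have S: "heat.S (0, t) = - 9 * (1 + t)\<^sup>2 / d t" for t
    unfolding heat.S_def unfolding map_defs ev_simps val d_def
    by (simp add: power2_eq_square del: minus_add_distrib) (simp add: algebra_simps)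
  have St: "heat.St (0, t) = 18 * (1 + t) / (d t)\<^sup>2" for t
  proof -
    have *: "ev (dt fC) (0, t) = 5" "ev (dt fD) (0, t) = -5"
      "ev (dt fU) (0, t) = 3" "ev (dt fW) (0, t) = 3"
      unfolding fac_defs by (simp_all add: pderiv_rules)
    show ?thesis
      unfolding heat.St_def quot_deriv_def unfolding map_defs d_def
      by (simp add: val pderiv_mult *) (rule arg_cong2[of _ _ _ _ "(/)"], algebra, algebra)
  qed
  have dt_cont: "isCont (\<lambda>t. ev p (0, t)) t" for p t
    by (rule DERIV_isCont, rule ev_chain_rule[OF DERIV_const DERIV_ident])
  have d1: "d (-1) = -1" by (simp add: d_def)
  have dc: "isCont d (-1)" unfolding d_def by (intro continuous_intros)
  have den: "ev Sden (0, -1) \<noteq> 0" "ev Tden (0, -1) \<noteq> 0"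
    by (simp_all add: map_defs val)
  have lim_S: "((\<lambda>t. heat.S (0, t)) \<longlongrightarrow> 0) (at (-1))"
  proof -
    have "isCont (\<lambda>t. heat.S (0, t)) (-1)"
      unfolding heat.S_def using den by (intro continuous_intros dt_cont)
    then show ?thesis using S[of "-1"] by (simp add: isCont_def)
  qed
  have lim_T: "((\<lambda>t. heat.T (0, t)) \<longlongrightarrow> 1) (at (-1))"
  proof -
    have "isCont (\<lambda>t. heat.T (0, t)) (-1)"
      unfolding heat.T_def using den by (intro continuous_intros dt_cont)
    moreover have "heat.T (0, -1) = 1"
      unfolding heat.T_def by (simp add: map_defs val)
    ultimately show ?thesis by (simp add: isCont_def)
  qed
  have lim_Tt: "((\<lambda>t. heat.Tt (0, t)) \<longlongrightarrow> heat.Tt (0, -1)) (at (-1))"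
    using den unfolding heat.Tt_def quot_deriv_def
    by (intro tendsto_intros dt_cont[unfolded isCont_def]) auto
  have lim_G: "((\<lambda>t. ev p (heat.G (0, t))) \<longlongrightarrow> ev p (0, 1)) (at (-1))" for p
    using tendsto_ev[OF lim_S lim_T, of p] by (simp add: heat.G_def)
  let ?f = "\<lambda>t. ev P (heat.G (0, t)) * (18 / (d t)\<^sup>2) +
    (- 9 * (1 + t) / d t) * ev q (heat.G (0, t)) * heat.Tt (0, t)"
  have "\<forall>\<^sub>F t in at (-1). ev P (0, t) \<noteq> 0"
  proof -
    have "finite {t. ev P (0, t) = 0}"
      using poly_roots_finite[OF P] by (simp add: poly_slice_s)
    then have "\<forall>\<^sub>F t in at (-1). \<forall>r\<in>{t. ev P (0, t) = 0}. t \<noteq> r"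
      by (intro eventually_ball_finite ballI eventually_neq_at_within)
    then show ?thesis by (auto elim: eventually_mono)
  qed
  moreover have "\<forall>\<^sub>F t in at (-1). t \<noteq> (-1 :: complex)"
    by (simp add: eventually_at_filter)
  moreover have "\<forall>\<^sub>F t in at (-1). heat.regular (0, t)"
    unfolding heat.regular_def
    by (intro eventually_conj tendsto_imp_eventually_ne[OF dt_cont[unfolded isCont_def]] den)
  ultimately have "\<forall>\<^sub>F t in at (-1). ?f t = 0"
  proof eventually_elim
    case (elim t)
    have "ev Q (0, t) = 0" by (simp add: q)
    then have "ev P (0, t) * (ev P (heat.G (0, t)) * heat.St (0, t) + ev Q (heat.G (0, t)) * heat.Tt (0, t)) = 0"
      using invariant elim(3) unfolding heat.invariant_def by (metis mult_zero_left)
    then have "ev P (heat.G (0, t)) * heat.St (0, t) + heat.S (0, t) * ev q (heat.G (0, t)) * heat.Tt (0, t) = 0"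
      using elim(1) q by (simp add: heat.G_def)
    then have "(1 + t) * ?f t = 0"
      unfolding S St by (simp add: power2_eq_square algebra_simps)
    then show ?case using elim(2) by (auto simp: add_eq_0_iff)
  qed
  then have "(?f \<longlongrightarrow> 0) (at (-1))" by (simp add: tendsto_eventually)
  moreover have "(?f \<longlongrightarrow> ev P (0, 1) * (18 / (-1)\<^sup>2) + (- 9 * (1 + (-1)) / (-1)) * ev q (0, 1) * heat.Tt (0, -1)) (at (-1))"
    using dc d1 by (intro tendsto_intros lim_G lim_Tt) (auto simp: isCont_def)
  ultimately have "ev P (0, 1) * (18 / (-1)\<^sup>2) + (- 9 * (1 + (-1)) / (-1)) * ev q (0, 1) * heat.Tt (0, -1) = 0"
    using tendsto_unique[OF at_neq_bot] by blast
  then have "ev P (0, 1) = 0" by simp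
  moreover have "ev Q (0, 1) = 0" by (simp add: q)
  ultimately show False using nonsingular_exceptional_point by (simp add: singular_def)
qed

end

section \<open>Homogeneous coordinates and the chart\<close>

definition scale :: "(nat \<Rightarrow> complex) \<Rightarrow> (nat \<Rightarrow> nat \<Rightarrow> complex) \<Rightarrow> nat \<Rightarrow> nat \<Rightarrow> complex" where
  "scale c v = (\<lambda>i j. c i * v i j)"

lemma eval_poly_scale:
  assumes "multihom ns d p"
  shows "eval_poly p (scale c v) = (\<Prod>i<length ns. c i ^ d i) * eval_poly p v"
proof -
  let ?K = "SIGMA i:{..<length ns}. {..ns ! i}"
  have "eval_mon m (scale c v) = (\<Prod>i<length ns. c i ^ d i) * eval_mon m v"
    if m: "m \<in> Poly_Mapping.keys p" for m
  proof -
    have K: "finite ?K" "Poly_Mapping.keys m \<subseteq> ?K"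
      using assms m by (auto simp: multihom_def)
    have "(\<Prod>(i, j)\<in>?K. c i ^ Poly_Mapping.lookup m (i, j)) =
        (\<Prod>i<length ns. \<Prod>j\<le>ns ! i. c i ^ Poly_Mapping.lookup m (i, j))"
      by (rule prod.Sigma[symmetric]) auto
    also have "\<dots> = (\<Prod>i<length ns. c i ^ d i)"
      using assms m by (intro prod.cong) (auto simp: multihom_def power_sum[symmetric])
    finally show ?thesis
      unfolding eval_mon_superset[OF K]
      by (simp add: scale_def power_mult_distrib prod.distrib case_prod_unfold)
  qed
  then show ?thesis
    by (simp add: eval_poly_def sum_distrib_left mult_ac)
qed

definition subst :: "(nat \<Rightarrow> nat \<Rightarrow> bipoly) \<Rightarrow> cpoly \<Rightarrow> bipoly" where
  "subst \<gamma> p = (\<Sum>m\<in>Poly_Mapping.keys p. const (Poly_Mapping.lookup p m) *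
     (\<Prod>(i, j)\<in>Poly_Mapping.keys m. \<gamma> i j ^ Poly_Mapping.lookup m (i, j)))"

lemma ev_subst: "ev (subst \<gamma> p) z = eval_poly p (\<lambda>i j. ev (\<gamma> i j) z)"
  by (simp add: subst_def eval_poly_def eval_mon_def case_prod_unfold)

definition chart :: "complex \<times> complex \<Rightarrow> nat \<Rightarrow> nat \<Rightarrow> complex" where
  "chart z = affine_point (1 + fst z) (1 + snd z * fst z)"

definition chart_poly :: "nat \<Rightarrow> nat \<Rightarrow> bipoly" where
  "chart_poly i j = (if i \<le> 1 \<and> j = 0 then 1 else if i = 0 \<and> j = 1 then 1 + \<s>
     else if i = 1 \<and> j = 1 then 1 + \<t> * \<s> else 0)"

lemma ev_chart_poly: "(\<lambda>i j. ev (chart_poly i j) z) = chart z"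
  by (auto simp: chart_poly_def chart_def affine_point_def fun_eq_iff)

lemma chart_P1xP1: "chart z \<in> P1xP1"
  unfolding chart_def by (rule affine_point_coords)

text \<open>
  The chart meets every nonempty Zariski open subset: move a point of the subset along a line in
  general direction until it lies over the chart.
\<close>

lemma chart_dense:
  assumes poly: "\<And>\<gamma>. \<exists>q. \<forall>z. ev q z = F (\<lambda>i j. ev (\<gamma> i j) z)"
    and hom: "\<And>c v. F (scale c v) = c 0 ^ d * c 1 ^ e * F v"
    and v: "v \<in> P1xP1" "F v \<noteq> 0"
  obtains z where "F (chart z) \<noteq> 0"
proof -
  \<comment> \<open>in this direction, \<open>\<gamma> 0 0\<close>, \<open>\<gamma> 1 0\<close> and \<open>\<gamma> 0 1 - \<gamma> 0 0\<close> are not constant, so they vanish only at isolated points\<close>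
  define \<gamma> where "\<gamma> = (\<lambda>i j. const (v i j) + \<s> * const (affine_point 2 1 i j))"
  obtain q where q: "\<And>z. ev q z = F (\<lambda>i j. ev (\<gamma> i j) z)" using poly[of \<gamma>] by blast
  have "ev q (0, 0) = F v" by (simp add: q \<gamma>_def)
  then have "q \<noteq> 0" using v(2) by auto
  have nz: "const c + \<s> * const 1 \<noteq> 0" for c
  proof
    assume "const c + \<s> * const 1 = 0"
    then have "ev (const c + \<s> * const 1) (1 - c, 0) = 0" by simp
    then show False by simp
  qed
  define \<delta> where "\<delta> = \<gamma> 0 1 - \<gamma> 0 0"
  have "\<gamma> 0 0 \<noteq> 0" "\<gamma> 1 0 \<noteq> 0" by (simp_all only: \<gamma>_def, simp_all add: affine_point_def nz)
  moreover have "\<delta> \<noteq> 0"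
  proof
    assume "\<delta> = 0"
    then have "ev \<delta> (1 - (v 0 1 - v 0 0), 0) = 0" by simp
    then show False by (simp add: \<delta>_def \<gamma>_def affine_point_def)
  qed
  ultimately have "q * \<gamma> 0 0 * \<gamma> 1 0 * \<delta> \<noteq> 0" using \<open>q \<noteq> 0\<close> by simp
  then obtain z where z: "ev (q * \<gamma> 0 0 * \<gamma> 1 0 * \<delta>) z \<noteq> 0" using bipoly_eq_0I by blast
  define u where "u = (\<lambda>i j. ev (\<gamma> i j) z)"
  have u: "F u \<noteq> 0" "u 0 0 \<noteq> 0" "u 1 0 \<noteq> 0" "u 0 1 - u 0 0 \<noteq> 0"
    using z by (auto simp: q u_def \<delta>_def)
  define s where "s = u 0 1 / u 0 0 - 1"
  have s: "s \<noteq> 0" using u by (simp add: s_def field_simps)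
  define t where "t = (u 1 1 / u 1 0 - 1) / s"
  have ts: "t * s = u 1 1 / u 1 0 - 1" using s by (simp add: t_def)
  have out: "u i j = 0" if "\<not> (i \<le> 1 \<and> j \<le> 1)" for i j
  proof -
    have "\<not> (i < length [1, 1 :: nat] \<and> j \<le> [1, 1] ! i)"
    proof
      assume "i < length [1, 1 :: nat] \<and> j \<le> [1, 1] ! i"
      then have "i = 0 \<or> i = 1" "j \<le> [1, 1] ! i" by auto
      with that show False by auto
    qed
    then have "v i j = 0" using v(1) unfolding coords_def by blast
    moreover have "affine_point 2 1 i j = 0" using that by (auto simp: affine_point_def)
    ultimately show ?thesis by (simp add: u_def \<gamma>_def)
  qed
  have "scale (\<lambda>i. u i 0) (chart (s, t)) i j = u i j" for i j
  proof (cases "i \<le> 1 \<and> j \<le> 1")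
    case True
    then consider "i = 0" "j = 0" | "i = 0" "j = 1" | "i = 1" "j = 0" | "i = 1" "j = 1" by linarith
    then show ?thesis
      using u by cases (simp_all add: scale_def chart_def affine_point_def ts, simp_all add: s_def)
  next
    case False
    then show ?thesis using out by (auto simp: scale_def chart_def affine_point_def)
  qed
  then have "scale (\<lambda>i. u i 0) (chart (s, t)) = u" by blast
  then have "F (chart (s, t)) \<noteq> 0" using hom[of "\<lambda>i. u i 0" "chart (s, t)"] u(1) by auto
  then show ?thesis by (rule that)
qed

lemma heat_map_chart:
  assumes "heat.regular z" "fst z \<noteq> 0"
  obtains c where "c 0 \<noteq> 0" "c 1 \<noteq> 0"
    "map_at heat_map (chart z) = scale c (chart (heat.G z))"
proof -
  obtain s t where z: "z = (s, t)" by (cases z)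
  have s: "s \<noteq> 0" using assms(2) by (simp add: z)
  define b c d f m w where "b = ev fB z" "c = ev fC z" "d = ev fD z" "f = ev fF z" "m = ev fM z"
    "w = ev fW z"
  note defs = this
  have nz: "b \<noteq> 0" "c \<noteq> 0" "d \<noteq> 0" "f \<noteq> 0" "m \<noteq> 0"
    using assms(1) unfolding heat.regular_def by (simp_all add: map_defs defs)
  have S: "heat.S z = (1 + t + s * t) * m * w / (c * d)"
    unfolding heat.S_def by (simp add: map_defs fU_def defs z)
  have T: "heat.T z = ev fN z * c * d / (m * f * b)"
    unfolding heat.T_def by (simp add: map_defs defs)
  have TS: "heat.T z * heat.S z = ev fN z * (1 + t + s * t) * w / (f * b)"
    unfolding S T using nz by simp
  define x y where "x = 1 + s" and "y = 1 + t * s"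
  have factors: "x^2*y^2 - 6*x*y - x + 6 = s * b" "x*y^2 + 4*x*y + x - y - 5 = s * c"
    "x^2*y^2 - 6*x*y - y + 6 = s * d" "x^2*y + 4*x*y - x + y - 5 = s * f"
    unfolding defs fac_defs x_def y_def z by (simp_all, algebra+)
  have num: "(x*y^2 + 2*x*y - 3) * b = s * (c * d + (1 + t + s * t) * m * w)"
    "(x^2*y + 2*x*y - 3) * d = s * (f * b + ev fN z * (1 + t + s * t) * w)"
    unfolding defs fac_defs x_def y_def z by (simp_all, algebra+)
  define k where "k = (\<lambda>i :: nat. if i = 0 then s^2 * (c * d) else s^2 * (f * b))"
  have chart: "chart z = affine_point x y" by (simp add: chart_def z x_def y_def)
  have v: "map_at heat_map (chart z) 0 0 = s^2 * (c * d)"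
    "map_at heat_map (chart z) 0 1 = s^2 * (c * d) * (1 + heat.S z)"
    "map_at heat_map (chart z) 1 0 = s^2 * (f * b)"
    "map_at heat_map (chart z) 1 1 = s^2 * (f * b) * (1 + heat.T z * heat.S z)"
  proof -
    have "map_at heat_map (chart z) 0 0 = (x*y^2 + 4*x*y + x - y - 5) * (x^2*y^2 - 6*x*y - y + 6)"
      "map_at heat_map (chart z) 0 1 = (x*y^2 + 2*x*y - 3) * (x^2*y^2 - 6*x*y - x + 6)"
      "map_at heat_map (chart z) 1 0 = (x^2*y + 4*x*y - x + y - 5) * (x^2*y^2 - 6*x*y - x + 6)"
      "map_at heat_map (chart z) 1 1 = (x^2*y + 2*x*y - 3) * (x^2*y^2 - 6*x*y - y + 6)"
      unfolding chart map_at_def heat_map_def Let_def by (simp_all add: affine_point_def)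
    note this[unfolded factors]
    moreover have "(x*y^2 + 2*x*y - 3) * (s * b) = s^2 * (c * d) * (1 + heat.S z)"
    proof -
      have "c * d * (1 + heat.S z) = c * d + (1 + t + s * t) * m * w"
        using nz by (simp add: S field_simps)
      with num(1) show ?thesis by algebra
    qed
    moreover have "(x^2*y + 2*x*y - 3) * (s * d) = s^2 * (f * b) * (1 + heat.T z * heat.S z)"
    proof -
      have "f * b * (1 + heat.T z * heat.S z) = f * b + ev fN z * (1 + t + s * t) * w"
        unfolding distrib_left TS using nz by simp
      with num(2) show ?thesis by algebra
    qed
    ultimately show "map_at heat_map (chart z) 0 0 = s^2 * (c * d)"
      "map_at heat_map (chart z) 0 1 = s^2 * (c * d) * (1 + heat.S z)"
      "map_at heat_map (chart z) 1 0 = s^2 * (f * b)"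
      "map_at heat_map (chart z) 1 1 = s^2 * (f * b) * (1 + heat.T z * heat.S z)"
      by (simp_all add: power2_eq_square mult_ac)
  qed
  have r: "scale k (chart (heat.G z)) 0 0 = s^2 * (c * d)"
    "scale k (chart (heat.G z)) 0 1 = s^2 * (c * d) * (1 + heat.S z)"
    "scale k (chart (heat.G z)) 1 0 = s^2 * (f * b)"
    "scale k (chart (heat.G z)) 1 1 = s^2 * (f * b) * (1 + heat.T z * heat.S z)"
    by (simp_all add: scale_def chart_def affine_point_def k_def heat.G_def)
  have "map_at heat_map (chart z) i j = scale k (chart (heat.G z)) i j" for i j
  proof (cases "i \<le> 1 \<and> j \<le> 1")
    case True
    then consider "i = 0" "j = 0" | "i = 0" "j = 1" | "i = 1" "j = 0" | "i = 1" "j = 1" by linarith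
    then show ?thesis
      by cases (simp_all only: v r)
  next
    case False
    then have "heat_map i j = 0" by (auto simp: heat_map_def Let_def)
    then show ?thesis using False
      by (auto simp: map_at_def scale_def chart_def affine_point_def)
  qed
  then have "map_at heat_map (chart z) = scale k (chart (heat.G z))" by blast
  then show ?thesis using that[of k] s nz by (simp add: k_def)
qed

section \<open>Projective curves\<close>

lemma zariski_closedE:
  assumes "zariski_closed ns Z"
  obtains S where "\<forall>p\<in>S. \<exists>d. multihom ns d p" "Z = {v \<in> coords ns. \<forall>p\<in>S. eval_poly p v = 0}"
proof -
  from assms have "\<exists>S. (\<forall>p\<in>S. \<exists>d. multihom ns d p) \<and> Z = {v \<in> coords ns. \<forall>p\<in>S. eval_poly p v = 0}"
    by (simp only: zariski_closed_def)
  then obtain S where S: "(\<forall>p\<in>S. \<exists>d. multihom ns d p) \<and> Z = {v \<in> coords ns. \<forall>p\<in>S. eval_poly p v = 0}"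
    by (rule exE)
  show ?thesis using that[OF conjunct1[OF S] conjunct2[OF S]] .
qed

lemma zariski_closed_scale:
  assumes "zariski_closed ns Z" "z \<in> Z" "\<And>i. c i \<noteq> 0"
  shows "scale c z \<in> Z"
proof -
  obtain S where S: "\<forall>p\<in>S. \<exists>d. multihom ns d p" "Z = {v \<in> coords ns. \<forall>p\<in>S. eval_poly p v = 0}"
    using assms(1) by (rule zariski_closedE)
  have "scale c z \<in> coords ns"
    using assms(2,3) S(2) by (auto simp: coords_def scale_def)
  moreover have "eval_poly p (scale c z) = 0" if "p \<in> S" for p
  proof -
    obtain d where "multihom ns d p" using S(1) \<open>p \<in> S\<close> by blast
    then show ?thesis using eval_poly_scale assms(2) S(2) that by auto
  qed
  ultimately show ?thesis using S(2) by auto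
qed

lemma multihom_0: "multihom ns d 0"
  by (simp add: multihom_def)

lemma multihom_sum: "(\<And>a. a \<in> A \<Longrightarrow> multihom ns d (f a)) \<Longrightarrow> multihom ns d (sum f A)"
  by (induction A rule: infinite_finite_induct) (auto intro: multihom_0 multihom_add)

lemma multihom_const: "multihom ns (\<lambda>i. 0) (Poly_Mapping.single 0 c)"
  by (auto simp: multihom_def)

lemma multihom_power:
  assumes "multihom ns d p" shows "multihom ns (\<lambda>i. k * d i) (p ^ k)"
proof (induction k)
  case 0
  show ?case using multihom_const[of ns 1] by (simp add: single_one)
next
  case (Suc k)
  show ?case using multihom_mult[OF assms Suc, of "\<lambda>i. Suc k * d i"] by simp
qed

lemma multihom_coordinate: "j \<le> n \<Longrightarrow> multihom [n] (\<lambda>i. 1) (Var 0 j)"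
  by (rule multihom_Var) auto

text \<open>
  The set of all coordinate vectors of the point represented by \<open>y\<close>.
\<close>

definition proj_point :: "nat \<Rightarrow> (nat \<Rightarrow> nat \<Rightarrow> complex) \<Rightarrow> (nat \<Rightarrow> nat \<Rightarrow> complex) set" where
  "proj_point n y = {v \<in> coords [n]. \<forall>i\<le>n. \<forall>j\<le>n. y 0 i * v 0 j = y 0 j * v 0 i}"

lemma coords_single: "v \<in> coords [n] \<longleftrightarrow> (\<exists>j\<le>n. v 0 j \<noteq> 0) \<and> (\<forall>i j. \<not> (i = 0 \<and> j \<le> n) \<longrightarrow> v i j = 0)"
proof -
  have "i < length [n] \<and> j \<le> [n] ! i \<longleftrightarrow> i = 0 \<and> j \<le> n" for i j by (cases i) auto
  then show ?thesis unfolding coords_def mem_Collect_eq by auto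
qed

lemma proj_point_closed: "zariski_closed [n] (proj_point n y)"
  unfolding zariski_closed_def
proof (intro exI conjI)
  define c where "c = (\<lambda>a. Poly_Mapping.single 0 a :: cpoly)"
  let ?S = "{c (y 0 i) * Var 0 j - c (y 0 j) * Var 0 i | i j. i \<le> n \<and> j \<le> n}"
  have "multihom [n] (\<lambda>i. 1) (c (y 0 i) * Var 0 j - c (y 0 j) * Var 0 i)"
    if "i \<le> n" "j \<le> n" for i j
    unfolding c_def using that
    by (intro multihom_diff multihom_mult[OF multihom_const multihom_coordinate]) auto
  then show "\<forall>p\<in>?S. \<exists>d. multihom [n] d p" by blast
  have "eval_poly (c a) v = a" for a v by (simp add: c_def eval_mon_def)
  then have "(\<forall>p\<in>?S. eval_poly p v = 0) \<longleftrightarrow> (\<forall>i\<le>n. \<forall>j\<le>n. y 0 i * v 0 j = y 0 j * v 0 i)" for v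
    by (fastforce simp: eval_poly_diff)
  then show "proj_point n y = {v \<in> coords [n]. \<forall>p\<in>?S. eval_poly p v = 0}"
    unfolding proj_point_def by blast
qed

lemma proj_point_eq:
  assumes y: "y \<in> coords [n]" and v: "v \<in> proj_point n y"
  obtains c where "c \<noteq> 0" "v = scale (\<lambda>_. c) y"
proof -
  obtain k where k: "k \<le> n" "y 0 k \<noteq> 0" using y by (auto simp: coords_single)
  define c where "c = v 0 k / y 0 k"
  have vc: "v \<in> coords [n]" and eq: "\<And>i j. i \<le> n \<Longrightarrow> j \<le> n \<Longrightarrow> y 0 i * v 0 j = y 0 j * v 0 i"
    using v by (auto simp: proj_point_def)
  have v0: "v 0 j = c * y 0 j" if "j \<le> n" for j
    using eq[OF k(1) that] k(2) by (simp add: c_def field_simps)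
  have "v i j = c * y i j" for i j
    using v0 vc y by (cases "i = 0 \<and> j \<le> n") (auto simp: coords_single)
  then have "v = scale (\<lambda>_. c) y" by (simp add: scale_def fun_eq_iff)
  moreover have "c \<noteq> 0" using v0 vc by (auto simp: coords_single)
  ultimately show ?thesis using that by blast
qed

lemma closed_contains_proj_point:
  assumes "zariski_closed [n] A" "y \<in> A" "y \<in> coords [n]"
  shows "proj_point n y \<subseteq> A"
proof
  fix v assume "v \<in> proj_point n y"
  then obtain c where "c \<noteq> 0" "v = scale (\<lambda>_. c) y" using proj_point_eq assms(3) by blast
  then show "v \<in> A" using zariski_closed_scale[OF assms(1,2)] by simp
qed

lemma proj_point_self: "y \<in> coords [n] \<Longrightarrow> y \<in> proj_point n y"
  by (simp add: proj_point_def)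

lemma proj_point_irreducible:
  assumes "y \<in> coords [n]"
  shows "irreducible_closed [n] (proj_point n y)"
  unfolding irreducible_closed_def
proof (intro conjI allI impI)
  fix A B
  assume AB: "zariski_closed [n] A \<and> zariski_closed [n] B \<and> proj_point n y \<subseteq> A \<union> B"
  then have "y \<in> A \<or> y \<in> B" using proj_point_self[OF assms] by blast
  then show "proj_point n y \<subseteq> A \<or> proj_point n y \<subseteq> B"
    using AB closed_contains_proj_point assms by blast
qed (use proj_point_closed proj_point_self[OF assms] in auto)

lemma curve_not_point:
  assumes "projective_curve n Y" "y \<in> coords [n]"
  shows "\<not> Y \<subseteq> proj_point n y"
proof
  assume Y: "Y \<subseteq> proj_point n y"
  have "k = 0" if "\<forall>i\<le>k. irreducible_closed [n] (Z i) \<and> Z i \<subseteq> Y" "\<forall>i<k. Z i \<subset> Z (Suc i)" for k Z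
  proof (rule ccontr)
    assume "k \<noteq> 0"
    then have Z: "irreducible_closed [n] (Z 0)" "Z 0 \<subseteq> Y" "Z (Suc 0) \<subseteq> Y" "Z 0 \<subset> Z (Suc 0)"
      using that by auto
    then obtain z where z: "z \<in> Z 0" "zariski_closed [n] (Z 0)" by (auto simp: irreducible_closed_def)
    then have "z \<in> proj_point n y" using Z(2) Y by blast
    then obtain c where c: "c \<noteq> 0" "z = scale (\<lambda>_. c) y" using proj_point_eq assms(2) by blast
    then have "y = scale (\<lambda>_. inverse c) z" by (auto simp: scale_def fun_eq_iff)
    then have "y \<in> Z 0" using zariski_closed_scale[OF z(2,1), of "\<lambda>_. inverse c"] c(1) by simp
    then have "proj_point n y \<subseteq> Z 0" using closed_contains_proj_point z(2) assms(2) by blast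
    with Z(3,4) Y show False by blast
  qed
  then have "proj_dim [n] Y \<le> 0"
    unfolding proj_dim_def by (intro Sup_least) (auto simp: zero_enat_def)
  with assms(1) show False by (simp add: projective_curve_def)
qed

text \<open>
  Otherwise a point, \<open>Z\<close> and the curve would be a chain of length two.
\<close>

lemma curve_no_intermediate:
  assumes "projective_curve n Y" "irreducible_closed [n] Z" "Z \<subseteq> Y"
    and y: "y \<in> coords [n]" "y \<in> Z" "\<not> Z \<subseteq> proj_point n y"
  shows "Z = Y"
proof (rule ccontr)
  assume "Z \<noteq> Y"
  define C where "C = (\<lambda>i :: nat. if i = 0 then proj_point n y else if i = 1 then Z else Y)"
  have Zc: "zariski_closed [n] Z" using assms(2) by (simp add: irreducible_closed_def)
  have pZ: "proj_point n y \<subset> Z" using closed_contains_proj_point[OF Zc y(2,1)] y(3) by blast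
  have "irreducible_closed [n] (C i) \<and> C i \<subseteq> Y" if "i \<le> 2" for i
    using that assms(1-3) proj_point_irreducible[OF y(1)] pZ
    by (auto simp: C_def projective_curve_def)
  moreover have "C i \<subset> C (Suc i)" if "i < 2" for i
    using that pZ assms(3) \<open>Z \<noteq> Y\<close> by (auto simp: C_def less_2_cases_iff)
  ultimately have "enat 2 \<le> proj_dim [n] Y"
    unfolding proj_dim_def by (intro Sup_upper) blast
  then show False using assms(1) by (simp add: projective_curve_def one_enat_def)
qed

lemma poly_linear_dependence:
  fixes f :: "'i \<Rightarrow> complex poly"
  assumes "finite I" "\<And>i k. i \<in> I \<Longrightarrow> k \<ge> N \<Longrightarrow> coeff (f i) k = 0" "N < card I"
  shows "\<exists>c. (\<exists>i\<in>I. c i \<noteq> 0) \<and> (\<Sum>i\<in>I. smult (c i) (f i)) = 0"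
  using assms
proof (induction N arbitrary: I f)
  case 0
  then have "f i = 0" if "i \<in> I" for i using that by (intro poly_eqI) auto
  moreover have "I \<noteq> {}" using 0 by auto
  ultimately show ?case by (intro exI[of _ "\<lambda>_. 1"]) auto
next
  case (Suc N)
  show ?case
  proof (cases "\<forall>i\<in>I. coeff (f i) N = 0")
    case True
    have "coeff (f i) k = 0" if "i \<in> I" "k \<ge> N" for i k
      using True Suc(3)[of i k] that by (cases "k = N") auto
    then show ?thesis using Suc by simp
  next
    case False
    then obtain i0 where i0: "i0 \<in> I" "coeff (f i0) N \<noteq> 0" by blast
    define r where "r = (\<lambda>i. coeff (f i) N / coeff (f i0) N)"
    define h where "h = (\<lambda>i. f i - smult (r i) (f i0))"
    have "coeff (h i) k = 0" if "i \<in> I - {i0}" "k \<ge> N" for i k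
      using Suc(3)[of i k] Suc(3)[of i0 k] that i0 by (cases "k = N") (auto simp: h_def r_def)
    moreover have "N < card (I - {i0})" using Suc(2,4) i0 by simp
    ultimately obtain c where c: "\<exists>i\<in>I - {i0}. c i \<noteq> 0" "(\<Sum>i\<in>I - {i0}. smult (c i) (h i)) = 0"
      using Suc(1)[of "I - {i0}" h] Suc(2) by auto
    define c' where "c' = c(i0 := - (\<Sum>i\<in>I - {i0}. c i * r i))"
    have "(\<Sum>i\<in>I. smult (c' i) (f i)) = smult (c' i0) (f i0) + (\<Sum>i\<in>I - {i0}. smult (c' i) (f i))"
      using Suc(2) i0(1) by (simp add: sum.remove)
    also have "(\<Sum>i\<in>I - {i0}. smult (c' i) (f i)) =
        (\<Sum>i\<in>I - {i0}. smult (c i) (h i)) + smult (\<Sum>i\<in>I - {i0}. c i * r i) (f i0)"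
      by (simp add: c'_def h_def smult_diff_right smult_sum sum.distrib[symmetric] flip: sum_subtractf)
    finally have "(\<Sum>i\<in>I. smult (c' i) (f i)) = 0" using c(2) by (simp add: c'_def)
    moreover have "\<exists>i\<in>I. c' i \<noteq> 0" using c(1) by (auto simp: c'_def)
    ultimately show ?thesis by blast
  qed
qed

text \<open>
  Two rational functions \<open>a / b\<close> and \<open>c / d\<close> of one variable satisfy a polynomial equation, which
  is written here without denominators: there are \<open>(M + 1)\<^sup>2\<close> monomials, but the space in which
  they take their values has a dimension that grows only linearly with \<open>M\<close>.
\<close>

lemma poly_algebraic_dependence:
  fixes a b c d :: "complex poly"
  obtains M e where "\<exists>k\<le>M. \<exists>l\<le>M. e (k, l) \<noteq> (0 :: complex)"
    "(\<Sum>(k, l)\<in>{..M} \<times> {..M}. smult (e (k, l)) (a ^ k * b ^ (M - k) * c ^ l * d ^ (M - l))) = 0"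
proof -
  define m where "m = Max {degree a, degree b, degree c, degree d}"
  have m: "degree a \<le> m" "degree b \<le> m" "degree c \<le> m" "degree d \<le> m" by (auto simp: m_def)
  \<comment> \<open>with this choice, \<open>(M + 1)\<^sup>2\<close> exceeds \<open>2 M m + 1\<close>\<close>
  define M where "M = 2 * m + 1"
  define f where "f = (\<lambda>(k, l). a ^ k * b ^ (M - k) * c ^ l * d ^ (M - l))"
  have deg: "degree (f (k, l)) \<le> 2 * M * m" if "k \<le> M" "l \<le> M" for k l
  proof -
    have "degree (f (k, l)) \<le> k * m + (M - k) * m + l * m + (M - l) * m"
      unfolding f_def case_prod_conv
      by (intro order.trans[OF degree_mult_le] add_mono order.trans[OF degree_power_le])
        (use m in \<open>auto simp: mult.commute\<close>)
    also have "\<dots> = (k + (M - k)) * m + (l + (M - l)) * m" by (simp only: distrib_right add.assoc)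
    also have "\<dots> = 2 * M * m" using that by simp
    finally show ?thesis .
  qed
  have "coeff (f i) k = 0" if "i \<in> {..M} \<times> {..M}" "k \<ge> 2 * M * m + 1" for i k
    using that deg by (cases i) (auto intro!: coeff_eq_0 le_less_trans[OF deg])
  moreover have "2 * M * m + 1 < card ({..M} \<times> {..M})"
    by (simp add: card_cartesian_product M_def)
  ultimately obtain e where e: "\<exists>i\<in>{..M} \<times> {..M}. e i \<noteq> 0" "(\<Sum>i\<in>{..M} \<times> {..M}. smult (e i) (f i)) = 0"
    using poly_linear_dependence[of "{..M} \<times> {..M}" "2 * M * m + 1" f] by auto
  show ?thesis
    by (rule that[of M e]) (use e in \<open>auto simp: f_def case_prod_unfold\<close>)
qed

section \<open>From an invariant fibration to an invariant foliation\<close>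

lemma has_field_derivative_cong_nearby:
  "(f has_field_derivative D) (at x) \<Longrightarrow> \<forall>\<^sub>F y in nhds x. f y = g y \<Longrightarrow>
    (g has_field_derivative D) (at x)"
  using DERIV_cong_ev[of x x f g D D] by simp

text \<open>
  A nonconstant rational function \<open>a / b\<close> is nonconstant on some horizontal or vertical line
  \<open>\<l>\<close>. Restricting to such a line turns polynomials in two variables into polynomials in one.
\<close>

lemma nonconstant_on_a_line:
  assumes b: "b \<noteq> 0" and nc: "\<nexists>c. a = const c * b"
  obtains \<l> x1 x2 where "\<And>p. \<exists>q. \<forall>x. poly q x = ev p (\<l> x)"
    "ev a (\<l> x1) * ev b (\<l> x2) \<noteq> ev a (\<l> x2) * ev b (\<l> x1)"
proof -
  have nonconst: "\<exists>x1 x2. poly A x1 * poly B x2 \<noteq> poly A x2 * poly B x1"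
    if "poly B x * poly (pderiv A) x \<noteq> poly A x * poly (pderiv B) x" for A B :: "complex poly" and x
  proof (rule ccontr)
    assume *: "\<not> ?thesis"
    have "poly (smult (poly B x) A) y = poly (smult (poly A x) B) y" for y
      using * by (metis mult.commute poly_smult)
    then have "smult (poly B x) A = smult (poly A x) B" by (metis poly_eq_poly_eq_iff ext)
    then have "poly (pderiv (smult (poly B x) A)) x = poly (pderiv (smult (poly A x) B)) x" by simp
    then show False using that by (simp add: pderiv_smult)
  qed
  have "b * ds a \<noteq> a * ds b \<or> b * dt a \<noteq> a * dt b"
    using proportional_if_jacobian_0[OF b] nc by metis
  then show ?thesis
  proof
    assume "b * ds a \<noteq> a * ds b"
    then obtain z where "ev (b * ds a) z \<noteq> ev (a * ds b) z"
      using bipoly_eq_0I[of "b * ds a - a * ds b"] by auto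
    moreover obtain s t where z: "z = (s, t)" by (cases z)
    ultimately obtain x1 x2 where
      "poly (poly a [:t:]) x1 * poly (poly b [:t:]) x2 \<noteq> poly (poly a [:t:]) x2 * poly (poly b [:t:]) x1"
      using nonconst[of "poly b [:t:]" s "poly a [:t:]"] by (auto simp: ev_def ds_slice)
    then show ?thesis
      by (intro that[of "\<lambda>x. (x, t)" x1 x2]) (auto simp: ev_def)
  next
    assume "b * dt a \<noteq> a * dt b"
    then obtain z where "ev (b * dt a) z \<noteq> ev (a * dt b) z"
      using bipoly_eq_0I[of "b * dt a - a * dt b"] by auto
    moreover obtain s t where z: "z = (s, t)" by (cases z)
    ultimately obtain x1 x2 where
      "poly (slice_s s a) x1 * poly (slice_s s b) x2 \<noteq> poly (slice_s s a) x2 * poly (slice_s s b) x1"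
      using nonconst[of "slice_s s b" t "slice_s s a"] by (auto simp: poly_slice_s pderiv_slice_s)
    moreover have "\<exists>q. \<forall>x. poly q x = ev p (s, x)" for p
      by (rule exI[of _ "slice_s s p"]) (simp add: poly_slice_s)
    ultimately show ?thesis
      by (intro that[of "\<lambda>x. (s, x)" x1 x2]) (simp_all add: poly_slice_s)
  qed
qed

text \<open>
  From here on, \<open>\<pi>\<close> is an invariant fibration over the curve \<open>Y\<close>, with induced map \<open>g\<close>.
\<close>

context
  fixes n Y \<pi> g
  assumes curve: "projective_curve n Y"
    and dominant: "dominant_rational_map [1, 1] P1xP1 [n] Y \<pi>"
    and g: "rational_map [n] Y [n] Y g"
    and semiconj: "comp_eq P1xP1 [1, 1] [n] [n] \<pi> heat_map g \<pi>"
begin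

text \<open>
  The homogeneous coordinates of \<open>\<pi>\<close> and of \<open>g \<circ> \<pi>\<close> as polynomials in the chart.
\<close>

definition pi_chart :: "nat \<Rightarrow> bipoly" where "pi_chart j = subst chart_poly (\<pi> 0 j)"

definition gpi_chart :: "nat \<Rightarrow> bipoly" where
  "gpi_chart j = subst (\<lambda>i j. subst chart_poly (\<pi> i j)) (g 0 j)"

lemma ev_pi_chart: "ev (pi_chart j) z = map_at \<pi> (chart z) 0 j"
  by (simp add: pi_chart_def ev_subst ev_chart_poly map_at_def)

lemma ev_gpi_chart: "ev (gpi_chart j) z = map_at g (map_at \<pi> (chart z)) 0 j"
  by (simp add: gpi_chart_def ev_subst ev_chart_poly map_at_def)

lemma single_index: "i < length [n] \<and> j \<le> [n] ! i \<longleftrightarrow> i = 0 \<and> j \<le> n"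
  by (cases i) auto

lemma \<pi>_rational: "rational_map [1, 1] P1xP1 [n] Y \<pi>"
  using dominant by (simp add: dominant_rational_map_def)

lemma outside: "\<not> (i = 0 \<and> j \<le> n) \<Longrightarrow> \<pi> i j = 0" "\<not> (i = 0 \<and> j \<le> n) \<Longrightarrow> g i j = 0"
  using \<pi>_rational g unfolding rational_map_def single_index by blast+

lemma degrees:
  obtains d d' where "\<And>j. j \<le> n \<Longrightarrow> multihom [1, 1] d (\<pi> 0 j)" "\<And>j. j \<le> n \<Longrightarrow> multihom [n] d' (g 0 j)"
proof -
  have "\<exists>d. \<forall>j\<le>n. multihom [1, 1] d (\<pi> 0 j)" "\<exists>d. \<forall>j\<le>n. multihom [n] d (g 0 j)"
    using \<pi>_rational g unfolding rational_map_def by fastforce+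
  with that show ?thesis by blast
qed

lemma map_at_coords: "map_at \<pi> v \<in> coords [n] \<longleftrightarrow> (\<exists>j\<le>n. map_at \<pi> v 0 j \<noteq> 0)"
  "map_at g v \<in> coords [n] \<longleftrightarrow> (\<exists>j\<le>n. map_at g v 0 j \<noteq> 0)"
  unfolding coords_single using outside by (auto simp: map_at_def)

lemma map_at_scale:
  "\<exists>d :: nat \<Rightarrow> nat. \<forall>c v. map_at \<pi> (scale c v) = scale (\<lambda>_. c 0 ^ d 0 * c 1 ^ d 1) (map_at \<pi> v)"
proof -
  obtain d d' where d: "\<And>j. j \<le> n \<Longrightarrow> multihom [1, 1] d (\<pi> 0 j)"
    "\<And>j. j \<le> n \<Longrightarrow> multihom [n] d' (g 0 j)" using degrees by blast
  have "map_at \<pi> (scale c v) i j = scale (\<lambda>_. c 0 ^ d 0 * c 1 ^ d 1) (map_at \<pi> v) i j" for c v i j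
  proof (cases "i = 0 \<and> j \<le> n")
    case True
    then show ?thesis
      using eval_poly_scale[OF d(1), of j c v] by (simp add: map_at_def scale_def numeral_2_eq_2)
  qed (simp add: map_at_def scale_def outside)
  then have "map_at \<pi> (scale c v) = scale (\<lambda>_. c 0 ^ d 0 * c 1 ^ d 1) (map_at \<pi> v)" for c v by blast
  then show ?thesis by (intro exI[of _ d] allI)
qed

lemma nonvanishing_on_chart:
  assumes \<Theta>: "multihom [n] d' \<Theta>" and v: "v \<in> P1xP1" "eval_poly \<Theta> (map_at \<pi> v) \<noteq> 0"
  obtains z where "eval_poly \<Theta> (map_at \<pi> (chart z)) \<noteq> 0"
proof -
  obtain d :: "nat \<Rightarrow> nat" where d: "\<And>c v. map_at \<pi> (scale c v) = scale (\<lambda>_. c 0 ^ d 0 * c 1 ^ d 1) (map_at \<pi> v)"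
    using map_at_scale by blast
  let ?F = "\<lambda>v. eval_poly \<Theta> (map_at \<pi> v)"
  have poly: "\<exists>q. \<forall>z. ev q z = ?F (\<lambda>i j. ev (\<gamma> i j) z)" for \<gamma>
    by (rule exI[of _ "subst (\<lambda>i j. subst \<gamma> (\<pi> i j)) \<Theta>"]) (simp add: ev_subst map_at_def)
  have hom: "?F (scale c v) = c 0 ^ (d 0 * d' 0) * c 1 ^ (d 1 * d' 0) * ?F v" for c v
    unfolding d eval_poly_scale[OF \<Theta>] by (simp add: power_mult power_mult_distrib)
  show ?thesis by (rule chart_dense[of ?F, OF poly hom v]) (rule that)
qed

lemma nonconstant_component:
  obtains i j where "i \<le> n" "j \<le> n" "pi_chart j \<noteq> 0" "\<nexists>c. pi_chart i = const c * pi_chart j"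
proof -
  have "dom_map P1xP1 [n] \<pi> \<noteq> {}" using \<pi>_rational by (simp add: rational_map_def)
  then obtain v j where v: "v \<in> P1xP1" "j \<le> n" "map_at \<pi> v 0 j \<noteq> 0"
    by (auto simp: dom_map_def map_at_coords)
  then obtain z where "map_at \<pi> (chart z) 0 j \<noteq> 0"
    using nonvanishing_on_chart[OF multihom_coordinate, of j v] by auto
  then have pcj: "pi_chart j \<noteq> 0" using ev_pi_chart[of j z] by auto
  have "\<exists>i\<le>n. \<nexists>c. pi_chart i = const c * pi_chart j"
  proof (rule ccontr)
    assume "\<not> ?thesis"
    then obtain c where c: "\<And>i. i \<le> n \<Longrightarrow> pi_chart i = const (c i) * pi_chart j" by metis
    define y where "y = (\<lambda>i k. if i = (0 :: nat) \<and> k \<le> n then c k else 0)"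
    have "c j \<noteq> 0" using c[OF v(2)] pcj by (auto simp: const_def)
    then have y: "y \<in> coords [n]" using v(2) by (auto simp: coords_single y_def)
    have "map_at \<pi> ` dom_map P1xP1 [n] \<pi> \<subseteq> proj_point n y"
    proof safe
      fix v assume "v \<in> dom_map P1xP1 [n] \<pi>"
      then have vd: "v \<in> P1xP1" "map_at \<pi> v \<in> coords [n]" by (auto simp: dom_map_def)
      have "y 0 i * map_at \<pi> v 0 k = y 0 k * map_at \<pi> v 0 i" if ik: "i \<le> n" "k \<le> n" for i k
      proof (rule ccontr)
        assume ne: "\<not> ?thesis"
        define \<Theta> where "\<Theta> = Poly_Mapping.single 0 (c i) * Var 0 k - Poly_Mapping.single 0 (c k) * Var 0 i"
        have ev: "eval_poly \<Theta> w = c i * w 0 k - c k * w 0 i" for w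
          by (simp add: \<Theta>_def eval_mon_def)
        have "multihom [n] (\<lambda>_. 1) \<Theta>"
          unfolding \<Theta>_def using ik
          by (intro multihom_diff multihom_mult[OF multihom_const multihom_coordinate]) auto
        moreover have "eval_poly \<Theta> (map_at \<pi> v) \<noteq> 0" using ne ik by (simp add: ev y_def)
        ultimately obtain z where "eval_poly \<Theta> (map_at \<pi> (chart z)) \<noteq> 0"
          using nonvanishing_on_chart vd(1) by blast
        then have "c i * ev (pi_chart k) z - c k * ev (pi_chart i) z \<noteq> 0" by (simp add: ev ev_pi_chart)
        then show False using c[OF ik(1)] c[OF ik(2)] by simp
      qed
      then show "map_at \<pi> v \<in> proj_point n y" using vd(2) by (simp add: proj_point_def)
    qed
    then have "Y \<subseteq> proj_point n y"
      using dominant proj_point_closed unfolding dominant_rational_map_def by blast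
    with curve_not_point[OF curve y] show False by blast
  qed
  with that pcj v(2) show ?thesis by blast
qed

text \<open>
  The closure of the image of a line on which \<open>\<pi>\<close> is not constant is an irreducible subset of
  \<open>Y\<close> that is not a point, hence all of \<open>Y\<close>. So an equation that holds along the line holds on
  \<open>Y\<close>.
\<close>

lemma curve_from_line:
  assumes line: "\<And>p. \<exists>q. \<forall>x. poly q x = ev p (\<l> x)"
    and ij: "i \<le> n" "j \<le> n"
    and nc: "ev (pi_chart i) (\<l> x1) * ev (pi_chart j) (\<l> x2) \<noteq> ev (pi_chart i) (\<l> x2) * ev (pi_chart j) (\<l> x1)"
    and \<Theta>: "multihom [n] d \<Theta>" "\<And>x. eval_poly \<Theta> (map_at \<pi> (chart (\<l> x))) = 0"
    and y: "y \<in> Y"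
  shows "eval_poly \<Theta> y = 0"
proof -
  define \<rho> where "\<rho> = (\<lambda>x. map_at \<pi> (chart (\<l> x)))"
  have poly: "\<exists>q. \<forall>x. poly q x = eval_poly \<Theta> (\<rho> x)" for \<Theta>
  proof -
    obtain q where "\<And>x. poly q x = ev (subst (\<lambda>i j. subst chart_poly (\<pi> i j)) \<Theta>) (\<l> x)"
      using line by blast
    then show ?thesis
      by (intro exI[of _ q]) (simp add: ev_subst ev_chart_poly \<rho>_def map_at_def)
  qed
  have \<rho>: "\<rho> x 0 k = ev (pi_chart k) (\<l> x)" for x k by (simp add: \<rho>_def ev_pi_chart)
  have "\<rho> x1 0 i \<noteq> 0 \<or> \<rho> x1 0 j \<noteq> 0" "\<rho> x2 0 i \<noteq> 0 \<or> \<rho> x2 0 j \<noteq> 0"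
    using nc by (auto simp: \<rho>)
  then have x12: "\<rho> x1 \<in> coords [n]" "\<rho> x2 \<in> coords [n]"
    using ij by (auto simp: \<rho>_def map_at_coords)
  then obtain k where k: "k \<le> n" "\<rho> x1 0 k \<noteq> 0" by (auto simp: coords_single)
  define Z where "Z = {y \<in> coords [n]. \<forall>\<Theta>\<in>{\<Theta>. (\<exists>d. multihom [n] d \<Theta>) \<and> (\<forall>x. eval_poly \<Theta> (\<rho> x) = 0)}.
    eval_poly \<Theta> y = 0}"
  have Zc: "zariski_closed [n] Z"
    unfolding zariski_closed_def
    by (rule exI[of _ "{\<Theta>. (\<exists>d. multihom [n] d \<Theta>) \<and> (\<forall>x. eval_poly \<Theta> (\<rho> x) = 0)}"])
      (auto simp: Z_def)
  have \<rho>Z: "\<rho> x \<in> Z" if "\<rho> x \<in> coords [n]" for x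
    using that by (auto simp: Z_def)
  have separate: "\<exists>\<alpha>. \<alpha> \<noteq> 0 \<and> (\<forall>x. poly \<alpha> x \<noteq> 0 \<longrightarrow> \<rho> x \<in> coords [n] \<longrightarrow> \<rho> x \<notin> A)"
    if A: "zariski_closed [n] A" "\<not> Z \<subseteq> A" for A
  proof -
    obtain S where S: "\<forall>p\<in>S. \<exists>d. multihom [n] d p" "A = {v \<in> coords [n]. \<forall>p\<in>S. eval_poly p v = 0}"
      using A(1) by (rule zariski_closedE)
    obtain z where z: "z \<in> Z" "z \<notin> A" using A(2) by blast
    have "z \<in> coords [n]" using z(1) unfolding Z_def by blast
    then obtain p where p: "p \<in> S" "eval_poly p z \<noteq> 0" using z(2) S(2) by blast
    obtain e where "multihom [n] e p" using S(1) p(1) by blast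
    then obtain x0 where x0: "eval_poly p (\<rho> x0) \<noteq> 0"
      using z(1) p(2) unfolding Z_def by blast
    obtain q where q: "\<forall>x. poly q x = eval_poly p (\<rho> x)" using poly by blast
    have "poly q x0 \<noteq> 0" using q x0 by simp
    then have "q \<noteq> 0" by (metis poly_0)
    moreover have "\<rho> x \<notin> A" if "poly q x \<noteq> 0" for x
      using that p(1) q unfolding S(2) by auto
    ultimately show ?thesis by blast
  qed
  obtain qk where qk: "\<And>x. poly qk x = \<rho> x 0 k"
    using poly[of "Var 0 k"] by auto
  have "qk \<noteq> 0" using qk[of x1] k(2) by auto
  have good: "\<rho> x \<in> coords [n]" if "poly qk x \<noteq> 0" for x
    using that k(1) unfolding qk by (auto simp: \<rho>_def map_at_coords)
  have "irreducible_closed [n] Z"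
    unfolding irreducible_closed_def
  proof (intro conjI allI impI)
    fix A B assume AB: "zariski_closed [n] A \<and> zariski_closed [n] B \<and> Z \<subseteq> A \<union> B"
    show "Z \<subseteq> A \<or> Z \<subseteq> B"
    proof (rule ccontr)
      assume "\<not> ?thesis"
      then obtain \<alpha> \<beta> where \<alpha>: "\<alpha> \<noteq> 0" "\<And>x. poly \<alpha> x \<noteq> 0 \<Longrightarrow> \<rho> x \<in> coords [n] \<Longrightarrow> \<rho> x \<notin> A"
        and \<beta>: "\<beta> \<noteq> 0" "\<And>x. poly \<beta> x \<noteq> 0 \<Longrightarrow> \<rho> x \<in> coords [n] \<Longrightarrow> \<rho> x \<notin> B"
        using separate AB by meson
      have "\<alpha> * \<beta> * qk \<noteq> 0" using \<alpha>(1) \<beta>(1) \<open>qk \<noteq> 0\<close> by simp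
      then obtain x where "poly (\<alpha> * \<beta> * qk) x \<noteq> 0" using poly_all_0_iff_0 by blast
      then have "\<rho> x \<in> coords [n]" "\<rho> x \<notin> A" "\<rho> x \<notin> B" using \<alpha>(2) \<beta>(2) good by auto
      with \<rho>Z AB show False by blast
    qed
  qed (use Zc \<rho>Z x12 in auto)
  moreover have "Z \<subseteq> Y"
  proof
    fix z assume z: "z \<in> Z"
    have "zariski_closed [n] Y"
      using curve by (simp add: projective_curve_def irreducible_closed_def)
    then obtain S where S: "\<forall>p\<in>S. \<exists>d. multihom [n] d p" "Y = {v \<in> coords [n]. \<forall>p\<in>S. eval_poly p v = 0}"
      by (rule zariski_closedE)
    have "eval_poly p z = 0" if p: "p \<in> S" for p
    proof -
      obtain q where q: "\<And>x. poly q x = eval_poly p (\<rho> x)" using poly by blast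
      have "poly (qk * q) x = 0" for x
      proof (cases "poly qk x = 0")
        case False
        then have "chart (\<l> x) \<in> dom_map P1xP1 [n] \<pi>"
          using good chart_P1xP1 by (simp add: dom_map_def \<rho>_def)
        then have "\<rho> x \<in> Y" using \<pi>_rational unfolding rational_map_def \<rho>_def by blast
        then show ?thesis using S(2) p q by simp
      qed simp
      then have "qk * q = 0" using poly_all_0_iff_0 by blast
      then have "q = 0" using \<open>qk \<noteq> 0\<close> by simp
      then have "eval_poly p (\<rho> x) = 0" for x using q[of x] by simp
      then show ?thesis using z S(1) p by (auto simp: Z_def)
    qed
    then show "z \<in> Y" using z S(2) by (auto simp: Z_def)
  qed
  moreover have "\<rho> x2 \<notin> proj_point n (\<rho> x1)"
    using nc ij by (auto simp: proj_point_def \<rho> mult.commute)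
  then have "\<not> Z \<subseteq> proj_point n (\<rho> x1)" using \<rho>Z x12 by blast
  ultimately have "Z = Y"
    using curve_no_intermediate[OF curve _ _ x12(1)] \<rho>Z x12(1) by blast
  then show ?thesis using y \<Theta> by (auto simp: Z_def \<rho>_def)
qed

lemma semiconjugacy_in_chart:
  "\<forall>\<^sub>F z in generic. \<exists>c. c \<noteq> 0 \<and> (\<forall>k\<le>n. ev (gpi_chart k) z = c * ev (pi_chart k) (heat.G z))"
proof -
  obtain i j where ij: "i \<le> n" "j \<le> n" "pi_chart j \<noteq> 0" "\<nexists>c. pi_chart i = const c * pi_chart j"
    using nonconstant_component .
  define U where "U = {v \<in> dom_map P1xP1 [1, 1] heat_map \<inter> dom_map P1xP1 [n] \<pi>.
    map_at \<pi> (map_at heat_map v) \<in> coords [n] \<and> map_at g (map_at \<pi> v) \<in> coords [n]}"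
  have U: "U \<noteq> {}"
    "\<And>v. v \<in> U \<Longrightarrow> same_point [n] (map_at \<pi> (map_at heat_map v)) (map_at g (map_at \<pi> v))"
    using semiconj unfolding comp_eq_def Let_def U_def by blast+
  obtain v k where v: "v \<in> P1xP1" "k \<le> n" "map_at g (map_at \<pi> v) 0 k \<noteq> 0"
    using U(1) by (auto simp: U_def dom_map_def map_at_coords)
  obtain d d' where d: "\<And>j. j \<le> n \<Longrightarrow> multihom [1, 1] d (\<pi> 0 j)" "\<And>j. j \<le> n \<Longrightarrow> multihom [n] d' (g 0 j)"
    using degrees by blast
  have "eval_poly (g 0 k) (map_at \<pi> v) \<noteq> 0" using v(3) by (simp add: map_at_def[of g])
  then obtain z where "eval_poly (g 0 k) (map_at \<pi> (chart z)) \<noteq> 0"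
    by (rule nonvanishing_on_chart[OF d(2)[OF v(2)] v(1)])
  then have gck: "gpi_chart k \<noteq> 0" using ev_gpi_chart[of k z] by (auto simp: map_at_def)
  have "\<s> \<noteq> 0" by (simp add: \<s>_def)
  obtain e :: "nat \<Rightarrow> nat" where e: "\<And>c v. map_at \<pi> (scale c v) = scale (\<lambda>_. c 0 ^ e 0 * c 1 ^ e 1) (map_at \<pi> v)"
    using map_at_scale by blast
  from heat.generic_regular eventually_ev_neq_0[OF \<open>\<s> \<noteq> 0\<close>] eventually_ev_neq_0[OF ij(3)]
    heat.generic_ev_G_neq_0[OF ij(3)] eventually_ev_neq_0[OF gck]
  show ?thesis
  proof eventually_elim
    case (elim z)
    obtain c where c: "c 0 \<noteq> 0" "c 1 \<noteq> 0" "map_at heat_map (chart z) = scale c (chart (heat.G z))"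
      using heat_map_chart[OF elim(1)] elim(2) by auto
    define \<kappa> where "\<kappa> = c 0 ^ e 0 * c 1 ^ e 1"
    have \<kappa>: "\<kappa> \<noteq> 0" using c by (simp add: \<kappa>_def)
    have \<pi>H: "map_at \<pi> (map_at heat_map (chart z)) 0 k = \<kappa> * ev (pi_chart k) (heat.G z)" for k
      unfolding c(3) e ev_pi_chart by (simp add: scale_def \<kappa>_def)
    have "chart z \<in> U"
    proof -
      have "chart z \<in> dom_map P1xP1 [1, 1] heat_map"
      proof -
        have "scale c (chart (heat.G z)) \<in> P1xP1"
        proof -
          have G: "chart (heat.G z) \<in> P1xP1" by (rule chart_P1xP1)
          have "c i \<noteq> 0" if "i < length [1, 1 :: nat]" for i
          proof -
            from that have "i = 0 \<or> i = 1" by auto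
            then show ?thesis using c by auto
          qed
          then show ?thesis using G unfolding coords_def scale_def mem_Collect_eq
            by (metis mult_eq_0_iff)
        qed
        then show ?thesis using chart_P1xP1 c(3) by (simp add: dom_map_def)
      qed
      moreover have "chart z \<in> dom_map P1xP1 [n] \<pi>"
        using elim(3) ij(2) chart_P1xP1 by (auto simp: dom_map_def map_at_coords ev_pi_chart)
      moreover have "map_at \<pi> (map_at heat_map (chart z)) \<in> coords [n]"
        using elim(4) ij(2) \<kappa> by (auto simp: map_at_coords \<pi>H)
      moreover have "map_at g (map_at \<pi> (chart z)) \<in> coords [n]"
        using elim(5) v(2) by (auto simp: map_at_coords ev_gpi_chart)
      ultimately show ?thesis by (simp add: U_def)
    qed
    from U(2)[OF this] obtain b where "b \<noteq> 0"
      "\<forall>k\<le>n. map_at g (map_at \<pi> (chart z)) 0 k = b * map_at \<pi> (map_at heat_map (chart z)) 0 k"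
      by (auto simp: same_point_def)
    then show ?case using \<kappa> by (intro exI[of _ "b * \<kappa>"]) (simp add: ev_gpi_chart \<pi>H)
  qed
qed

text \<open>
  The functions \<open>\<pi>\<^sub>i / \<pi>\<^sub>j\<close> and \<open>(g\<^sub>i / g\<^sub>j) \<circ> \<pi>\<close> are algebraically dependent on a line; the
  equation between them is one between homogeneous polynomials on \<open>Y\<close>, so it holds everywhere.
\<close>

lemma algebraically_dependent:
  assumes ij: "i \<le> n" "j \<le> n" and "pi_chart j \<noteq> 0" "\<nexists>c. pi_chart i = const c * pi_chart j"
  shows "\<exists>\<Psi>. \<Psi> \<noteq> 0 \<and> (\<forall>z. ev (pi_chart j) z \<noteq> 0 \<longrightarrow> ev (gpi_chart j) z \<noteq> 0 \<longrightarrow>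
    ev \<Psi> (ev (pi_chart i) z / ev (pi_chart j) z, ev (gpi_chart i) z / ev (gpi_chart j) z) = 0)"
proof -
  obtain \<l> x1 x2 where line: "\<And>p. \<exists>q. \<forall>x. poly q x = ev p (\<l> x)"
    and nc: "ev (pi_chart i) (\<l> x1) * ev (pi_chart j) (\<l> x2) \<noteq> ev (pi_chart i) (\<l> x2) * ev (pi_chart j) (\<l> x1)"
    using nonconstant_on_a_line[OF assms(3,4)] by metis
  obtain a b c d where abcd: "\<And>x. poly a x = ev (pi_chart i) (\<l> x)" "\<And>x. poly b x = ev (pi_chart j) (\<l> x)"
    "\<And>x. poly c x = ev (gpi_chart i) (\<l> x)" "\<And>x. poly d x = ev (gpi_chart j) (\<l> x)"
    using line by metis
  obtain M e where e: "\<exists>k\<le>M. \<exists>l\<le>M. e (k, l) \<noteq> (0 :: complex)"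
    "(\<Sum>(k, l)\<in>{..M} \<times> {..M}. smult (e (k, l)) (a ^ k * b ^ (M - k) * c ^ l * d ^ (M - l))) = 0"
    using poly_algebraic_dependence .
  define \<Theta> where "\<Theta> = (\<Sum>(k, l)\<in>{..M} \<times> {..M}. Poly_Mapping.single 0 (e (k, l)) *
    (Var 0 i ^ k * Var 0 j ^ (M - k) * (g 0 i ^ l * g 0 j ^ (M - l))))"
  have ev_\<Theta>: "eval_poly \<Theta> (map_at \<pi> (chart z)) = (\<Sum>(k, l)\<in>{..M} \<times> {..M}. e (k, l) *
      (ev (pi_chart i) z ^ k * ev (pi_chart j) z ^ (M - k) * (ev (gpi_chart i) z ^ l * ev (gpi_chart j) z ^ (M - l))))" for z
    by (simp add: \<Theta>_def eval_poly_sum case_prod_unfold eval_mon_def ev_pi_chart ev_gpi_chart map_at_def[of g])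
  obtain d1 d2 where d2: "\<And>j. j \<le> n \<Longrightarrow> multihom [1, 1] d1 (\<pi> 0 j)"
    "\<And>j. j \<le> n \<Longrightarrow> multihom [n] d2 (g 0 j)" using degrees by blast
  have "multihom [n] (\<lambda>r. M + M * d2 r) \<Theta>"
    unfolding \<Theta>_def
  proof (rule multihom_sum, clarify)
    fix k l assume kl: "k \<le> M" "l \<le> M"
    have "multihom [n] (\<lambda>_. M) (Var 0 i ^ k * Var 0 j ^ (M - k))"
      by (rule multihom_mult[OF multihom_power multihom_power, OF multihom_coordinate multihom_coordinate])
        (use ij kl in auto)
    moreover have "multihom [n] (\<lambda>r. M * d2 r) (g 0 i ^ l * g 0 j ^ (M - l))"
      by (rule multihom_mult[OF multihom_power multihom_power, OF d2(2) d2(2)])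
        (use ij kl in \<open>auto simp flip: distrib_right\<close>)
    ultimately have "multihom [n] (\<lambda>r. M + M * d2 r)
        (Var 0 i ^ k * Var 0 j ^ (M - k) * (g 0 i ^ l * g 0 j ^ (M - l)))"
      by (rule multihom_mult) auto
    then show "multihom [n] (\<lambda>r. M + M * d2 r) (Poly_Mapping.single 0 (e (k, l)) *
        (Var 0 i ^ k * Var 0 j ^ (M - k) * (g 0 i ^ l * g 0 j ^ (M - l))))"
      by (rule multihom_mult[OF multihom_const]) auto
  qed
  moreover have "eval_poly \<Theta> (map_at \<pi> (chart (\<l> x))) = 0" for x
  proof -
    have "poly (\<Sum>(k, l)\<in>{..M} \<times> {..M}. smult (e (k, l)) (a ^ k * b ^ (M - k) * c ^ l * d ^ (M - l))) x = 0"
      unfolding e(2) by simp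
    then show ?thesis
      unfolding ev_\<Theta> by (simp add: poly_sum case_prod_unfold abcd mult.assoc)
  qed
  ultimately have \<Theta>Y: "eval_poly \<Theta> y = 0" if "y \<in> Y" for y
    using curve_from_line[OF line ij nc] that by blast
  define \<Psi> where "\<Psi> = (\<Sum>(k, l)\<in>{..M} \<times> {..M}. monom (monom (e (k, l)) k) l)"
  have ev_\<Psi>: "ev \<Psi> z = (\<Sum>(k, l)\<in>{..M} \<times> {..M}. e (k, l) * fst z ^ k * snd z ^ l)" for z
    unfolding \<Psi>_def by (simp add: case_prod_unfold ev_def poly_monom poly_sum)
  obtain k0 l0 where kl0: "k0 \<le> M" "l0 \<le> M" "e (k0, l0) \<noteq> 0" using e(1) by blast
  have *: "coeff (coeff (monom (monom (e (k, l)) k) l) l0) k0 = (if (k, l) = (k0, l0) then e (k, l) else 0)" for k l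
    by (cases "l = l0") (auto simp: coeff_monom)
  have "coeff (coeff \<Psi> l0) k0 = (\<Sum>x\<in>{..M} \<times> {..M}. if x = (k0, l0) then e x else 0)"
    unfolding \<Psi>_def coeff_sum
  proof (intro sum.cong refl)
    show "coeff (coeff (case x of (k, l) \<Rightarrow> monom (monom (e (k, l)) k) l) l0) k0 =
        (if x = (k0, l0) then e x else 0)" for x
      by (cases x) (simp only: case_prod_conv *)
  qed
  also have "\<dots> = e (k0, l0)" using kl0 by (simp add: sum.delta)
  finally have "\<Psi> \<noteq> 0" using kl0(3) by auto
  moreover have "ev \<Psi> (ev (pi_chart i) z / ev (pi_chart j) z, ev (gpi_chart i) z / ev (gpi_chart j) z) = 0"
    if nz: "ev (pi_chart j) z \<noteq> 0" "ev (gpi_chart j) z \<noteq> 0" for z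
  proof -
    have "chart z \<in> dom_map P1xP1 [n] \<pi>"
      using nz(1) ij(2) chart_P1xP1 by (auto simp: dom_map_def map_at_coords ev_pi_chart)
    then have "map_at \<pi> (chart z) \<in> Y" using \<pi>_rational unfolding rational_map_def by blast
    then have "eval_poly \<Theta> (map_at \<pi> (chart z)) = 0" by (rule \<Theta>Y)
    also have "eval_poly \<Theta> (map_at \<pi> (chart z)) = ev (pi_chart j) z ^ M * ev (gpi_chart j) z ^ M *
        ev \<Psi> (ev (pi_chart i) z / ev (pi_chart j) z, ev (gpi_chart i) z / ev (gpi_chart j) z)"
      unfolding ev_\<Theta> ev_\<Psi> sum_distrib_left
    proof (intro sum.cong refl, clarify)
      fix k l assume kl: "k \<le> M" "l \<le> M"
      have "ev (pi_chart j) z ^ M = ev (pi_chart j) z ^ k * ev (pi_chart j) z ^ (M - k)"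
        "ev (gpi_chart j) z ^ M = ev (gpi_chart j) z ^ l * ev (gpi_chart j) z ^ (M - l)"
        using kl by (simp_all flip: power_add)
      then show "e (k, l) * (ev (pi_chart i) z ^ k * ev (pi_chart j) z ^ (M - k) * (ev (gpi_chart i) z ^ l * ev (gpi_chart j) z ^ (M - l))) =
        ev (pi_chart j) z ^ M * ev (gpi_chart j) z ^ M * (e (k, l) *
          fst (ev (pi_chart i) z / ev (pi_chart j) z, ev (gpi_chart i) z / ev (gpi_chart j) z) ^ k *
          snd (ev (pi_chart i) z / ev (pi_chart j) z, ev (gpi_chart i) z / ev (gpi_chart j) z) ^ l)"
        using nz by (simp add: power_divide)
    qed
    finally show ?thesis using nz by simp
  qed
  ultimately show ?thesis by blast
qed

text \<open>
  Let \<open>u = \<pi>\<^sub>i / \<pi>\<^sub>j\<close> be nonconstant. It is algebraically dependent with \<open>(g\<^sub>i / g\<^sub>j) \<circ> \<pi>\<close>, that is,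
  with \<open>u \<circ> H\<close>; so the map with these two components is not dominant, and its Jacobian vanishes.
  This says that \<open>du\<close> and its pull-back are proportional: after removal of the common factor \<open>h\<close>
  of its coefficients, \<open>du\<close> defines an invariant foliation.
\<close>

lemma no_invariant_fibration: False
proof -
  obtain i j where ij: "i \<le> n" "j \<le> n" and b: "pi_chart j \<noteq> 0" and nc: "\<nexists>c. pi_chart i = const c * pi_chart j"
    using nonconstant_component .
  obtain \<Psi> where \<Psi>: "\<Psi> \<noteq> 0" "\<And>z. ev (pi_chart j) z \<noteq> 0 \<Longrightarrow> ev (gpi_chart j) z \<noteq> 0 \<Longrightarrow>
    ev \<Psi> (ev (pi_chart i) z / ev (pi_chart j) z, ev (gpi_chart i) z / ev (gpi_chart j) z) = 0"
    using algebraically_dependent[OF ij b nc] by blast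
  interpret uv: plane_map "pi_chart i" "pi_chart j" "gpi_chart i" "gpi_chart j" .
  have jac: "uv.jac z = 0" if "uv.regular z" for z
  proof (rule ccontr)
    assume "uv.jac z \<noteq> 0"
    with that have "dominant_plane_map (pi_chart i) (pi_chart j) (gpi_chart i) (gpi_chart j)"
      by unfold_locales blast
    moreover have "ev \<Psi> (uv.G z) = 0" if "uv.regular z" for z
      using \<Psi>(2)[of z] that unfolding uv.regular_def uv.G_def uv.S_def uv.T_def by blast
    ultimately show False
      using dominant_plane_map.image_not_in_curve[of "pi_chart i" "pi_chart j" "gpi_chart i" "gpi_chart j" \<Psi>] \<Psi>(1) by blast
  qed
  have gcj: "\<forall>\<^sub>F z in generic. ev (gpi_chart j) z \<noteq> 0"
    using semiconjugacy_in_chart heat.generic_ev_G_neq_0[OF b]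
  proof eventually_elim
    case (elim z)
    then obtain c where "c \<noteq> 0" "ev (gpi_chart j) z = c * ev (pi_chart j) (heat.G z)" using ij by blast
    then show ?case using elim(2) by simp
  qed
  have cross: "ev (gpi_chart i) z * ev (pi_chart j) (heat.G z) = ev (gpi_chart j) z * ev (pi_chart i) (heat.G z)"
    if "heat.regular z" for z
  proof -
    have "heat.rat (\<lambda>z. ev (gpi_chart i) z * ev (pi_chart j) (heat.G z) - ev (gpi_chart j) z * ev (pi_chart i) (heat.G z))"
      by (intro heat.rat_diff heat.rat_mult heat.rat_ev heat.rat_ev_G)
    moreover have "\<forall>\<^sub>F z in generic.
        ev (gpi_chart i) z * ev (pi_chart j) (heat.G z) - ev (gpi_chart j) z * ev (pi_chart i) (heat.G z) = 0"
      using semiconjugacy_in_chart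
    proof eventually_elim
      case (elim z)
      then obtain c where "ev (gpi_chart i) z = c * ev (pi_chart i) (heat.G z)" "ev (gpi_chart j) z = c * ev (pi_chart j) (heat.G z)"
        using ij by blast
      then show ?case by simp
    qed
    ultimately have "ev (gpi_chart i) z * ev (pi_chart j) (heat.G z) - ev (gpi_chart j) z * ev (pi_chart i) (heat.G z) = 0"
      using that by (rule heat.rat_eq_0_if_generically_0)
    then show ?thesis by simp
  qed
  define P0 Q0 where "P0 = ds (pi_chart i) * pi_chart j - pi_chart i * ds (pi_chart j)"
    and "Q0 = dt (pi_chart i) * pi_chart j - pi_chart i * dt (pi_chart j)"
  have quot: "quot_deriv ds (pi_chart i) (pi_chart j) z = ev P0 z * inverse ((ev (pi_chart j) z)\<^sup>2)"
    "quot_deriv dt (pi_chart i) (pi_chart j) z = ev Q0 z * inverse ((ev (pi_chart j) z)\<^sup>2)" for z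
    by (simp_all add: quot_deriv_def P0_def Q0_def divide_inverse)
  have "P0 \<noteq> 0 \<or> Q0 \<noteq> 0"
  proof (rule ccontr)
    assume "\<not> ?thesis"
    then have "pi_chart j * ds (pi_chart i) = pi_chart i * ds (pi_chart j)" "pi_chart j * dt (pi_chart i) = pi_chart i * dt (pi_chart j)"
      by (simp_all add: P0_def Q0_def mult.commute)
    then obtain c where "pi_chart i = const c * pi_chart j" by (rule proportional_if_jacobian_0[OF b])
    with nc show False by blast
  qed
  then have "gcd P0 Q0 \<noteq> 0" by simp
  then obtain P Q where PQ: "P0 = P * gcd P0 Q0" "Q0 = Q * gcd P0 Q0" "coprime P Q"
    using gcd_coprime_exists by blast
  define h where "h = gcd P0 Q0"
  have P0: "ev P0 z = ev P z * ev h z" and Q0: "ev Q0 z = ev Q z * ev h z" for z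
    using arg_cong[OF PQ(1), of "\<lambda>p. ev p z"] arg_cong[OF PQ(2), of "\<lambda>p. ev p z"]
    by (simp_all add: h_def)
  have h: "h \<noteq> 0" using \<open>gcd P0 Q0 \<noteq> 0\<close> by (simp add: h_def)
  have gen: "\<forall>\<^sub>F z in generic. ev P z * (ev P (heat.G z) * heat.St z + ev Q (heat.G z) * heat.Tt z) -
      ev Q z * (ev P (heat.G z) * heat.Ss z + ev Q (heat.G z) * heat.Ts z) = 0"
    using heat.generic_regular eventually_ev_neq_0[OF b] heat.generic_ev_G_neq_0[OF b] gcj
      eventually_ev_neq_0[OF h] heat.generic_ev_G_neq_0[OF h]
  proof eventually_elim
    case (elim z)
    obtain s t where z: "z = (s, t)" by (cases z)
    have reg: "heat.regular (s, t)" using elim(1) z by simp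
    note nz = elim(2-6)[unfolded z]
    have v: "ev (gpi_chart i) w / ev (gpi_chart j) w = ev (pi_chart i) (heat.G w) / ev (pi_chart j) (heat.G w)"
      if "heat.regular w" "ev (gpi_chart j) w \<noteq> 0" "ev (pi_chart j) (heat.G w) \<noteq> 0" for w
      using cross[OF that(1)] that(2,3) by (simp add: frac_eq_eq mult.commute)
    have GS: "((\<lambda>x. heat.S (x, t)) has_field_derivative heat.Ss (s, t)) (at s)"
      "((\<lambda>x. heat.T (x, t)) has_field_derivative heat.Ts (s, t)) (at s)"
      using reg unfolding heat.S_def heat.T_def heat.Ss_def heat.Ts_def heat.regular_def
      by (auto intro: quot_deriv_s)
    have GT: "((\<lambda>x. heat.S (s, x)) has_field_derivative heat.St (s, t)) (at t)"
      "((\<lambda>x. heat.T (s, x)) has_field_derivative heat.Tt (s, t)) (at t)"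
      using reg unfolding heat.S_def heat.T_def heat.St_def heat.Tt_def heat.regular_def
      by (auto intro: quot_deriv_t)
    have "((\<lambda>x. ev (gpi_chart i) (x, t) / ev (gpi_chart j) (x, t)) has_field_derivative uv.Ts (s, t)) (at s)"
      unfolding uv.Ts_def using nz by (intro quot_deriv_s) auto
    moreover have "\<forall>\<^sub>F x in nhds s. ev (gpi_chart i) (x, t) / ev (gpi_chart j) (x, t) =
        ev (pi_chart i) (heat.S (x, t), heat.T (x, t)) / ev (pi_chart j) (heat.S (x, t), heat.T (x, t))"
    proof -
      have "((\<lambda>x. ev (pi_chart j) (heat.G (x, t))) \<longlongrightarrow> ev (pi_chart j) (heat.G (s, t))) (nhds s)"
        using DERIV_isCont[OF heat.ev_G_deriv_s[OF reg], of "pi_chart j"]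
          tendsto_at_iff_tendsto_nhds[of "\<lambda>x. ev (pi_chart j) (heat.G (x, t))" s] by (simp add: isCont_def)
      then have "\<forall>\<^sub>F x in nhds s. ev (pi_chart j) (heat.G (x, t)) \<noteq> 0"
        using nz(2) by (rule tendsto_imp_eventually_ne)
      with heat.regular_nearby_s[OF reg] ev_neq_0_nearby_s[OF nz(3)] show ?thesis
        unfolding heat.G_def[symmetric] by eventually_elim (rule v)
    qed
    ultimately have "((\<lambda>x. ev (pi_chart i) (heat.S (x, t), heat.T (x, t)) / ev (pi_chart j) (heat.S (x, t), heat.T (x, t)))
        has_field_derivative uv.Ts (s, t)) (at s)"
      by (rule has_field_derivative_cong_nearby)
    then have Ts: "uv.Ts (s, t) = quot_deriv ds (pi_chart i) (pi_chart j) (heat.G (s, t)) * heat.Ss (s, t) +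
        quot_deriv dt (pi_chart i) (pi_chart j) (heat.G (s, t)) * heat.Ts (s, t)"
      unfolding heat.G_def
      by (rule DERIV_unique[OF _ quot_deriv_curve[OF GS]]) (use nz(2) in \<open>simp add: heat.G_def\<close>)
    have "((\<lambda>x. ev (gpi_chart i) (s, x) / ev (gpi_chart j) (s, x)) has_field_derivative uv.Tt (s, t)) (at t)"
      unfolding uv.Tt_def using nz by (intro quot_deriv_t) auto
    moreover have "\<forall>\<^sub>F x in nhds t. ev (gpi_chart i) (s, x) / ev (gpi_chart j) (s, x) =
        ev (pi_chart i) (heat.S (s, x), heat.T (s, x)) / ev (pi_chart j) (heat.S (s, x), heat.T (s, x))"
    proof -
      have "((\<lambda>x. ev (pi_chart j) (heat.G (s, x))) \<longlongrightarrow> ev (pi_chart j) (heat.G (s, t))) (nhds t)"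
        using DERIV_isCont[OF heat.ev_G_deriv_t[OF reg], of "pi_chart j"]
          tendsto_at_iff_tendsto_nhds[of "\<lambda>x. ev (pi_chart j) (heat.G (s, x))" t] by (simp add: isCont_def)
      then have "\<forall>\<^sub>F x in nhds t. ev (pi_chart j) (heat.G (s, x)) \<noteq> 0"
        using nz(2) by (rule tendsto_imp_eventually_ne)
      with heat.regular_nearby_t[OF reg] ev_neq_0_nearby_t[OF nz(3)] show ?thesis
        unfolding heat.G_def[symmetric] by eventually_elim (rule v)
    qed
    ultimately have "((\<lambda>x. ev (pi_chart i) (heat.S (s, x), heat.T (s, x)) / ev (pi_chart j) (heat.S (s, x), heat.T (s, x)))
        has_field_derivative uv.Tt (s, t)) (at t)"
      by (rule has_field_derivative_cong_nearby)
    then have Tt: "uv.Tt (s, t) = quot_deriv ds (pi_chart i) (pi_chart j) (heat.G (s, t)) * heat.St (s, t) +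
        quot_deriv dt (pi_chart i) (pi_chart j) (heat.G (s, t)) * heat.Tt (s, t)"
      unfolding heat.G_def
      by (rule DERIV_unique[OF _ quot_deriv_curve[OF GT]]) (use nz(2) in \<open>simp add: heat.G_def\<close>)
    have "uv.regular z" using elim(2,4) by (simp add: uv.regular_def)
    from jac[OF this] have "uv.Ss z * uv.Tt z - uv.St z * uv.Ts z = 0" unfolding uv.jac_def .
    then have 0: "ev P0 z * inverse ((ev (pi_chart j) z)\<^sup>2) *
          (ev P0 (heat.G z) * inverse ((ev (pi_chart j) (heat.G z))\<^sup>2) * heat.St z
            + ev Q0 (heat.G z) * inverse ((ev (pi_chart j) (heat.G z))\<^sup>2) * heat.Tt z)
      - ev Q0 z * inverse ((ev (pi_chart j) z)\<^sup>2) *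
          (ev P0 (heat.G z) * inverse ((ev (pi_chart j) (heat.G z))\<^sup>2) * heat.Ss z
            + ev Q0 (heat.G z) * inverse ((ev (pi_chart j) (heat.G z))\<^sup>2) * heat.Ts z) = 0"
      unfolding Ts[folded z] Tt[folded z] uv.Ss_def uv.St_def quot .
    have factor: "(h1 * h2 * b1 * b2) * (p * (p' * st + q' * tt) - q * (p' * ss + q' * ts)) = 0"
      if "p * h1 * b1 * (p' * h2 * b2 * st + q' * h2 * b2 * tt)
        - q * h1 * b1 * (p' * h2 * b2 * ss + q' * h2 * b2 * ts) = 0"
      for p q p' q' h1 h2 b1 b2 ss st ts tt :: complex
    proof -
      have "(h1 * h2 * b1 * b2) * (p * (p' * st + q' * tt) - q * (p' * ss + q' * ts)) =
        p * h1 * b1 * (p' * h2 * b2 * st + q' * h2 * b2 * tt)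
        - q * h1 * b1 * (p' * h2 * b2 * ss + q' * h2 * b2 * ts)"
        by (simp add: algebra_simps)
      then show ?thesis using that by simp
    qed
    from factor[OF 0[unfolded P0 Q0]] show ?case
      using elim(2,3,5,6) by (simp only: mult_eq_0_iff inverse_nonzero_iff_nonzero power_eq_0_iff) simp
  qed
  have rat: "heat.rat (\<lambda>z. ev P z * (ev P (heat.G z) * heat.St z + ev Q (heat.G z) * heat.Tt z) -
      ev Q z * (ev P (heat.G z) * heat.Ss z + ev Q (heat.G z) * heat.Ts z))"
    by (intro heat.rat_diff heat.rat_mult heat.rat_add heat.rat_ev heat.rat_ev_G heat.rat_partials)
  have "heat.invariant P Q"
    unfolding heat.invariant_def
  proof (intro allI impI)
    fix z assume "heat.regular z"
    from heat.rat_eq_0_if_generically_0[OF rat gen this]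
    show "ev P z * (ev P (heat.G z) * heat.St z + ev Q (heat.G z) * heat.Tt z) =
      ev Q z * (ev P (heat.G z) * heat.Ss z + ev Q (heat.G z) * heat.Ts z)"
      by (simp only: right_minus_eq)
  qed
  with PQ(3) show False by (rule no_invariant_foliation)
qed

end

theorem corollary1p3:
  shows "\<not> has_invariant_fibration [1, 1] P1xP1 heat_map"
proof
  assume "has_invariant_fibration [1, 1] P1xP1 heat_map"
  then obtain n Y \<pi> g where "projective_curve n Y" "dominant_rational_map [1, 1] P1xP1 [n] Y \<pi>"
    "rational_map [n] Y [n] Y g" "comp_eq P1xP1 [1, 1] [n] [n] \<pi> heat_map g \<pi>"
    unfolding has_invariant_fibration_def by (elim exE conjE)
  then show False by (rule no_invariant_fibration)
qed

end
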